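(* Let $\mathcal A$, $G_\pm^{IJ}$, the Lorentz generators $\Lambda_L{}^K$, the functionals $F_{\pm L}{}^K$, the quantum Minkowsky coordinates $X_{\pm I}$ and the spinors $\theta_{\pm\alpha},\theta_{\pm\dot\alpha}$ be as in the context. Then for each choice of sign the norm $N_\pm:=G_\pm^{IJ}X_{\pm I}X_{\pm J}$ is invariant, i.e. $$\Delta_L(N_\pm)=I_{\mathcal A}\otimes N_\pm,\qquad \Delta_R(N_\pm)=N_\pm\otimes I_{\mathcal A},$$ and central, i.e. $N_\pm$ commutes with every element of $\mathcal A$, with all coordinates $X_{+P},X_{-P}$, and with all spinors $\theta_{+\alpha},\theta_{-\alpha},\theta_{+\dot\alpha},\theta_{-\dot\alpha}$.
   Context: Conventions. Spinor indices $\alpha,\beta,\dots$ and dotted indices $\dot\alpha,\dot\beta,\dots$ run over $\{1,2\}$; $I,J,K,L,\dots$ run over $\{0,1,2,3\}$. Repeated indices are summed; an undotted index $\alpha$ and the dotted index $\dot\alpha$ with the same letter have the same numerical value. On complex numbers $\star$ is complex conjugation. In formulas with $\pm,\mp$ the upper signs go together and the lower signs go together. Spinor metric. $(\varepsilon_{\alpha\beta})$ is an invertible complex $2\times2$ matrix with inverse $(\varepsilon^{\alpha\beta})$: $\varepsilon^{\alpha\gamma}\varepsilon_{\gamma\beta}=\delta^\alpha_\beta=\varepsilon_{\beta\gamma}\varepsilon^{\gamma\alpha}$. Dotted versions: $\varepsilon_{\dot\beta\dot\alpha}:=(\varepsilon_{\alpha\beta})^\star$, $\varepsilon^{\dot\beta\dot\alpha}:=(\varepsilon^{\alpha\beta})^\star$.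 It is assumed that $\varepsilon_{\dot\beta\dot\alpha}=-\varepsilon^{\alpha\beta}$ and $\varepsilon^{\dot\beta\dot\alpha}=-\varepsilon_{\alpha\beta}$. $R$ matrices. $a\neq0$ is a real number with $a+a^{-1}+\varepsilon^{\alpha\beta}\varepsilon_{\alpha\beta}=0$ (then $a>0$, and $a^{1/2}$ is the positive root), $Q:=a+a^{-1}$, and $R^{\pm\alpha\beta}_{\ \ \gamma\delta}=\delta^\alpha_\gamma\delta^\beta_\delta+a^{\pm1}\varepsilon^{\alpha\beta}\varepsilon_{\gamma\delta}$. Mixed $R$ matrices are defined by $R^{\pm\dot\delta\gamma}_{\ \ \alpha\dot\sigma}:=a^{\pm1/2}R^{\mp\gamma\sigma}_{\ \ \delta\alpha}$ and $R^{\mp\gamma\dot\delta}_{\ \ \dot\sigma\alpha}:=a^{\pm1/2}\varepsilon_{\delta\lambda}R^{\mp\gamma\lambda}_{\ \ \nu\alpha}\varepsilon^{\nu\sigma}$. The $\star$-Hopf algebra $\mathcal A$ (quantum $SL(2,\mathbb C)$). $\mathcal A$ is a complex unital $\star$-algebra with unit $I_{\mathcal A}$ ($\star$ antilinear and antimultiplicative) generated by $M_\alpha{}^\beta$ and $M_{\dot\alpha}{}^{\dot\beta}:=(M_\alpha{}^\beta)^\star$, satisfying $\varepsilon_{\alpha\beta}M_\gamma{}^\alpha M_\delta{}^\beta=\varepsilon_{\gamma\delta}I_{\mathcal A}$, $\varepsilon^{\gamma\delta}M_\gamma{}^\alpha M_\delta{}^\beta=\varepsilon^{\alpha\beta}I_{\mathcal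 A}$, the same relations with all indices dotted, and, for both signs, $M_\alpha{}^\gamma M_{\dot\sigma}{}^{\dot\delta}R^{\pm\dot\rho\beta}_{\ \ \gamma\dot\delta}=R^{\pm\dot\delta\gamma}_{\ \ \alpha\dot\sigma}M_{\dot\delta}{}^{\dot\rho}M_\gamma{}^\beta$. It is a $\star$-Hopf algebra with $\Delta(M_\alpha{}^\beta)=M_\alpha{}^\gamma\otimes M_\gamma{}^\beta$, counit $\varepsilon(M_\alpha{}^\beta)=\delta_\alpha^\beta$, antipode $S(M_\alpha{}^\beta)=\varepsilon_{\alpha\gamma}M_\delta{}^\gamma\varepsilon^{\delta\beta}$, and the same formulas with dotted indices; $S^{-1}(M_{\dot\alpha}{}^{\dot\beta})=\varepsilon^{\dot\beta\dot\delta}M_{\dot\delta}{}^{\dot\gamma}\varepsilon_{\dot\gamma\dot\alpha}$. Convolution. For linear functionals $f,g$ on $\mathcal A$ and $b\in\mathcal A$: $b\star f=(f\otimes \mathrm{id})\Delta(b)$, $f\star b=(\mathrm{id}\otimes f)\Delta(b)$, $(f\star g)(b)=(f\otimes g)\Delta(b)$. Functionals of the bicovariant calculus (given data, standing assumptions). There are linear functionals $f_{\pm\alpha}{}^\beta,\tilde f_{\pm\alpha}{}^\beta,f_{\pm\dot\alpha}{}^{\dot\beta},\tilde f_{\pm\dot\alpha}{}^{\dot\beta}:\mathcal A\to\mathbb C$ such that for all $b,c\in\mathcal A$ (for each sign): - $f_{\alpha}{}^\beta(bc)=f_\alpha{}^\gamma(b)f_\gamma{}^\beta(c)$, $\tilde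 f_\alpha{}^\beta(bc)=\tilde f_\gamma{}^\beta(b)\tilde f_\alpha{}^\gamma(c)$, the same with dotted indices, and each takes the value Kronecker delta at $I_{\mathcal A}$; - $M_\alpha{}^\gamma(f_\gamma{}^\beta\star b)=(b\star f_\alpha{}^\gamma)M_\gamma{}^\beta$, $S(M_\gamma{}^\alpha)(\tilde f_\beta{}^\gamma\star b)=(b\star\tilde f_\gamma{}^\alpha)S(M_\beta{}^\gamma)$, $M_{\dot\alpha}{}^{\dot\gamma}(f_{\dot\gamma}{}^{\dot\beta}\star b)=(b\star f_{\dot\alpha}{}^{\dot\gamma})M_{\dot\gamma}{}^{\dot\beta}$, $S^{-1}(M_{\dot\gamma}{}^{\dot\alpha})(\tilde f_{\dot\beta}{}^{\dot\gamma}\star b)=(b\star\tilde f_{\dot\gamma}{}^{\dot\alpha})S^{-1}(M_{\dot\beta}{}^{\dot\gamma})$; - $f_\alpha{}^\beta=\tilde f_\alpha{}^\beta\circ S$, $f_{\dot\alpha}{}^{\dot\beta}=\tilde f_{\dot\alpha}{}^{\dot\beta}\circ S^{-1}$, $f_\alpha{}^\beta=\varepsilon^{\beta\delta}\tilde f_\delta{}^\gamma\varepsilon_{\gamma\alpha}$, $\tilde f_{\dot\alpha}{}^{\dot\beta}=\varepsilon^{\dot\beta\dot\delta}f_{\dot\delta}{}^{\dot\gamma}\varepsilon_{\dot\gamma\dot\alpha}$; - $f_{\pm\dot\alpha}{}^{\dot\beta}=\tilde f_{\pm\beta}{}^{\alpha}$, $\tilde f_{\pm\dot\alpha}{}^{\dot\beta}=f_{\pm\beta}{}^\alpha$;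 - $(f_{\pm\alpha}{}^\beta(b))^\star=f_{\mp\dot\alpha}{}^{\dot\beta}(S(b^\star))$, $(\tilde f_{\pm\alpha}{}^\beta(b))^\star=\tilde f_{\mp\dot\alpha}{}^{\dot\beta}(S(b^\star))$, and the same with dotted and undotted exchanged; - values on generators: $f_{\pm\gamma}{}^\alpha(M_\delta{}^\rho)=a^{\mp1/2}R^{\pm\rho\alpha}_{\ \ \gamma\delta}$, $f_{\pm\gamma}{}^\alpha(S(M_\delta{}^\rho))=a^{\pm1/2}R^{\mp\alpha\rho}_{\ \ \delta\gamma}$, $f_{\pm\alpha}{}^\gamma(M_{\dot\sigma}{}^{\dot\delta})=R^{\pm\dot\delta\gamma}_{\ \ \alpha\dot\sigma}$, $f_{\pm\alpha}{}^\gamma(S(M_{\dot\sigma}{}^{\dot\delta}))=R^{\mp\gamma\dot\delta}_{\ \ \dot\sigma\alpha}$. Quantum Pauli matrices, metric and Lorentz generators. $\sigma^I=(\sigma^I_{\alpha\dot\beta})$, $I=0,\dots,3$, are four linearly independent hermitean complex $2\times2$ matrices ($(\sigma^I_{\alpha\dot\beta})^\star=\sigma^I_{\beta\dot\alpha}$), and $\overline\sigma_\pm^{I\dot\alpha\beta}:=\varepsilon^{\dot\alpha\dot\lambda}R^{\mp\sigma\dot\rho}_{\ \ \dot\lambda\nu}\varepsilon^{\nu\beta}\sigma^I_{\sigma\dot\rho}$. The metric is $G_\pm^{IJ}:=\frac1Q\varepsilon^{\alpha\nu}\sigma^I_{\alpha\dot\beta}\overline\sigma_\pm^{J\dot\beta\gamma}\varepsilon_{\gamma\nu}$,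 and $(G_{\pm IJ})$ is the inverse matrix of $(G_\pm^{IJ})$. One sets $\overline\sigma_I^{\dot\alpha\beta}:=G_{\pm IJ}\overline\sigma_\pm^{J\dot\alpha\beta}$ (both signs give the same matrices), $\overline\sigma_{L\dot\gamma}{}^{\alpha}:=\varepsilon_{\dot\gamma\dot\delta}\overline\sigma_L^{\dot\delta\alpha}$, $\sigma^K{}_\sigma{}^{\dot\rho}:=\varepsilon^{\dot\rho\dot\beta}\sigma^K_{\sigma\dot\beta}$, and $\Lambda_L{}^K:=\frac1Q\overline\sigma_{L\dot\gamma}{}^\alpha M_\alpha{}^\sigma\sigma^K{}_\sigma{}^{\dot\rho}S^{-1}(M_{\dot\rho}{}^{\dot\gamma})\in\mathcal A$. The functionals $F_\pm$ are $F_{\pm L}{}^K:=\frac1Q\,\overline\sigma_{L\dot\alpha}{}^\delta\,\sigma^K{}_\gamma{}^{\dot\beta}\,(\tilde f_{\mp\dot\beta}{}^{\dot\alpha}\star f_{\pm\delta}{}^\gamma):\mathcal A\to\mathbb C$. Coordinates and spinors. The quantum Minkowsky coordinates $X_{\pm I}$ and the spinors $\theta_{\pm\alpha},\theta_{\pm\dot\alpha}$ are elements of an algebra containing $\mathcal A$ (with the same unit) in which, for all $b\in\mathcal A$, $X_{\pm L}b=(b\star F_{\pm L}{}^K)X_{\pm K}$, $\theta_{\pm\alpha}b=(b\star f_{\pm\alpha}{}^\beta)\theta_{\pm\beta}$, $\theta_{\pm\dot\alpha}b=(b\star f_{\pm\dot\alpha}{}^{\dot\beta})\theta_{\pm\dot\beta}$,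 and which satisfies, for all independent choices of signs $s,t\in\{+,-\}$, the quantum symmetrization relations $X_{sL}X_{tK}=F_{tK}{}^N(S(\Lambda_L{}^M))\,X_{tN}X_{sM}$, $\ \theta_{s\alpha}X_{tK}=F_{tK}{}^N(S(M_\alpha{}^\beta))\,X_{tN}\theta_{s\beta}$, $\ \theta_{s\dot\alpha}X_{tK}=F_{tK}{}^N(S(M_{\dot\alpha}{}^{\dot\beta}))\,X_{tN}\theta_{s\dot\beta}$. The left and right coactions $\Delta_L,\Delta_R$ are multiplicative, extend $\Delta$ on $\mathcal A$, and satisfy $\Delta_L(X_{\pm L})=\Lambda_L{}^K\otimes X_{\pm K}$, $\Delta_R(X_{\pm L})=X_{\pm L}\otimes I_{\mathcal A}$. *)

theory Defs
  imports "HOL-Analysis.Analysis" "HOL-Library.Multiset"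
begin

section \<open>Complex vector spaces and algebras\<close>

class complex_vector = ab_group_add +
  fixes scaleC :: "complex \<Rightarrow> 'a \<Rightarrow> 'a"  (infixr \<open>*\<^sub>C\<close> 75)
  assumes scaleC_add_right: "c *\<^sub>C (x + y) = c *\<^sub>C x + c *\<^sub>C y"
    and scaleC_add_left: "(c + d) *\<^sub>C x = c *\<^sub>C x + d *\<^sub>C x"
    and scaleC_scaleC: "c *\<^sub>C d *\<^sub>C x = (c * d) *\<^sub>C x"
    and scaleC_one: "1 *\<^sub>C x = x"

class complex_algebra_1 = complex_vector + ring_1 +
  assumes mult_scaleC_left: "(c *\<^sub>C x) * y = c *\<^sub>C (x * y)"
    and mult_scaleC_right: "x * (c *\<^sub>C y) = c *\<^sub>C (x * y)"

global_interpretation cvs: vector_space "scaleC :: complex \<Rightarrow> 'a \<Rightarrow> 'a::complex_vector"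
  by unfold_locales
    (simp_all add: scaleC_add_right scaleC_add_left scaleC_scaleC scaleC_one)

global_interpretation cvsp: vector_space_pair
  "scaleC :: complex \<Rightarrow> 'a \<Rightarrow> 'a::complex_vector"
  "scaleC :: complex \<Rightarrow> 'b \<Rightarrow> 'b::complex_vector"
  by unfold_locales

instantiation complex :: complex_algebra_1
begin
definition scaleC_complex :: "complex \<Rightarrow> complex \<Rightarrow> complex"
  where "scaleC_complex c x = c * x"
instance
  by standard (simp_all add: scaleC_complex_def algebra_simps)
end

abbreviation clinear :: "('a::complex_vector \<Rightarrow> 'b::complex_vector) \<Rightarrow> bool"
  where "clinear \<equiv> Vector_Spaces.linear scaleC scaleC"

lemma clinearI:
  assumes "\<And>x y. f (x + y) = f x + f y" "\<And>c x. f (c *\<^sub>C x) = c *\<^sub>C f x"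
  shows "clinear f"
  using assms by unfold_locales

definition alg_hom :: "('a::complex_algebra_1 \<Rightarrow> 'b::complex_algebra_1) \<Rightarrow> bool"
  where "alg_hom h \<longleftrightarrow> clinear h \<and> (\<forall>x y. h (x * y) = h x * h y) \<and> h 1 = 1"

definition subalgebra :: "'a::complex_algebra_1 set \<Rightarrow> bool"
  where "subalgebra B \<longleftrightarrow> cvs.subspace B \<and> 1 \<in> B \<and> (\<forall>x\<in>B. \<forall>y\<in>B. x * y \<in> B)"


section \<open>The algebraic tensor product over the complex numbers\<close>

text \<open>Formal finite sums of pairs \<open>(a, b)\<close>, as multisets, modulo the usual relations. A scalar
  multiple or the negative of a formal sum is obtained by acting on the first components.\<close>

inductive tensor_eq ::
  "('a::complex_vector \<times> 'b::complex_vector) multiset \<Rightarrow> ('a \<times> 'b) multiset \<Rightarrow> bool"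
where
  te_refl: "tensor_eq p p"
| te_sym: "tensor_eq p q \<Longrightarrow> tensor_eq q p"
| te_trans: "tensor_eq p q \<Longrightarrow> tensor_eq q r \<Longrightarrow> tensor_eq p r"
| te_add: "tensor_eq p q \<Longrightarrow> tensor_eq p' q' \<Longrightarrow> tensor_eq (p + p') (q + q')"
| te_left: "tensor_eq {#(a + a', b)#} {#(a, b), (a', b)#}"
| te_right: "tensor_eq {#(a, b + b')#} {#(a, b), (a, b')#}"
| te_scale: "tensor_eq {#(c *\<^sub>C a, b)#} {#(a, c *\<^sub>C b)#}"
| te_zero: "tensor_eq {#(0, b)#} {#}"

quotient_type (overloaded) ('a, 'b) tensor =
    "('a::complex_vector \<times> 'b::complex_vector) multiset" / tensor_eq
  by (intro equivpI reflpI sympI transpI) (blast intro: te_refl te_sym te_trans)+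

lift_definition tens :: "'a::complex_vector \<Rightarrow> 'b::complex_vector \<Rightarrow> ('a, 'b) tensor"
    (infixl \<open>\<otimes>\<close> 70)
  is "\<lambda>a b. {#(a, b)#}" .

lemma tensor_eq_image:
  assumes "tensor_eq p q"
    and "\<And>a a'. g (a + a') = g a + g a'" "\<And>c a. g (c *\<^sub>C a) = c *\<^sub>C g a"
  shows "tensor_eq (image_mset (\<lambda>(a, b). (g a, b)) p) (image_mset (\<lambda>(a, b). (g a, b)) q)"
proof -
  have "g 0 = 0" using assms(2)[of 0 0] by simp
  from assms(1) show ?thesis
    by induction (auto simp: assms \<open>g 0 = 0\<close> intro: tensor_eq.intros)
qed

instantiation tensor :: (complex_vector, complex_vector) complex_vector
begin

lift_definition zero_tensor :: "('a, 'b) tensor" is "{#}" .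

lift_definition plus_tensor :: "('a, 'b) tensor \<Rightarrow> ('a, 'b) tensor \<Rightarrow> ('a, 'b) tensor"
  is "(+)" by (rule te_add)

lift_definition scaleC_tensor :: "complex \<Rightarrow> ('a, 'b) tensor \<Rightarrow> ('a, 'b) tensor"
  is "\<lambda>c. image_mset (\<lambda>(a, b). (c *\<^sub>C a, b))"
  by (rule tensor_eq_image) (auto simp: scaleC_add_right scaleC_scaleC mult.commute)

lift_definition uminus_tensor :: "('a, 'b) tensor \<Rightarrow> ('a, 'b) tensor"
  is "image_mset (\<lambda>(a, b). (- a, b))"
  by (rule tensor_eq_image) auto

definition minus_tensor :: "('a, 'b) tensor \<Rightarrow> ('a, 'b) tensor \<Rightarrow> ('a, 'b) tensor"
  where "minus_tensor x y = x + - y"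

lemma tensor_eq_uminus:
  "tensor_eq (image_mset (\<lambda>(a, b). (- a, b)) p + p) {#}"
proof (induction p)
  case empty
  show ?case by (simp add: te_refl)
next
  case (add ab p)
  obtain a b where ab: "ab = (a, b)" by fastforce
  have "tensor_eq {#(- a, b), (a, b)#} {#(- a + a, b)#}" by (rule te_sym[OF te_left])
  then have "tensor_eq {#(- a, b), (a, b)#} {#}" using te_zero by (auto intro: te_trans)
  from te_add[OF this add.IH] show ?case by (simp add: ab add_mset_commute union_ac)
qed

lemma tensor_eq_scale_add:
  "tensor_eq (image_mset (\<lambda>(a, b). ((c + d) *\<^sub>C a, b)) p)
     (image_mset (\<lambda>(a, b). (c *\<^sub>C a, b)) p + image_mset (\<lambda>(a, b). (d *\<^sub>C a, b)) p)"
proof (induction p)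
  case empty
  show ?case by (simp add: te_refl)
next
  case (add ab p)
  obtain a b where ab: "ab = (a, b)" by fastforce
  have "tensor_eq {#((c + d) *\<^sub>C a, b)#} {#(c *\<^sub>C a, b), (d *\<^sub>C a, b)#}"
    unfolding scaleC_add_left by (rule te_left)
  from te_add[OF this add.IH] show ?case by (simp add: ab add_mset_commute union_ac)
qed

instance
proof
  fix x y z :: "('a, 'b) tensor" and c d :: complex
  show "x + y + z = x + (y + z)" by transfer (simp add: te_refl ac_simps)
  show "x + y = y + x" by transfer (simp add: te_refl ac_simps)
  show "0 + x = x" by transfer (simp add: te_refl)
  show "- x + x = 0" by transfer (rule tensor_eq_uminus)
  show "x - y = x + - y" by (rule minus_tensor_def)
  show "c *\<^sub>C (x + y) = c *\<^sub>C x + c *\<^sub>C y" by transfer (simp add: te_refl)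
  show "(c + d) *\<^sub>C x = c *\<^sub>C x + d *\<^sub>C x" by transfer (rule tensor_eq_scale_add)
  show "c *\<^sub>C d *\<^sub>C x = (c * d) *\<^sub>C x"
    by transfer (simp add: multiset.map_comp comp_def case_prod_unfold scaleC_scaleC te_refl)
  show "1 *\<^sub>C x = x"
    by transfer (simp add: case_prod_unfold scaleC_one te_refl)
qed

end

lemma tens_add_left: "(a + a') \<otimes> b = a \<otimes> b + a' \<otimes> b"
  by transfer (use te_left in \<open>simp add: add_mset_commute\<close>)

lemma tens_add_right: "a \<otimes> (b + b') = a \<otimes> b + a \<otimes> b'"
  by transfer (use te_right in \<open>simp add: add_mset_commute\<close>)

lemma tens_scale_left: "(c *\<^sub>C a) \<otimes> b = c *\<^sub>C (a \<otimes> b)"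
  by transfer (simp add: te_refl)

lemma tens_scale_right: "a \<otimes> (c *\<^sub>C b) = c *\<^sub>C (a \<otimes> b)"
  by (subst tens_scale_left[symmetric], transfer) (simp add: te_scale te_sym)

lemma tensor_induct [case_names zero tens_add]:
  assumes "P 0" "\<And>a b t. P t \<Longrightarrow> P (a \<otimes> b + t)"
  shows "P t"
proof -
  have P0: "P (abs_tensor {#})" using assms(1) by (simp add: zero_tensor_def)
  have "P (abs_tensor p)" for p
  proof (induction p)
    case empty
    show ?case by (rule P0)
  next
    case (add ab p)
    obtain a b where ab: "ab = (a, b)" by fastforce
    have "abs_tensor (add_mset ab p) = a \<otimes> b + abs_tensor p"
      by (simp add: ab tens.abs_eq plus_tensor.abs_eq)
    then show ?case using assms(2)[OF add.IH] by simp
  qed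
  then show ?thesis by (metis Quotient_abs_rep[OF Quotient_tensor])
qed

text \<open>Every biadditive balanced map (in particular every bilinear map, but also a map that is
  antilinear in both arguments) factors through the tensor product. On maps that are
  not balanced the value of \<open>tensor_lift\<close> is irrelevant.\<close>

definition balanced :: "('a::complex_vector \<Rightarrow> 'b::complex_vector \<Rightarrow> 'c::ab_group_add) \<Rightarrow> bool"
  where "balanced h \<longleftrightarrow>
    (\<forall>a a' b. h (a + a') b = h a b + h a' b) \<and>
    (\<forall>a b b'. h a (b + b') = h a b + h a b') \<and>
    (\<forall>c a b. h (c *\<^sub>C a) b = h a (c *\<^sub>C b))"

definition tensor_lift ::
  "('a::complex_vector \<Rightarrow> 'b::complex_vector \<Rightarrow> 'c::ab_group_add) \<Rightarrow> ('a, 'b) tensor \<Rightarrow> 'c"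
  where "tensor_lift h t = (\<Sum>(a, b)\<in>#rep_tensor t. h a b)"

lemma balanced_zero_left: "balanced h \<Longrightarrow> h 0 b = 0"
  unfolding balanced_def by (metis add_cancel_right_left)

lemma tensor_lift_abs:
  assumes h: "balanced h"
  shows "tensor_lift h (abs_tensor p) = (\<Sum>(a, b)\<in>#p. h a b)"
proof -
  have respects: "(\<Sum>(a, b)\<in>#p. h a b) = (\<Sum>(a, b)\<in>#q. h a b)" if "tensor_eq p q" for p q
    using that
  proof induction
    case (te_zero b)
    then show ?case using h by (simp add: balanced_zero_left)
  qed (use h in \<open>simp_all add: balanced_def\<close>)
  have "tensor_eq (rep_tensor (abs_tensor p)) p"
    by (rule Quotient_rep_abs[OF Quotient_tensor]) (rule te_refl)
  from respects[OF this] show ?thesis by (simp add: tensor_lift_def)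
qed

lemma tensor_lift_tens:
  "balanced h \<Longrightarrow> tensor_lift h (a \<otimes> b) = h a b"
  by (simp add: tens.abs_eq tensor_lift_abs)

lemma tensor_lift_zero: "balanced h \<Longrightarrow> tensor_lift h 0 = 0"
  by (simp add: zero_tensor_def tensor_lift_abs)

lemma tensor_lift_add:
  assumes "balanced h"
  shows "tensor_lift h (x + y) = tensor_lift h x + tensor_lift h y"
proof -
  obtain p q where "x = abs_tensor p" "y = abs_tensor q"
    by (metis Quotient_abs_rep[OF Quotient_tensor])
  then show ?thesis using assms by (simp add: plus_tensor.abs_eq tensor_lift_abs)
qed

lemma tensor_lift_scaleC:
  assumes "balanced h" "\<And>c a b. h (c *\<^sub>C a) b = c *\<^sub>C h a b"
  shows "tensor_lift h (c *\<^sub>C x) = c *\<^sub>C tensor_lift h x"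
  by (induction x rule: tensor_induct)
    (simp_all add: assms tensor_lift_zero tensor_lift_add tensor_lift_tens scaleC_add_right
      tens_scale_left[symmetric])

definition tensor_map ::
  "('a::complex_vector \<Rightarrow> 'c::complex_vector) \<Rightarrow> ('b::complex_vector \<Rightarrow> 'd::complex_vector)
    \<Rightarrow> ('a, 'b) tensor \<Rightarrow> ('c, 'd) tensor"
  where "tensor_map f g = tensor_lift (\<lambda>a b. f a \<otimes> g b)"

definition tensor_assoc ::
  "(('a::complex_vector, 'b::complex_vector) tensor, 'c::complex_vector) tensor
    \<Rightarrow> ('a, ('b, 'c) tensor) tensor"
  where "tensor_assoc = tensor_lift (\<lambda>t c. tensor_lift (\<lambda>a b. a \<otimes> (b \<otimes> c)) t)"

subsection \<open>The tensor product of algebras\<close>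

definition tens_mult_left ::
  "'a::complex_algebra_1 \<Rightarrow> 'b::complex_algebra_1 \<Rightarrow> ('a, 'b) tensor \<Rightarrow> ('a, 'b) tensor"
  where "tens_mult_left a b = tensor_lift (\<lambda>c d. (a * c) \<otimes> (b * d))"

lemmas tens_bilinear_simps =
  tens_add_left tens_add_right tens_scale_left tens_scale_right
  mult_scaleC_left mult_scaleC_right distrib_left distrib_right scaleC_add_right

lemma balanced_tens_mult:
  "balanced (\<lambda>c d. ((a::'a::complex_algebra_1) * c) \<otimes> ((b::'b::complex_algebra_1) * d))"
  by (simp add: balanced_def tens_bilinear_simps)

lemmas tens_mult_left_tens = tensor_lift_tens[OF balanced_tens_mult, folded tens_mult_left_def]
lemmas tens_mult_left_zero = tensor_lift_zero[OF balanced_tens_mult, folded tens_mult_left_def]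
lemmas tens_mult_left_add = tensor_lift_add[OF balanced_tens_mult, folded tens_mult_left_def]

lemma tens_mult_left_scaleC: "tens_mult_left a b (c *\<^sub>C y) = c *\<^sub>C tens_mult_left a b y"
  unfolding tens_mult_left_def
  by (rule tensor_lift_scaleC[OF balanced_tens_mult]) (simp add: tens_bilinear_simps)

lemma balanced_tens_mult_left: "balanced (\<lambda>a b. tens_mult_left a b y)"
proof -
  have "tens_mult_left (a + a') b y = tens_mult_left a b y + tens_mult_left a' b y"
    "tens_mult_left a (b + b') y = tens_mult_left a b y + tens_mult_left a b' y"
    "tens_mult_left (c *\<^sub>C a) b y = tens_mult_left a (c *\<^sub>C b) y" for a a' b b' c
    by (induction y rule: tensor_induct;
        simp add: tens_mult_left_zero tens_mult_left_add tens_mult_left_tens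
          tens_bilinear_simps ac_simps)+
  then show ?thesis by (simp add: balanced_def)
qed

lemma ex_functional_one: "\<exists>\<phi> :: 'a::complex_algebra_1 \<Rightarrow> complex. clinear \<phi> \<and> \<phi> 1 = 1"
proof -
  have "cvs.independent {1 :: 'a}" by simp
  from cvsp.linear_independent_extend[OF this, of "\<lambda>_. 1 :: complex"] show ?thesis by auto
qed

instantiation tensor :: (complex_algebra_1, complex_algebra_1) complex_algebra_1
begin

definition times_tensor :: "('a, 'b) tensor \<Rightarrow> ('a, 'b) tensor \<Rightarrow> ('a, 'b) tensor"
  where "times_tensor x y = tensor_lift (\<lambda>a b. tens_mult_left a b y) x"

definition one_tensor :: "('a, 'b) tensor"
  where "one_tensor = 1 \<otimes> 1"

lemma tens_mult_tensor: "(a \<otimes> b) * y = tens_mult_left a b y"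
  by (simp add: times_tensor_def tensor_lift_tens balanced_tens_mult_left)

lemma tensor_dr: "(x + x') * y = x * y + x' * (y :: ('a, 'b) tensor)"
  by (simp add: times_tensor_def tensor_lift_add balanced_tens_mult_left)

lemma tensor_zl: "0 * y = (0 :: ('a, 'b) tensor)"
  by (simp add: times_tensor_def tensor_lift_zero balanced_tens_mult_left)

lemma tensor_zr: "x * 0 = (0 :: ('a, 'b) tensor)"
  by (induction x rule: tensor_induct)
    (simp_all add: tensor_zl tensor_dr tens_mult_tensor tens_mult_left_zero)

lemma tensor_dl: "x * (y + y') = x * y + x * (y' :: ('a, 'b) tensor)"
  by (induction x rule: tensor_induct)
    (simp_all add: tensor_zl tensor_dr tens_mult_tensor tens_mult_left_add algebra_simps)

lemma tens_mult_tens: "(a \<otimes> b) * (c \<otimes> d) = (a * c) \<otimes> (b * d)"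
  by (simp add: tens_mult_tensor tens_mult_left_tens)

lemma one_neq_zero_tensor: "(1 :: 'a) \<otimes> (1 :: 'b) \<noteq> 0"
proof -
  obtain \<phi> :: "'a \<Rightarrow> complex" and \<psi> :: "'b \<Rightarrow> complex" where
    \<phi>: "clinear \<phi>" "\<phi> 1 = 1" and \<psi>: "clinear \<psi>" "\<psi> 1 = 1" using ex_functional_one by metis
  have h: "balanced (\<lambda>a b. \<phi> a * \<psi> b)"
    using \<phi> \<psi> 
    by (simp add: balanced_def cvsp.linear_add cvsp.linear_scale scaleC_complex_def algebra_simps)
  have "tensor_lift (\<lambda>a b. \<phi> a * \<psi> b) (1 \<otimes> 1) = 1"
    by (simp add: tensor_lift_tens[OF h] \<phi> \<psi>)
  then show ?thesis using tensor_lift_zero[OF h] by auto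
qed

lemma tensor_assoc_mult: "x * y * z = x * (y * (z :: ('a, 'b) tensor))"
proof -
  have 1: "(a \<otimes> b) * (c \<otimes> d) * z = (a \<otimes> b) * ((c \<otimes> d) * z)"
    for a c :: 'a and b d :: 'b
    by (induction z rule: tensor_induct)
      (simp_all add: tensor_zr tensor_dl tens_mult_tens mult.assoc)
  have 2: "(a \<otimes> b) * y * z = (a \<otimes> b) * (y * z)" for a b
    by (induction y rule: tensor_induct) (simp_all add: 1 tensor_zr tensor_zl tensor_dl tensor_dr)
  show ?thesis
    by (induction x rule: tensor_induct) (simp_all add: 2 tensor_zl tensor_dr)
qed

lemma tensor_scale_left: "(c *\<^sub>C x) * y = c *\<^sub>C (x * (y :: ('a, 'b) tensor))"
proof (induction x rule: tensor_induct)
  case zero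
  show ?case by (simp add: tensor_zl)
next
  case (tens_add a b t)
  have "((c *\<^sub>C a) \<otimes> b) * y = c *\<^sub>C ((a \<otimes> b) * y)"
    by (induction y rule: tensor_induct)
      (simp_all add: tensor_zr tensor_dl tens_mult_tens mult_scaleC_left scaleC_add_right
        tens_scale_left[symmetric])
  then show ?case
    by (simp add: scaleC_add_right tensor_dr tens_add tens_scale_left)
qed

lemma tensor_scale_right: "x * (c *\<^sub>C y) = c *\<^sub>C (x * (y :: ('a, 'b) tensor))"
  by (induction x rule: tensor_induct)
    (simp_all add: tensor_zl tensor_dr tens_mult_tensor tens_mult_left_scaleC scaleC_add_right)

instance
proof
  fix x y z :: "('a, 'b) tensor" and c :: complex
  show "x * y * z = x * (y * z)" by (rule tensor_assoc_mult)
  show "1 * x = x"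
    by (induction x rule: tensor_induct)
      (simp_all add: one_tensor_def tensor_zr tensor_dl tens_mult_tens)
  show "x * 1 = x"
    by (induction x rule: tensor_induct)
      (simp_all add: one_tensor_def tensor_zl tensor_dr tens_mult_tens)
  show "(x + y) * z = x * z + y * z" by (rule tensor_dr)
  show "x * (y + z) = x * y + x * z" by (rule tensor_dl)
  show "(0 :: ('a, 'b) tensor) \<noteq> 1" using one_neq_zero_tensor by (simp add: one_tensor_def)
  show "(c *\<^sub>C x) * y = c *\<^sub>C (x * y)" by (rule tensor_scale_left)
  show "x * (c *\<^sub>C y) = c *\<^sub>C (x * y)" by (rule tensor_scale_right)
qed

end


section \<open>Convolution\<close>

text \<open>For a coproduct \<open>D\<close>: \<open>elt_conv D b f\<close> is \<open>b \<star> f = (f \<otimes> id) (D b)\<close>, \<open>conv_elt D f b\<close> is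
  \<open>f \<star> b = (id \<otimes> f) (D b)\<close>, and \<open>conv D f g\<close> is the product \<open>f \<star> g\<close> of two functionals.\<close>

definition elt_conv ::
  "('a::complex_vector \<Rightarrow> ('a, 'a) tensor) \<Rightarrow> 'a \<Rightarrow> ('a \<Rightarrow> complex) \<Rightarrow> 'a"
  where "elt_conv D b f = tensor_lift (\<lambda>x y. f x *\<^sub>C y) (D b)"

definition conv_elt ::
  "('a::complex_vector \<Rightarrow> ('a, 'a) tensor) \<Rightarrow> ('a \<Rightarrow> complex) \<Rightarrow> 'a \<Rightarrow> 'a"
  where "conv_elt D f b = tensor_lift (\<lambda>x y. f y *\<^sub>C x) (D b)"

definition conv ::
  "('a::complex_vector \<Rightarrow> ('a, 'a) tensor) \<Rightarrow> ('a \<Rightarrow> complex) \<Rightarrow> ('a \<Rightarrow> complex) \<Rightarrow> 'a \<Rightarrow> complex"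
  where "conv D f g b = tensor_lift (\<lambda>x y. f x * g y) (D b)"


section \<open>Spinor metric, R matrices and quantum Pauli matrices\<close>

text \<open>Signs label the two calculi: \<open>spow x s\<close> is \<open>x\<close> or \<open>1/x\<close>, i.e. the upper (lower) sign of
  \<open>x\<^bsup>\<plusminus>1\<^esup>\<close>, and \<open>opp s\<close> turns \<open>\<plusminus>\<close> into \<open>\<mp>\<close>.\<close>

datatype sign = Plus | Minus

fun opp :: "sign \<Rightarrow> sign" where
  "opp Plus = Minus"
| "opp Minus = Plus"

definition spow :: "real \<Rightarrow> sign \<Rightarrow> complex"
  where "spow x s = of_real (case s of Plus \<Rightarrow> x | Minus \<Rightarrow> inverse x)"

definition kron :: "'i \<Rightarrow> 'i \<Rightarrow> complex"
  where "kron i j = (if i = j then 1 else 0)"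

text \<open>Spinor indices, dotted or not, have type \<open>2\<close>; vector indices have type \<open>4\<close>, whose elements
  are \<open>0, 1, 2, 3\<close>. Arguments are listed in the order of the indices in the symbol, for \<open>R\<close> the
  upper ones first: \<open>eps \<alpha> \<beta>\<close> is \<open>\<epsilon>\<close> with lower indices, \<open>epsu \<alpha> \<beta>\<close> with upper ones, \<open>epsd\<close> and
  \<open>epsud\<close> are the dotted versions of \<open>eps\<close> and \<open>epsu\<close>.\<close>

locale spinor_metric =
  fixes eps epsu :: "2 \<Rightarrow> 2 \<Rightarrow> complex" and a :: real
  assumes epsu_eps: "(\<Sum>\<gamma>\<in>UNIV. epsu \<alpha> \<gamma> * eps \<gamma> \<beta>) = kron \<alpha> \<beta>"
    and eps_epsu: "(\<Sum>\<gamma>\<in>UNIV. eps \<beta> \<gamma> * epsu \<gamma> \<alpha>) = kron \<alpha> \<beta>"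
    and cnj_eps: "cnj (eps \<alpha> \<beta>) = - epsu \<alpha> \<beta>"
    and cnj_epsu: "cnj (epsu \<alpha> \<beta>) = - eps \<alpha> \<beta>"
    and a_nonzero: "a \<noteq> 0"
    and a_eq: "of_real (a + inverse a) + (\<Sum>\<alpha>\<in>UNIV. \<Sum>\<beta>\<in>UNIV. epsu \<alpha> \<beta> * eps \<alpha> \<beta>) = 0"
begin

definition epsd :: "2 \<Rightarrow> 2 \<Rightarrow> complex" where "epsd \<beta> \<alpha> = cnj (eps \<alpha> \<beta>)"
definition epsud :: "2 \<Rightarrow> 2 \<Rightarrow> complex" where "epsud \<beta> \<alpha> = cnj (epsu \<alpha> \<beta>)"

definition Q :: complex where "Q = of_real (a + inverse a)"

definition R :: "sign \<Rightarrow> 2 \<Rightarrow> 2 \<Rightarrow> 2 \<Rightarrow> 2 \<Rightarrow> complex"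
  where "R s \<alpha> \<beta> \<gamma> \<delta> = kron \<alpha> \<gamma> * kron \<beta> \<delta> + spow a s * epsu \<alpha> \<beta> * eps \<gamma> \<delta>"

text \<open>The mixed \<open>R\<close> matrices: in \<open>Rdu s \<delta> \<gamma> \<alpha> \<sigma>\<close> the indices \<open>\<delta>\<close> and \<open>\<sigma>\<close> are dotted, in
  \<open>Rud s \<gamma> \<delta> \<sigma> \<alpha>\<close> again \<open>\<delta>\<close> and \<open>\<sigma>\<close>. The sign \<open>s\<close> is the one carried by the mixed matrix, so
  that the prefactor of \<open>Rud s\<close> has the opposite exponent. Both square roots are positive
  because the assumptions imply \<open>a > 0\<close>.\<close>

definition Rdu :: "sign \<Rightarrow> 2 \<Rightarrow> 2 \<Rightarrow> 2 \<Rightarrow> 2 \<Rightarrow> complex"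
  where "Rdu s \<delta> \<gamma> \<alpha> \<sigma> = spow (sqrt a) s * R (opp s) \<gamma> \<sigma> \<delta> \<alpha>"

definition Rud :: "sign \<Rightarrow> 2 \<Rightarrow> 2 \<Rightarrow> 2 \<Rightarrow> 2 \<Rightarrow> complex"
  where "Rud s \<gamma> \<delta> \<sigma> \<alpha> =
    spow (sqrt a) (opp s) * (\<Sum>\<mu>\<in>UNIV. \<Sum>\<nu>\<in>UNIV. eps \<delta> \<mu> * R s \<gamma> \<mu> \<nu> \<alpha> * epsu \<nu> \<sigma>)"

end

text \<open>\<open>sig I \<alpha> \<beta>\<close> has undotted \<open>\<alpha>\<close> and dotted \<open>\<beta>\<close>, both lower; \<open>sbar s I \<alpha> \<beta>\<close> has dotted \<open>\<alpha>\<close> and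
  undotted \<open>\<beta>\<close>, both upper.\<close>

locale quantum_pauli = spinor_metric eps epsu a
  for eps epsu :: "2 \<Rightarrow> 2 \<Rightarrow> complex" and a :: real +
  fixes sig :: "4 \<Rightarrow> 2 \<Rightarrow> 2 \<Rightarrow> complex"
  assumes sig_hermitian: "cnj (sig I \<alpha> \<beta>) = sig I \<beta> \<alpha>"
    and sig_independent:
      "(\<And>\<alpha> \<beta>. (\<Sum>I\<in>UNIV. k I * sig I \<alpha> \<beta>) = 0) \<Longrightarrow> k = (\<lambda>I. 0)"
begin

definition sbar :: "sign \<Rightarrow> 4 \<Rightarrow> 2 \<Rightarrow> 2 \<Rightarrow> complex"
  where "sbar s I \<alpha> \<beta> =
    (\<Sum>\<mu>\<in>UNIV. \<Sum>\<sigma>\<in>UNIV. \<Sum>\<rho>\<in>UNIV. \<Sum>\<nu>\<in>UNIV.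
      epsud \<alpha> \<mu> * Rud (opp s) \<sigma> \<rho> \<mu> \<nu> * epsu \<nu> \<beta> * sig I \<sigma> \<rho>)"

definition G :: "sign \<Rightarrow> complex^4^4"
  where "G s = (\<chi> I J. 1 / Q *
    (\<Sum>\<alpha>\<in>UNIV. \<Sum>\<nu>\<in>UNIV. \<Sum>\<beta>\<in>UNIV. \<Sum>\<gamma>\<in>UNIV.
      epsu \<alpha> \<nu> * sig I \<alpha> \<beta> * sbar s J \<beta> \<gamma> * eps \<gamma> \<nu>))"

text \<open>\<open>sbar\<close> with lowered vector index. The upper sign is used; the lower sign gives the same
  matrices.\<close>

definition sbar_low :: "4 \<Rightarrow> 2 \<Rightarrow> 2 \<Rightarrow> complex"
  where "sbar_low I \<alpha> \<beta> = (\<Sum>J\<in>UNIV. matrix_inv (G Plus) $ I $ J * sbar Plus J \<alpha> \<beta>)"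

text \<open>The mixed versions: \<open>sbar_mix L \<gamma> \<alpha>\<close> has dotted lower \<open>\<gamma>\<close> and upper \<open>\<alpha>\<close>; \<open>sig_mix K \<sigma> \<rho>\<close> has
  lower \<open>\<sigma>\<close> and dotted upper \<open>\<rho>\<close>.\<close>

definition sbar_mix :: "4 \<Rightarrow> 2 \<Rightarrow> 2 \<Rightarrow> complex"
  where "sbar_mix L \<gamma> \<alpha> = (\<Sum>\<delta>\<in>UNIV. epsd \<gamma> \<delta> * sbar_low L \<delta> \<alpha>)"

definition sig_mix :: "4 \<Rightarrow> 2 \<Rightarrow> 2 \<Rightarrow> complex"
  where "sig_mix K \<sigma> \<rho> = (\<Sum>\<beta>\<in>UNIV. epsud \<rho> \<beta> * sig K \<sigma> \<beta>)"

end


section \<open>Star Hopf algebras and quantum SL(2,C)\<close>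

locale star_hopf_algebra =
  fixes star :: "'a::complex_algebra_1 \<Rightarrow> 'a"
    and Delta :: "'a \<Rightarrow> ('a, 'a) tensor"
    and counit :: "'a \<Rightarrow> complex"
    and S :: "'a \<Rightarrow> 'a"
  assumes star_add: "star (b + c) = star b + star c"
    and star_scale: "star (k *\<^sub>C b) = cnj k *\<^sub>C star b"
    and star_mult: "star (b * c) = star c * star b"
    and star_star: "star (star b) = b"
    and Delta_hom: "alg_hom Delta"
    and counit_hom: "alg_hom counit"
    and S_linear: "clinear S"
    and coassoc: "tensor_assoc (tensor_map Delta id (Delta b)) = tensor_map id Delta (Delta b)"
    and counit_left: "tensor_lift (\<lambda>x y. counit x *\<^sub>C y) (Delta b) = b"
    and counit_right: "tensor_lift (\<lambda>x y. counit y *\<^sub>C x) (Delta b) = b"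
    and antipode_left: "tensor_lift (\<lambda>x y. S x * y) (Delta b) = counit b *\<^sub>C 1"
    and antipode_right: "tensor_lift (\<lambda>x y. x * S y) (Delta b) = counit b *\<^sub>C 1"
    and Delta_star: "Delta (star b) = tensor_map star star (Delta b)"
    and counit_star: "counit (star b) = cnj (counit b)"
    and S_bij: "bij S"

text \<open>\<open>M \<alpha> \<beta>\<close> has lower index \<open>\<alpha>\<close> and upper index \<open>\<beta>\<close>, and so have \<open>Md\<close> and all
  functionals below.\<close>

locale quantum_SL2C =
  spinor_metric eps epsu a + star_hopf_algebra star Delta counit S
  for eps epsu :: "2 \<Rightarrow> 2 \<Rightarrow> complex" and a :: real
    and star :: "'a::complex_algebra_1 \<Rightarrow> 'a" and Delta counit S +
  fixes M Md :: "2 \<Rightarrow> 2 \<Rightarrow> 'a"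
  assumes Md_eq: "Md \<alpha> \<beta> = star (M \<alpha> \<beta>)"
    and generated: "subalgebra hull ({M \<alpha> \<beta> |\<alpha> \<beta>. True} \<union> {Md \<alpha> \<beta> |\<alpha> \<beta>. True}) = UNIV"
    and eps_M_M:
      "(\<Sum>\<alpha>\<in>UNIV. \<Sum>\<beta>\<in>UNIV. eps \<alpha> \<beta> *\<^sub>C (M \<gamma> \<alpha> * M \<delta> \<beta>)) = eps \<gamma> \<delta> *\<^sub>C 1"
    and epsu_M_M:
      "(\<Sum>\<gamma>\<in>UNIV. \<Sum>\<delta>\<in>UNIV. epsu \<gamma> \<delta> *\<^sub>C (M \<gamma> \<alpha> * M \<delta> \<beta>)) = epsu \<alpha> \<beta> *\<^sub>C 1"
    and epsd_Md_Md:
      "(\<Sum>\<alpha>\<in>UNIV. \<Sum>\<beta>\<in>UNIV. epsd \<alpha> \<beta> *\<^sub>C (Md \<gamma> \<alpha> * Md \<delta> \<beta>)) = epsd \<gamma> \<delta> *\<^sub>C 1"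
    and epsud_Md_Md:
      "(\<Sum>\<gamma>\<in>UNIV. \<Sum>\<delta>\<in>UNIV. epsud \<gamma> \<delta> *\<^sub>C (Md \<gamma> \<alpha> * Md \<delta> \<beta>)) = epsud \<alpha> \<beta> *\<^sub>C 1"
    and M_Md_R:
      "(\<Sum>\<gamma>\<in>UNIV. \<Sum>\<delta>\<in>UNIV. Rdu s \<rho> \<beta> \<gamma> \<delta> *\<^sub>C (M \<alpha> \<gamma> * Md \<sigma> \<delta>)) =
       (\<Sum>\<delta>\<in>UNIV. \<Sum>\<gamma>\<in>UNIV. Rdu s \<delta> \<gamma> \<alpha> \<sigma> *\<^sub>C (Md \<delta> \<rho> * M \<gamma> \<beta>))"
    and Delta_M: "Delta (M \<alpha> \<beta>) = (\<Sum>\<gamma>\<in>UNIV. M \<alpha> \<gamma> \<otimes> M \<gamma> \<beta>)"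
    and Delta_Md: "Delta (Md \<alpha> \<beta>) = (\<Sum>\<gamma>\<in>UNIV. Md \<alpha> \<gamma> \<otimes> Md \<gamma> \<beta>)"
    and counit_M: "counit (M \<alpha> \<beta>) = kron \<alpha> \<beta>"
    and counit_Md: "counit (Md \<alpha> \<beta>) = kron \<alpha> \<beta>"
    and S_M: "S (M \<alpha> \<beta>) =
      (\<Sum>\<gamma>\<in>UNIV. \<Sum>\<delta>\<in>UNIV. (eps \<alpha> \<gamma> * epsu \<delta> \<beta>) *\<^sub>C M \<delta> \<gamma>)"
    and S_Md: "S (Md \<alpha> \<beta>) =
      (\<Sum>\<gamma>\<in>UNIV. \<Sum>\<delta>\<in>UNIV. (epsd \<alpha> \<gamma> * epsud \<delta> \<beta>) *\<^sub>C Md \<delta> \<gamma>)"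
    and inv_S_Md: "inv S (Md \<alpha> \<beta>) =
      (\<Sum>\<delta>\<in>UNIV. \<Sum>\<gamma>\<in>UNIV. (epsud \<beta> \<delta> * epsd \<gamma> \<alpha>) *\<^sub>C Md \<delta> \<gamma>)"


section \<open>The functionals of the bicovariant calculus and the Lorentz generators\<close>

text \<open>\<open>f\<close>, \<open>ft\<close> are the functionals with undotted indices without and with tilde, \<open>fd\<close>, \<open>ftd\<close>
  those with dotted indices.\<close>

locale bicovariant_functionals =
  quantum_SL2C eps epsu a star Delta counit S M Md
  for eps epsu :: "2 \<Rightarrow> 2 \<Rightarrow> complex" and a :: real
    and star :: "'a::complex_algebra_1 \<Rightarrow> 'a" and Delta counit S
    and M Md :: "2 \<Rightarrow> 2 \<Rightarrow> 'a" +
  fixes f ft fd ftd :: "sign \<Rightarrow> 2 \<Rightarrow> 2 \<Rightarrow> 'a \<Rightarrow> complex"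
  assumes linear:
      "clinear (f s \<alpha> \<beta>)" "clinear (ft s \<alpha> \<beta>)" "clinear (fd s \<alpha> \<beta>)" "clinear (ftd s \<alpha> \<beta>)"
    and f_mult: "f s \<alpha> \<beta> (b * c) = (\<Sum>\<gamma>\<in>UNIV. f s \<alpha> \<gamma> b * f s \<gamma> \<beta> c)"
    and ft_mult: "ft s \<alpha> \<beta> (b * c) = (\<Sum>\<gamma>\<in>UNIV. ft s \<gamma> \<beta> b * ft s \<alpha> \<gamma> c)"
    and fd_mult: "fd s \<alpha> \<beta> (b * c) = (\<Sum>\<gamma>\<in>UNIV. fd s \<alpha> \<gamma> b * fd s \<gamma> \<beta> c)"
    and ftd_mult: "ftd s \<alpha> \<beta> (b * c) = (\<Sum>\<gamma>\<in>UNIV. ftd s \<gamma> \<beta> b * ftd s \<alpha> \<gamma> c)"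
    and at_one:
      "f s \<alpha> \<beta> 1 = kron \<alpha> \<beta>" "ft s \<alpha> \<beta> 1 = kron \<alpha> \<beta>"
      "fd s \<alpha> \<beta> 1 = kron \<alpha> \<beta>" "ftd s \<alpha> \<beta> 1 = kron \<alpha> \<beta>"
    and M_f: "(\<Sum>\<gamma>\<in>UNIV. M \<alpha> \<gamma> * conv_elt Delta (f s \<gamma> \<beta>) b) =
      (\<Sum>\<gamma>\<in>UNIV. elt_conv Delta b (f s \<alpha> \<gamma>) * M \<gamma> \<beta>)"
    and S_M_ft: "(\<Sum>\<gamma>\<in>UNIV. S (M \<gamma> \<alpha>) * conv_elt Delta (ft s \<beta> \<gamma>) b) =
      (\<Sum>\<gamma>\<in>UNIV. elt_conv Delta b (ft s \<gamma> \<alpha>) * S (M \<beta> \<gamma>))"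
    and Md_fd: "(\<Sum>\<gamma>\<in>UNIV. Md \<alpha> \<gamma> * conv_elt Delta (fd s \<gamma> \<beta>) b) =
      (\<Sum>\<gamma>\<in>UNIV. elt_conv Delta b (fd s \<alpha> \<gamma>) * Md \<gamma> \<beta>)"
    and inv_S_Md_ftd: "(\<Sum>\<gamma>\<in>UNIV. inv S (Md \<gamma> \<alpha>) * conv_elt Delta (ftd s \<beta> \<gamma>) b) =
      (\<Sum>\<gamma>\<in>UNIV. elt_conv Delta b (ftd s \<gamma> \<alpha>) * inv S (Md \<beta> \<gamma>))"
    and f_ft_S: "f s \<alpha> \<beta> = ft s \<alpha> \<beta> \<circ> S"
    and fd_ftd_inv_S: "fd s \<alpha> \<beta> = ftd s \<alpha> \<beta> \<circ> inv S"
    and f_ft_eps: "f s \<alpha> \<beta> b = (\<Sum>\<delta>\<in>UNIV. \<Sum>\<gamma>\<in>UNIV. epsu \<beta> \<delta> * ft s \<delta> \<gamma> b * eps \<gamma> \<alpha>)"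
    and ftd_fd_eps: "ftd s \<alpha> \<beta> b = (\<Sum>\<delta>\<in>UNIV. \<Sum>\<gamma>\<in>UNIV. epsud \<beta> \<delta> * fd s \<delta> \<gamma> b * epsd \<gamma> \<alpha>)"
    and fd_ft: "fd s \<alpha> \<beta> = ft s \<beta> \<alpha>"
    and ftd_f: "ftd s \<alpha> \<beta> = f s \<beta> \<alpha>"
    and cnj_f: "cnj (f s \<alpha> \<beta> b) = fd (opp s) \<alpha> \<beta> (S (star b))"
    and cnj_ft: "cnj (ft s \<alpha> \<beta> b) = ftd (opp s) \<alpha> \<beta> (S (star b))"
    and cnj_fd: "cnj (fd s \<alpha> \<beta> b) = f (opp s) \<alpha> \<beta> (S (star b))"
    and cnj_ftd: "cnj (ftd s \<alpha> \<beta> b) = ft (opp s) \<alpha> \<beta> (S (star b))"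
    and f_M: "f s \<gamma> \<alpha> (M \<delta> \<rho>) = spow (sqrt a) (opp s) * R s \<rho> \<alpha> \<gamma> \<delta>"
    and f_S_M: "f s \<gamma> \<alpha> (S (M \<delta> \<rho>)) = spow (sqrt a) s * R (opp s) \<alpha> \<rho> \<delta> \<gamma>"
    and f_Md: "f s \<alpha> \<gamma> (Md \<sigma> \<delta>) = Rdu s \<delta> \<gamma> \<alpha> \<sigma>"
    and f_S_Md: "f s \<alpha> \<gamma> (S (Md \<sigma> \<delta>)) = Rud (opp s) \<gamma> \<delta> \<sigma> \<alpha>"

locale quantum_lorentz =
  quantum_pauli eps epsu a sig +
  bicovariant_functionals eps epsu a star Delta counit S M Md f ft fd ftd
  for eps epsu :: "2 \<Rightarrow> 2 \<Rightarrow> complex" and a :: real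
    and star :: "'a::complex_algebra_1 \<Rightarrow> 'a" and Delta counit S
    and M Md :: "2 \<Rightarrow> 2 \<Rightarrow> 'a"
    and f ft fd ftd :: "sign \<Rightarrow> 2 \<Rightarrow> 2 \<Rightarrow> 'a \<Rightarrow> complex"
    and sig :: "4 \<Rightarrow> 2 \<Rightarrow> 2 \<Rightarrow> complex"
begin

definition Lambda :: "4 \<Rightarrow> 4 \<Rightarrow> 'a"
  where "Lambda L K = (1 / Q) *\<^sub>C
    (\<Sum>\<gamma>\<in>UNIV. \<Sum>\<alpha>\<in>UNIV. \<Sum>\<sigma>\<in>UNIV. \<Sum>\<rho>\<in>UNIV.
      (sbar_mix L \<gamma> \<alpha> * sig_mix K \<sigma> \<rho>) *\<^sub>C (M \<alpha> \<sigma> * inv S (Md \<rho> \<gamma>)))"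

definition F :: "sign \<Rightarrow> 4 \<Rightarrow> 4 \<Rightarrow> 'a \<Rightarrow> complex"
  where "F s L K b = 1 / Q *
    (\<Sum>\<alpha>\<in>UNIV. \<Sum>\<delta>\<in>UNIV. \<Sum>\<gamma>\<in>UNIV. \<Sum>\<beta>\<in>UNIV.
      sbar_mix L \<alpha> \<delta> * sig_mix K \<gamma> \<beta> * conv Delta (ftd (opp s) \<beta> \<alpha>) (f s \<delta> \<gamma>) b)"

end


section \<open>Quantum Minkowski coordinates and spinors\<close>

text \<open>The algebra in which the coordinates and spinors live is the type \<open>'e\<close>; the
  inclusion of the Hopf algebra is \<open>iota\<close>. \<open>th\<close> and \<open>thd\<close> are the spinors with undotted and
  dotted index, \<open>DL\<close> and \<open>DR\<close> the left and right coactions.\<close>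

locale quantum_minkowski =
  quantum_lorentz eps epsu a star Delta counit S M Md f ft fd ftd sig
  for eps epsu :: "2 \<Rightarrow> 2 \<Rightarrow> complex" and a :: real
    and star :: "'a::complex_algebra_1 \<Rightarrow> 'a" and Delta counit S
    and M Md :: "2 \<Rightarrow> 2 \<Rightarrow> 'a"
    and f ft fd ftd :: "sign \<Rightarrow> 2 \<Rightarrow> 2 \<Rightarrow> 'a \<Rightarrow> complex"
    and sig :: "4 \<Rightarrow> 2 \<Rightarrow> 2 \<Rightarrow> complex" +
  fixes iota :: "'a \<Rightarrow> 'e::complex_algebra_1"
    and X :: "sign \<Rightarrow> 4 \<Rightarrow> 'e"
    and th thd :: "sign \<Rightarrow> 2 \<Rightarrow> 'e"
    and DL :: "'e \<Rightarrow> ('a, 'e) tensor"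
    and DR :: "'e \<Rightarrow> ('e, 'a) tensor"
  assumes iota_hom: "alg_hom iota"
    and iota_inj: "inj iota"
    and X_iota: "X s L * iota b = (\<Sum>K\<in>UNIV. iota (elt_conv Delta b (F s L K)) * X s K)"
    and th_iota: "th s \<alpha> * iota b = (\<Sum>\<beta>\<in>UNIV. iota (elt_conv Delta b (f s \<alpha> \<beta>)) * th s \<beta>)"
    and thd_iota: "thd s \<alpha> * iota b = (\<Sum>\<beta>\<in>UNIV. iota (elt_conv Delta b (fd s \<alpha> \<beta>)) * thd s \<beta>)"
    and X_X: "X s L * X t K =
      (\<Sum>N\<in>UNIV. \<Sum>M'\<in>UNIV. F t K N (S (Lambda L M')) *\<^sub>C (X t N * X s M'))"
    and th_X: "th s \<alpha> * X t K =
      (\<Sum>N\<in>UNIV. \<Sum>\<beta>\<in>UNIV. F t K N (S (M \<alpha> \<beta>)) *\<^sub>C (X t N * th s \<beta>))"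
    and thd_X: "thd s \<alpha> * X t K =
      (\<Sum>N\<in>UNIV. \<Sum>\<beta>\<in>UNIV. F t K N (S (Md \<alpha> \<beta>)) *\<^sub>C (X t N * thd s \<beta>))"
    and DL_hom: "alg_hom DL"
    and DL_coassoc: "tensor_assoc (tensor_map Delta id (DL x)) = tensor_map id DL (DL x)"
    and DL_counit: "tensor_lift (\<lambda>b y. counit b *\<^sub>C y) (DL x) = x"
    and DL_iota: "DL (iota b) = tensor_map id iota (Delta b)"
    and DL_X: "DL (X s L) = (\<Sum>K\<in>UNIV. Lambda L K \<otimes> X s K)"
    and DR_hom: "alg_hom DR"
    and DR_coassoc: "tensor_assoc (tensor_map DR id (DR x)) = tensor_map id Delta (DR x)"
    and DR_counit: "tensor_lift (\<lambda>y b. counit b *\<^sub>C y) (DR x) = x"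
    and DR_iota: "DR (iota b) = tensor_map iota id (Delta b)"
    and DR_X: "DR (X s L) = X s L \<otimes> 1"

end

theory Submission
  imports Defs
begin

text \<open>
  The proof is a Kauffman bracket argument. Put \<open>r = \<surd>a\<close>. The matrix \<open>\<epsilon>\<close> with lower or upper
  indices plays the part of a cap or a cup, the closed loop \<open>\<epsilon>\<^sup>\<alpha>\<^sup>\<beta> \<epsilon>\<^sub>\<alpha>\<^sub>\<beta>\<close> has the value \<open>- r\<^sup>2 - r\<^sup>-\<^sup>2\<close>, and every
  \<open>R\<close> matrix, mixed or not, is a rescaled crossing \<open>r\<^sup>-\<^sup>1 id + r (cup cap)\<close> or its mirror image. In the
  spinor basis given by the quantum Pauli matrices the metric \<open>G\<^sub>\<plusminus>\<close> is, up to the factor \<open>-1/Q\<close>,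
  two cups on four strands that cross once (\<open>G_frame\<close>, \<open>crossed_cups_crossing\<close>).

  A family of operators with spinor indices \<open>P\<close> and a family \<open>N\<close>, attached to the odd and the even
  strands, leaves these crossed cups invariant as soon as it can be slid through the crossing and
  both families leave the cup invariant (\<open>crossed_cups_invariant\<close>). This one fact is used twice.

  For left multiplication by \<open>M\<close> and by \<open>S\<^sup>-\<^sup>1(M)\<close> with dotted indices, whose combination is \<open>\<Lambda>\<close>, the
  conditions are the defining relations of the quantum group, and the conclusion
  \<open>G\<^sup>I\<^sup>J \<Lambda>\<^sub>I\<^sup>K \<Lambda>\<^sub>J\<^sup>L = G\<^sup>K\<^sup>L\<close> is the invariance of the norm.

  For the operators \<open>b \<mapsto> b \<star> f\<^sub>\<plusminus>\<close> and \<open>b \<mapsto> b \<star> f\<^sub>\<mp>\<close>, whose combination is \<open>b \<mapsto> b \<star> F\<^sub>\<plusminus>\<close>, the cup condition is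
  the antipode axiom, because \<open>f = ft \<circ> S\<close> is up to \<open>\<epsilon>\<close> the transpose of \<open>ft\<close>, and the sliding condition
  results from evaluating one functional \<open>f\<close> on the commutation rule of \<open>M\<close> with \<open>f \<star> b\<close>. The
  conclusion \<open>G\<^sup>I\<^sup>J (F\<^sub>J\<^sup>L \<star> F\<^sub>I\<^sup>K) = G\<^sup>K\<^sup>L counit\<close> says that the norm commutes with the Hopf algebra.

  Finally, commuting a coordinate or a spinor with the norm amounts to evaluating the same
  combination of \<open>F\<close> on the antipodes of a matrix \<open>T\<close> that is \<open>\<Lambda>\<close>, \<open>M\<close> or its dotted version. Since the matrix
  \<open>F(S(T))\<close> is inverse to \<open>F(T)\<close>, invariance of \<open>G\<close> under \<open>F(T)\<close> implies invariance under
  \<open>F(S(T))\<close> (\<open>F_corep_preserves_G\<close>).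
\<close>

section \<open>Kronecker symbols and finite sums\<close>

lemma sum_kron [simp]:
  fixes x :: "'i::finite \<Rightarrow> complex"
  shows "(\<Sum>j\<in>UNIV. kron i j * x j) = x i" "(\<Sum>j\<in>UNIV. kron j i * x j) = x i"
    "(\<Sum>j\<in>UNIV. x j * kron i j) = x i" "(\<Sum>j\<in>UNIV. x j * kron j i) = x i"
  by (simp_all add: kron_def if_distrib[of "\<lambda>c. c * _"] if_distrib[of "\<lambda>c. _ * c"] cong: if_cong)

lemma sum_kron_scaleC [simp]:
  fixes v :: "'i::finite \<Rightarrow> 'v::complex_vector"
  shows "(\<Sum>j\<in>UNIV. kron i j *\<^sub>C v j) = v i" "(\<Sum>j\<in>UNIV. kron j i *\<^sub>C v j) = v i"
  by (simp_all add: kron_def if_distrib[of "\<lambda>c. c *\<^sub>C _"] scaleC_one cong: if_cong)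

lemma kron_commute: "kron i j = kron j i"
  by (auto simp: kron_def)

lemma kron_prod: "kron p q = kron (fst p) (fst q) * kron (snd p) (snd q)"
  by (auto simp: kron_def prod_eq_iff)

lemma sum_UNIV_prod: "(\<Sum>p\<in>UNIV. h p) = (\<Sum>x\<in>UNIV. \<Sum>y\<in>UNIV. h (x :: 'i::finite, y :: 'j::finite))"
  by (simp add: sum.cartesian_product flip: UNIV_Times_UNIV)

lemma opp_opp [simp]: "opp (opp s) = s"
  by (cases s) simp_all

lemma clinear_sum: "clinear h \<Longrightarrow> h (sum v A) = (\<Sum>i\<in>A. h (v i))"
  by (rule cvsp.linear_sum)

lemma clinear_scale: "clinear h \<Longrightarrow> h (c *\<^sub>C v) = c *\<^sub>C h v"
  by (rule cvsp.linear_scale)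

lemma clinear_compose: "clinear g \<Longrightarrow> clinear h \<Longrightarrow> clinear (\<lambda>v. g (h v))"
  using Vector_Spaces.linear_compose[of scaleC scaleC h scaleC g] by (simp add: comp_def)

lemma sum_swap3: "(\<Sum>x\<in>A. \<Sum>a\<in>B. \<Sum>b\<in>C. f x a b) = (\<Sum>a\<in>B. \<Sum>b\<in>C. \<Sum>x\<in>A. f x a b)"
  by (subst sum.swap, rule sum.cong[OF refl], rule sum.swap)

lemma sum_swap4: "(\<Sum>x\<in>A. \<Sum>a\<in>B. \<Sum>b\<in>C. \<Sum>c\<in>D. f x a b c) =
   (\<Sum>a\<in>B. \<Sum>b\<in>C. \<Sum>c\<in>D. \<Sum>x\<in>A. f x a b c)"
  by (subst sum.swap, rule sum.cong[OF refl], rule sum_swap3)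

lemma sum_swap5: "(\<Sum>x\<in>A. \<Sum>a\<in>B. \<Sum>b\<in>C. \<Sum>c\<in>D. \<Sum>d\<in>E. f x a b c d) =
   (\<Sum>a\<in>B. \<Sum>b\<in>C. \<Sum>c\<in>D. \<Sum>d\<in>E. \<Sum>x\<in>A. f x a b c d)"
  by (subst sum.swap, rule sum.cong[OF refl], rule sum_swap4)

text \<open>Vector indices and pairs of spinor indices are different types with four elements each, so the
  facts on square matrices have to be transported along a bijection.\<close>

lemma left_inverse_right_inverse:
  fixes A :: "'m::finite \<Rightarrow> 'n::finite \<Rightarrow> complex"
  assumes card: "CARD('m) = CARD('n)"
    and BA: "\<And>i k. (\<Sum>j\<in>UNIV. B i j * A j k) = kron i k"
  shows "(\<Sum>k\<in>UNIV. A i k * B k j) = kron i j"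
proof -
  obtain h :: "'n \<Rightarrow> 'm" where h: "bij h"
    using card finite_same_card_bij[of "UNIV :: 'n set" "UNIV :: 'm set"] by auto
  define A' :: "complex^'n^'n" where "A' = (\<chi> i k. A (h i) k)"
  define B' :: "complex^'n^'n" where "B' = (\<chi> i k. B i (h k))"
  have "(\<Sum>k\<in>UNIV. B i (h k) * A (h k) j) = kron i j" for i j
    using sum.reindex_bij_betw[OF h, of "\<lambda>k. B i k * A k j"] BA by simp
  then have "B' ** A' = mat 1"
    by (simp add: A'_def B'_def matrix_matrix_mult_def mat_def vec_eq_iff kron_def)
  then have "A' ** B' = mat 1" by (simp add: matrix_left_right_inverse)
  then have *: "(\<Sum>k\<in>UNIV. A (h x) k * B k (h y)) = kron x y" for x y
    by (simp add: A'_def B'_def matrix_matrix_mult_def mat_def vec_eq_iff kron_def)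
  obtain x y where "i = h x" "j = h y" using h by (meson bij_pointE)
  then show ?thesis using *[of x y] h by (auto simp: kron_def bij_def inj_eq)
qed

lemma injective_left_inverse:
  fixes A :: "'m::finite \<Rightarrow> 'n::finite \<Rightarrow> complex"
  assumes card: "CARD('m) = CARD('n)"
    and inj: "\<And>x. (\<And>j. (\<Sum>k\<in>UNIV. A j k * x k) = 0) \<Longrightarrow> x = (\<lambda>k. 0)"
  obtains B where "\<And>i k. (\<Sum>j\<in>UNIV. B i j * A j k) = kron i k"
proof -
  obtain h :: "'n \<Rightarrow> 'm" where h: "bij h"
    using card finite_same_card_bij[of "UNIV :: 'n set" "UNIV :: 'm set"] by auto
  define A' :: "complex^'n^'n" where "A' = (\<chi> i k. A (h i) k)"
  have "x = 0" if "A' *v x = 0" for x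
  proof -
    have 0: "(\<Sum>k\<in>UNIV. A (h i) k * x $ k) = 0" for i
      using that by (simp add: A'_def matrix_vector_mult_def vec_eq_iff)
    have "(\<Sum>k\<in>UNIV. A j k * x $ k) = 0" for j
      using 0[of "inv h j"] h by (simp add: bij_def surj_f_inv_f)
    from inj[OF this] show ?thesis by (simp add: vec_eq_iff fun_eq_iff)
  qed
  then obtain B' where B': "B' ** A' = mat 1" using matrix_left_invertible_ker by blast
  have "(\<Sum>j\<in>UNIV. B' $ i $ inv h j * A j k) = kron i k" for i k
    using B' sum.reindex_bij_betw[OF h, of "\<lambda>j. B' $ i $ inv h j * A j k"] h
    by (simp add: A'_def matrix_matrix_mult_def mat_def vec_eq_iff kron_def bij_def)
  then show ?thesis by (rule that)
qed

section \<open>Crossings and cups\<close>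

context spinor_metric
begin

text \<open>The number \<open>a + 1/a\<close> is the sum of the squared moduli of the entries of \<open>eps\<close>.\<close>

lemma a_pos: "a > 0"
proof (rule ccontr)
  assume "\<not> a > 0"
  then have neg: "a + inverse a < 0" using a_nonzero by (simp add: add_neg_neg)
  have "complex_of_real (a + inverse a) = (\<Sum>\<alpha>\<in>UNIV. \<Sum>\<beta>\<in>UNIV. cnj (eps \<alpha> \<beta>) * eps \<alpha> \<beta>)"
    using a_eq by (simp add: cnj_eps sum_negf eq_neg_iff_add_eq_0)
  also have "\<dots> = of_real (\<Sum>\<alpha>\<in>UNIV. \<Sum>\<beta>\<in>UNIV. (cmod (eps \<alpha> \<beta>))\<^sup>2)"
    by (simp add: complex_norm_square mult.commute del: of_real_power)
  finally have "a + inverse a = (\<Sum>\<alpha>\<in>UNIV. \<Sum>\<beta>\<in>UNIV. (cmod (eps \<alpha> \<beta>))\<^sup>2)"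
    using of_real_eq_iff by blast
  then have "a + inverse a \<ge> 0" by (simp add: sum_nonneg)
  with neg show False by simp
qed

lemma spow_opp [simp]: "spow (sqrt a) s * spow (sqrt a) (opp s) = 1"
  "spow (sqrt a) (opp s) * spow (sqrt a) s = 1"
  using a_pos by (cases s; simp add: spow_def flip: of_real_mult)+

lemma spow_a: "spow a s = spow (sqrt a) s * spow (sqrt a) s"
  using a_pos by (cases s) (simp_all add: spow_def flip: of_real_mult inverse_mult_distrib of_real_inverse)

lemma Q_eq: "Q = spow a s + spow a (opp s)"
  by (cases s) (simp_all add: Q_def spow_def)

lemma Q_nonzero: "Q \<noteq> 0"
proof -
  have "a + inverse a > 0" using a_pos by (simp add: add_pos_pos)
  then have "a + inverse a \<noteq> 0" by simp
  then show ?thesis unfolding Q_def of_real_eq_0_iff .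
qed

lemma loop: "(\<Sum>\<alpha>\<in>UNIV. \<Sum>\<beta>\<in>UNIV. epsu \<alpha> \<beta> * eps \<alpha> \<beta>) = - Q"
  using a_eq unfolding Q_def eq_neg_iff_add_eq_0 by (simp only: add.commute)

text \<open>The Kauffman resolution of a crossing with incoming indices \<open>\<beta>, \<gamma>\<close> and outgoing indices
  \<open>i, j\<close>. It is the common form of all \<open>R\<close> matrices, see \<open>R_crossing\<close> and \<open>Rdu_crossing\<close>.\<close>

definition crossing :: "sign \<Rightarrow> 2 \<Rightarrow> 2 \<Rightarrow> 2 \<Rightarrow> 2 \<Rightarrow> complex"
  where "crossing s \<beta> \<gamma> i j =
    spow (sqrt a) (opp s) * kron \<beta> i * kron \<gamma> j + spow (sqrt a) s * eps \<beta> \<gamma> * epsu i j"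

text \<open>Number the four indices \<open>fst p, snd p, fst q, snd q\<close> as strands 1 to 4. The two terms join 1 with 4
  and 2 with 3, and 1 with 2 and 3 with 4: together they resolve the cups that join 1 with 3
  and 2 with 4 and cross once.\<close>

definition crossed_cups :: "sign \<Rightarrow> 2 \<times> 2 \<Rightarrow> 2 \<times> 2 \<Rightarrow> complex"
  where "crossed_cups s p q = - (1 / Q) *
    (spow (sqrt a) s * epsu (fst p) (snd q) * epsu (snd p) (fst q)
     + spow (sqrt a) (opp s) * epsu (fst p) (snd p) * epsu (fst q) (snd q))"

lemma crossed_cups_crossing:
  "crossed_cups s p q = - (1 / Q) * (\<Sum>\<beta>\<in>UNIV. \<Sum>\<gamma>\<in>UNIV.
     epsu (fst p) \<beta> * epsu \<gamma> (snd q) * crossing s \<beta> \<gamma> (snd p) (fst q))"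
proof -
  have "(\<Sum>\<beta>\<in>UNIV. \<Sum>\<gamma>\<in>UNIV. epsu i \<beta> * epsu \<gamma> l * crossing s \<beta> \<gamma> j k) =
    spow (sqrt a) (opp s) * (\<Sum>\<beta>\<in>UNIV. epsu i \<beta> * kron \<beta> j) * (\<Sum>\<gamma>\<in>UNIV. epsu \<gamma> l * kron \<gamma> k)
    + spow (sqrt a) s * (\<Sum>\<gamma>\<in>UNIV. (\<Sum>\<beta>\<in>UNIV. epsu i \<beta> * eps \<beta> \<gamma>) * epsu \<gamma> l) * epsu j k" for i j k l
    by (simp add: crossing_def sum_2 algebra_simps del: sum_kron)
  note * = this
  show ?thesis unfolding * epsu_eps by (simp add: crossed_cups_def algebra_simps)
qed

lemma R_crossing: "spow (sqrt a) (opp s) * R s \<rho> \<alpha> \<gamma> \<delta> = crossing s \<gamma> \<delta> \<rho> \<alpha>"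
proof -
  have "spow (sqrt a) (opp s) * spow a s = spow (sqrt a) s"
    by (simp add: spow_a flip: mult.assoc)
  then have "spow (sqrt a) (opp s) * (spow a s * x) = spow (sqrt a) s * x" for x
    by (simp flip: mult.assoc)
  then show ?thesis
    by (simp add: crossing_def R_def distrib_left kron_commute mult.assoc)
qed

text \<open>The \<open>\<epsilon>\<close> factors in the definition of \<open>sbar\<close> cancel those of the mixed \<open>R\<close> matrix; a multiple of
  the identity and a trace remain.\<close>

lemma Rud_sandwich:
  "(\<Sum>\<mu>\<in>UNIV. \<Sum>\<nu>\<in>UNIV. epsud \<alpha> \<mu> * Rud (opp s) \<sigma> \<rho> \<mu> \<nu> * epsu \<nu> \<beta>) =
   - (spow (sqrt a) s * kron \<sigma> \<alpha> * kron \<rho> \<beta>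
     + spow (sqrt a) (opp s) * (\<Sum>\<mu>\<in>UNIV. eps \<rho> \<mu> * epsu \<sigma> \<mu>) * kron \<alpha> \<beta>)"
proof -
  define w where "w = (\<Sum>\<mu>\<in>UNIV. eps \<rho> \<mu> * epsu \<sigma> \<mu>)"
  have R: "(\<Sum>\<mu>'\<in>UNIV. \<Sum>\<nu>'\<in>UNIV. eps \<rho> \<mu>' * R (opp s) \<sigma> \<mu>' \<nu>' \<nu> * epsu \<nu>' \<mu>)
    = eps \<rho> \<nu> * epsu \<sigma> \<mu> + spow a (opp s) * w * (\<Sum>\<nu>'\<in>UNIV. eps \<nu>' \<nu> * epsu \<nu>' \<mu>)" for \<mu> \<nu>
  proof -
    have "(\<Sum>\<mu>'\<in>UNIV. \<Sum>\<nu>'\<in>UNIV. eps \<rho> \<mu>' * R (opp s) \<sigma> \<mu>' \<nu>' \<nu> * epsu \<nu>' \<mu>)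
     = (\<Sum>\<mu>'\<in>UNIV. eps \<rho> \<mu>' * kron \<mu>' \<nu>) * (\<Sum>\<nu>'\<in>UNIV. kron \<sigma> \<nu>' * epsu \<nu>' \<mu>)
     + spow a (opp s) * w * (\<Sum>\<nu>'\<in>UNIV. eps \<nu>' \<nu> * epsu \<nu>' \<mu>)"
      unfolding w_def R_def by (simp add: sum_2 algebra_simps del: sum_kron)
    then show ?thesis by simp
  qed
  have "(\<Sum>\<mu>\<in>UNIV. \<Sum>\<nu>\<in>UNIV. epsud \<alpha> \<mu> * Rud (opp s) \<sigma> \<rho> \<mu> \<nu> * epsu \<nu> \<beta>)
    = - spow (sqrt a) s * ((\<Sum>\<mu>\<in>UNIV. epsu \<sigma> \<mu> * eps \<mu> \<alpha>) * (\<Sum>\<nu>\<in>UNIV. eps \<rho> \<nu> * epsu \<nu> \<beta>)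
      + spow a (opp s) * w * (\<Sum>\<nu>'\<in>UNIV. (\<Sum>\<mu>\<in>UNIV. epsu \<nu>' \<mu> * eps \<mu> \<alpha>)
         * (\<Sum>\<nu>\<in>UNIV. eps \<nu>' \<nu> * epsu \<nu> \<beta>)))"
    unfolding Rud_def R by (simp add: epsud_def cnj_epsu sum_2 algebra_simps)
  also have "\<dots> = - spow (sqrt a) s * (kron \<sigma> \<alpha> * kron \<rho> \<beta> + spow a (opp s) * w * kron \<alpha> \<beta>)"
    unfolding epsu_eps eps_epsu by (simp add: kron_commute)
  also have "\<dots> = - (spow (sqrt a) s * kron \<sigma> \<alpha> * kron \<rho> \<beta>
     + (spow (sqrt a) s * spow a (opp s)) * w * kron \<alpha> \<beta>)"
    by (simp add: algebra_simps)
  also have "spow (sqrt a) s * spow a (opp s) = spow (sqrt a) (opp s)"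
    by (simp add: spow_a flip: mult.assoc)
  finally show ?thesis by (simp add: w_def)
qed

text \<open>Contracting the equation with two caps shows that \<open>z\<close> is the multiple \<open>- a\<^sup>\<mp>\<^sup>1 c\<close> of \<open>eps\<close>, where \<open>c\<close>
  is the contraction of \<open>z\<close> with the cup. Closing the loop gives \<open>c = a\<^sup>\<mp>\<^sup>1 Q c = c + a\<^sup>\<mp>\<^sup>2 c\<close>, hence \<open>c = 0\<close>.\<close>

lemma crossed_cups_nondegenerate:
  assumes "\<And>p. (\<Sum>q\<in>UNIV. crossed_cups s p q * z q) = 0"
  shows "z p = 0"
proof -
  define c where "c = (\<Sum>q\<in>UNIV. epsu (fst q) (snd q) * z q)"
  have 1: "spow (sqrt a) s * (\<Sum>k\<in>UNIV. \<Sum>l\<in>UNIV. epsu i l * epsu j k * z (k, l))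
     + spow (sqrt a) (opp s) * epsu i j * c = 0" for i j
  proof -
    have "- (1 / Q) * (spow (sqrt a) s * (\<Sum>k\<in>UNIV. \<Sum>l\<in>UNIV. epsu i l * epsu j k * z (k, l))
     + spow (sqrt a) (opp s) * epsu i j * c) = 0"
      using assms[of "(i, j)"]
      by (simp add: crossed_cups_def c_def sum_UNIV_prod sum_2 algebra_simps)
    then show ?thesis using Q_nonzero by simp
  qed
  have 2: "z (x, y) = - (spow a (opp s) * c) * eps x y" for x y
  proof -
    have "(\<Sum>j\<in>UNIV. \<Sum>i\<in>UNIV. eps y i * eps x j *
       (\<Sum>k\<in>UNIV. \<Sum>l\<in>UNIV. epsu i l * epsu j k * z (k, l)))
      = (\<Sum>k\<in>UNIV. (\<Sum>j\<in>UNIV. eps x j * epsu j k) * (\<Sum>l\<in>UNIV. (\<Sum>i\<in>UNIV. eps y i * epsu i l) * z (k, l)))"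
      by (simp add: sum_2 algebra_simps)
    also have "\<dots> = z (x, y)" by (simp add: eps_epsu kron_commute)
    finally have z: "z (x, y) = (\<Sum>j\<in>UNIV. \<Sum>i\<in>UNIV. eps y i * eps x j *
       (\<Sum>k\<in>UNIV. \<Sum>l\<in>UNIV. epsu i l * epsu j k * z (k, l)))" by simp
    have u: "(\<Sum>j\<in>UNIV. \<Sum>i\<in>UNIV. eps y i * eps x j * epsu i j) = eps x y"
    proof -
      have "(\<Sum>j\<in>UNIV. \<Sum>i\<in>UNIV. eps y i * eps x j * epsu i j)
         = (\<Sum>j\<in>UNIV. eps x j * (\<Sum>i\<in>UNIV. eps y i * epsu i j))"
        by (simp add: sum_2 algebra_simps)
      then show ?thesis by (simp add: eps_epsu)
    qed
    have "spow (sqrt a) s * z (x, y) + spow (sqrt a) (opp s) * c * eps x y =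
      (\<Sum>j\<in>UNIV. \<Sum>i\<in>UNIV. eps y i * eps x j *
       (spow (sqrt a) s * (\<Sum>k\<in>UNIV. \<Sum>l\<in>UNIV. epsu i l * epsu j k * z (k, l))
     + spow (sqrt a) (opp s) * epsu i j * c))"
      unfolding z u[symmetric] by (simp add: sum_2 algebra_simps)
    also have "\<dots> = 0" unfolding 1 by simp
    finally have "spow (sqrt a) (opp s) * (spow (sqrt a) s * z (x, y) + spow (sqrt a) (opp s) * c * eps x y) = 0"
      by simp
    then have "(spow (sqrt a) (opp s) * spow (sqrt a) s) * z (x, y) + spow a (opp s) * c * eps x y = 0"
      unfolding spow_a by (simp add: algebra_simps del: spow_opp)
    then show ?thesis by (simp add: eq_neg_iff_add_eq_0)
  qed
  have "c = (\<Sum>x\<in>UNIV. \<Sum>y\<in>UNIV. epsu x y * z (x, y))"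
    by (simp add: c_def sum_UNIV_prod)
  also have "\<dots> = - (spow a (opp s) * c) * (\<Sum>\<alpha>\<in>UNIV. \<Sum>\<beta>\<in>UNIV. epsu \<alpha> \<beta> * eps \<alpha> \<beta>)"
    unfolding 2 by (simp add: sum_2 algebra_simps)
  also have "\<dots> = spow a (opp s) * c * (spow a s + spow a (opp s))"
    unfolding loop Q_eq[of s] by (simp only: algebra_simps minus_mult_minus minus_minus)
  also have "\<dots> = c * (spow a s * spow a (opp s)) + c * (spow a (opp s) * spow a (opp s))"
    by (simp only: algebra_simps)
  also have "spow a s * spow a (opp s) = 1"
    using a_nonzero by (cases s) (simp_all add: spow_def)
  finally have "c * (spow a (opp s) * spow a (opp s)) = 0" by simp
  moreover have "spow a (opp s) \<noteq> 0"
    using a_nonzero by (cases s) (simp_all add: spow_def)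
  ultimately have "c = 0" by simp
  then show ?thesis using 2[of "fst p" "snd p"] by simp
qed

end

context spinor_metric
begin

text \<open>Slide the two inner operators through the crossing. Then equal families sit at the two ends of
  each cup and are absorbed. The operators act on an arbitrary space because the lemma is needed
  both for multiplication and for convolution operators.\<close>

lemma crossed_cups_invariant:
  fixes P N :: "2 \<Rightarrow> 2 \<Rightarrow> 'v::complex_vector \<Rightarrow> 'v"
  assumes lin: "\<And>i j. clinear (P i j)" "\<And>i j. clinear (N i j)"
    and cupP: "\<And>k l v. (\<Sum>i\<in>UNIV. \<Sum>j\<in>UNIV. epsu i j *\<^sub>C P i k (P j l v)) = epsu k l *\<^sub>C v"
    and cupN: "\<And>k l v. (\<Sum>i\<in>UNIV. \<Sum>j\<in>UNIV. epsu i j *\<^sub>C N i k (N j l v)) = epsu k l *\<^sub>C v"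
    and cross: "\<And>\<beta> \<gamma> k l v. (\<Sum>i\<in>UNIV. \<Sum>j\<in>UNIV. crossing s \<beta> \<gamma> i j *\<^sub>C N i k (P j l v))
       = (\<Sum>i\<in>UNIV. \<Sum>j\<in>UNIV. crossing s i j k l *\<^sub>C P \<beta> i (N \<gamma> j v))"
  shows "(\<Sum>p\<in>UNIV. \<Sum>q\<in>UNIV. crossed_cups s p q *\<^sub>C
      P (fst p) (fst p') (N (snd p) (snd p') (P (fst q) (fst q') (N (snd q) (snd q') v))))
    = crossed_cups s p' q' *\<^sub>C v"
proof -
  note lin_sum = clinear_sum[OF lin(1)] clinear_sum[OF lin(2)]
  note lin_scale = clinear_scale[OF lin(1)] clinear_scale[OF lin(2)]
  obtain i j k l where pq: "p' = (i, j)" "q' = (k, l)" by (metis surj_pair)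
  define W where "W x1 x2 x3 x4 = P x1 i (N x2 j (P x3 k (N x4 l v)))" for x1 x2 x3 x4
  define V where "V x1 \<beta> \<gamma> x4 a b = P x1 i (P \<beta> a (N \<gamma> b (N x4 l v)))" for x1 \<beta> \<gamma> x4 a b
  \<comment> \<open>the crossing slides over the inner operators, here \<open>N\<close> on strand 2 and \<open>P\<close> on strand 3\<close>
  have inner: "(\<Sum>x2\<in>UNIV. \<Sum>x3\<in>UNIV. crossing s \<beta> \<gamma> x2 x3 *\<^sub>C W x1 x2 x3 x4)
    = (\<Sum>a\<in>UNIV. \<Sum>b\<in>UNIV. crossing s a b j k *\<^sub>C V x1 \<beta> \<gamma> x4 a b)" for \<beta> \<gamma> x1 x4
    using arg_cong[OF cross[of \<beta> \<gamma> j k "N x4 l v"], of "P x1 i"]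
    by (simp add: W_def V_def lin_sum lin_scale)
  \<comment> \<open>the cups now join strand 1 to a \<open>P\<close> and strand 4 to an \<open>N\<close>\<close>
  have outer: "(\<Sum>x1\<in>UNIV. \<Sum>x4\<in>UNIV. \<Sum>\<beta>\<in>UNIV. \<Sum>\<gamma>\<in>UNIV. (epsu x1 \<beta> * epsu \<gamma> x4) *\<^sub>C V x1 \<beta> \<gamma> x4 a b)
    = (epsu i a * epsu b l) *\<^sub>C v" for a b
  proof -
    have "(\<Sum>x1\<in>UNIV. \<Sum>x4\<in>UNIV. \<Sum>\<beta>\<in>UNIV. \<Sum>\<gamma>\<in>UNIV. (epsu x1 \<beta> * epsu \<gamma> x4) *\<^sub>C V x1 \<beta> \<gamma> x4 a b)
      = (\<Sum>x1\<in>UNIV. \<Sum>\<beta>\<in>UNIV. \<Sum>\<gamma>\<in>UNIV. \<Sum>x4\<in>UNIV. (epsu x1 \<beta> * epsu \<gamma> x4) *\<^sub>C V x1 \<beta> \<gamma> x4 a b)"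
      by (rule sum.cong[OF refl], rule sum_swap3)
    also have "\<dots> = (\<Sum>x1\<in>UNIV. \<Sum>\<beta>\<in>UNIV. epsu x1 \<beta> *\<^sub>C P x1 i (P \<beta> a
        (\<Sum>\<gamma>\<in>UNIV. \<Sum>x4\<in>UNIV. epsu \<gamma> x4 *\<^sub>C N \<gamma> b (N x4 l v))))"
      by (simp add: V_def lin_sum lin_scale cvs.scale_sum_right scaleC_scaleC)
    also have "\<dots> = epsu b l *\<^sub>C (\<Sum>x1\<in>UNIV. \<Sum>\<beta>\<in>UNIV. epsu x1 \<beta> *\<^sub>C P x1 i (P \<beta> a v))"
      by (simp add: cupN lin_scale cvs.scale_sum_right scaleC_scaleC mult.commute)
    finally show ?thesis by (simp add: cupP scaleC_scaleC mult.commute)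
  qed
  define \<kappa> where "\<kappa> = - (1 / Q)"
  have "(\<Sum>p\<in>UNIV. \<Sum>q\<in>UNIV. crossed_cups s p q *\<^sub>C
      P (fst p) (fst p') (N (snd p) (snd p') (P (fst q) (fst q') (N (snd q) (snd q') v))))
    = (\<Sum>x1\<in>UNIV. \<Sum>x2\<in>UNIV. \<Sum>x3\<in>UNIV. \<Sum>x4\<in>UNIV. \<Sum>\<beta>\<in>UNIV. \<Sum>\<gamma>\<in>UNIV.
       \<kappa> *\<^sub>C (epsu x1 \<beta> * epsu \<gamma> x4) *\<^sub>C crossing s \<beta> \<gamma> x2 x3 *\<^sub>C W x1 x2 x3 x4)"
    unfolding sum_UNIV_prod crossed_cups_crossing
    by (simp add: pq W_def \<kappa>_def cvs.scale_sum_left scaleC_scaleC mult.assoc sum_distrib_left)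
  also have "\<dots> = (\<Sum>x1\<in>UNIV. \<Sum>x4\<in>UNIV. \<Sum>\<beta>\<in>UNIV. \<Sum>\<gamma>\<in>UNIV. \<Sum>x2\<in>UNIV. \<Sum>x3\<in>UNIV.
       \<kappa> *\<^sub>C (epsu x1 \<beta> * epsu \<gamma> x4) *\<^sub>C crossing s \<beta> \<gamma> x2 x3 *\<^sub>C W x1 x2 x3 x4)"
  proof (rule sum.cong[OF refl])
    fix x1 :: 2
    have "(\<Sum>x2\<in>UNIV. \<Sum>x3\<in>UNIV. \<Sum>x4\<in>UNIV. \<Sum>\<beta>\<in>UNIV. \<Sum>\<gamma>\<in>UNIV. F x2 x3 x4 \<beta> \<gamma>) =
      (\<Sum>x4\<in>UNIV. \<Sum>\<beta>\<in>UNIV. \<Sum>\<gamma>\<in>UNIV. \<Sum>x2\<in>UNIV. \<Sum>x3\<in>UNIV. F x2 x3 x4 \<beta> \<gamma>)"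
      for F :: "2 \<Rightarrow> 2 \<Rightarrow> 2 \<Rightarrow> 2 \<Rightarrow> 2 \<Rightarrow> 'v"
      unfolding sum_swap4[of "\<lambda>x3. F _ x3"] by (rule sum_swap4)
    then show "(\<Sum>x2\<in>UNIV. \<Sum>x3\<in>UNIV. \<Sum>x4\<in>UNIV. \<Sum>\<beta>\<in>UNIV. \<Sum>\<gamma>\<in>UNIV.
       \<kappa> *\<^sub>C (epsu x1 \<beta> * epsu \<gamma> x4) *\<^sub>C crossing s \<beta> \<gamma> x2 x3 *\<^sub>C W x1 x2 x3 x4) =
      (\<Sum>x4\<in>UNIV. \<Sum>\<beta>\<in>UNIV. \<Sum>\<gamma>\<in>UNIV. \<Sum>x2\<in>UNIV. \<Sum>x3\<in>UNIV.
       \<kappa> *\<^sub>C (epsu x1 \<beta> * epsu \<gamma> x4) *\<^sub>C crossing s \<beta> \<gamma> x2 x3 *\<^sub>C W x1 x2 x3 x4)" .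
  qed
  also have "\<dots> = \<kappa> *\<^sub>C (\<Sum>x1\<in>UNIV. \<Sum>x4\<in>UNIV. \<Sum>\<beta>\<in>UNIV. \<Sum>\<gamma>\<in>UNIV.
       (epsu x1 \<beta> * epsu \<gamma> x4) *\<^sub>C (\<Sum>x2\<in>UNIV. \<Sum>x3\<in>UNIV. crossing s \<beta> \<gamma> x2 x3 *\<^sub>C W x1 x2 x3 x4))"
    by (simp only: cvs.scale_sum_right)
  also have "\<dots> = \<kappa> *\<^sub>C (\<Sum>x1\<in>UNIV. \<Sum>x4\<in>UNIV. \<Sum>\<beta>\<in>UNIV. \<Sum>\<gamma>\<in>UNIV. \<Sum>a\<in>UNIV. \<Sum>b\<in>UNIV.
       crossing s a b j k *\<^sub>C (epsu x1 \<beta> * epsu \<gamma> x4) *\<^sub>C V x1 \<beta> \<gamma> x4 a b)"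
    unfolding inner by (simp only: cvs.scale_sum_right scaleC_scaleC mult.commute)
  also have "\<dots> = \<kappa> *\<^sub>C (\<Sum>a\<in>UNIV. \<Sum>b\<in>UNIV. \<Sum>x1\<in>UNIV. \<Sum>x4\<in>UNIV. \<Sum>\<beta>\<in>UNIV. \<Sum>\<gamma>\<in>UNIV.
       crossing s a b j k *\<^sub>C (epsu x1 \<beta> * epsu \<gamma> x4) *\<^sub>C V x1 \<beta> \<gamma> x4 a b)"
  proof -
    have "(\<Sum>a\<in>UNIV. \<Sum>b\<in>UNIV. \<Sum>x1\<in>UNIV. \<Sum>x4\<in>UNIV. \<Sum>\<beta>\<in>UNIV. \<Sum>\<gamma>\<in>UNIV. F x1 x4 \<beta> \<gamma> a b)
      = (\<Sum>x1\<in>UNIV. \<Sum>x4\<in>UNIV. \<Sum>\<beta>\<in>UNIV. \<Sum>\<gamma>\<in>UNIV. \<Sum>a\<in>UNIV. \<Sum>b\<in>UNIV. F x1 x4 \<beta> \<gamma> a b)"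
      for F :: "2 \<Rightarrow> 2 \<Rightarrow> 2 \<Rightarrow> 2 \<Rightarrow> 2 \<Rightarrow> 2 \<Rightarrow> 'v"
      unfolding sum_swap5[of "\<lambda>b x1 x4 \<beta> \<gamma>. F x1 x4 \<beta> \<gamma> _ b"] by (rule sum_swap5)
    note swap = this
    show ?thesis by (rule arg_cong[where f = "\<lambda>x. \<kappa> *\<^sub>C x"], rule swap[symmetric])
  qed
  also have "\<dots> = \<kappa> *\<^sub>C (\<Sum>a\<in>UNIV. \<Sum>b\<in>UNIV. crossing s a b j k *\<^sub>C (epsu i a * epsu b l) *\<^sub>C v)"
    unfolding outer[symmetric] by (simp only: cvs.scale_sum_right)
  also have "\<dots> = crossed_cups s p' q' *\<^sub>C v"
    unfolding crossed_cups_crossing pq \<kappa>_def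
    by (simp add: cvs.scale_sum_left scaleC_scaleC sum_distrib_left mult_ac flip: cvs.scale_sum_left)
  finally show ?thesis .
qed

end

section \<open>The frame of quantum Pauli matrices and the metric\<close>

context quantum_pauli
begin

text \<open>This is \<open>tr (\<epsilon> (\<epsilon>\<^sup>-\<^sup>1)\<^sup>T \<sigma>\<^sup>J)\<close>, a quantum trace of the Pauli matrix.\<close>

definition trace_part :: "4 \<Rightarrow> complex"
  where "trace_part J = (\<Sum>\<sigma>\<in>UNIV. \<Sum>\<rho>\<in>UNIV. (\<Sum>\<mu>\<in>UNIV. eps \<rho> \<mu> * epsu \<sigma> \<mu>) * sig J \<sigma> \<rho>)"

lemma sbar_eq:
  "sbar s J \<alpha> \<beta> = - (spow (sqrt a) s * sig J \<alpha> \<beta> + spow (sqrt a) (opp s) * trace_part J * kron \<alpha> \<beta>)"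
proof -
  have "sbar s J \<alpha> \<beta> = (\<Sum>\<sigma>\<in>UNIV. \<Sum>\<rho>\<in>UNIV.
    (\<Sum>\<mu>\<in>UNIV. \<Sum>\<nu>\<in>UNIV. epsud \<alpha> \<mu> * Rud (opp s) \<sigma> \<rho> \<mu> \<nu> * epsu \<nu> \<beta>) * sig J \<sigma> \<rho>)"
    by (simp add: sbar_def sum_2 algebra_simps)
  also have "\<dots> = - (spow (sqrt a) s * (\<Sum>\<sigma>\<in>UNIV. kron \<sigma> \<alpha> * (\<Sum>\<rho>\<in>UNIV. kron \<rho> \<beta> * sig J \<sigma> \<rho>))
      + spow (sqrt a) (opp s) * trace_part J * kron \<alpha> \<beta>)"
    unfolding Rud_sandwich trace_part_def by (simp add: sum_2 algebra_simps del: sum_kron)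
  finally show ?thesis by simp
qed

text \<open>The frame is the change of basis from vector indices to pairs of an undotted and a dotted spinor
  index; \<open>coframe\<close> turns out to be its inverse.\<close>

definition frame :: "4 \<Rightarrow> 2 \<times> 2 \<Rightarrow> complex"
  where "frame K p = sig_mix K (fst p) (snd p)"

definition coframe :: "4 \<Rightarrow> 2 \<times> 2 \<Rightarrow> complex"
  where "coframe L p = sbar_mix L (snd p) (fst p) / Q"

lemma frame_eq: "frame K p = - (\<Sum>\<beta>\<in>UNIV. sig K (fst p) \<beta> * eps \<beta> (snd p))"
  by (simp add: frame_def sig_mix_def epsud_def cnj_epsu sum_negf mult.commute)

lemma sig_frame: "sig K \<sigma> \<beta> = - (\<Sum>\<rho>\<in>UNIV. frame K (\<sigma>, \<rho>) * epsu \<rho> \<beta>)"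
proof -
  have "- (\<Sum>\<rho>\<in>UNIV. frame K (\<sigma>, \<rho>) * epsu \<rho> \<beta>)
    = (\<Sum>\<gamma>\<in>UNIV. sig K \<sigma> \<gamma> * (\<Sum>\<rho>\<in>UNIV. eps \<gamma> \<rho> * epsu \<rho> \<beta>))"
    by (simp add: frame_eq sum_2 algebra_simps)
  then show ?thesis by (simp add: eps_epsu)
qed

lemma trace_part_frame: "trace_part J = - (\<Sum>q\<in>UNIV. epsu (fst q) (snd q) * frame J q)"
  by (simp add: trace_part_def frame_eq sum_UNIV_prod sum_2 algebra_simps)

text \<open>Read with \<open>G_frame\<close>, this says that lowering the vector index of \<open>sbar\<close> with the metric produces the
  dual basis of the frame.\<close>

lemma sbar_frame:
  "(\<Sum>\<delta>\<in>UNIV. epsd \<gamma> \<delta> * sbar s J \<delta> \<alpha>) / Q = (\<Sum>q\<in>UNIV. frame J q * crossed_cups s q (\<alpha>, \<gamma>))"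
proof -
  have "(\<Sum>\<delta>\<in>UNIV. epsd \<gamma> \<delta> * sbar s J \<delta> \<alpha>) =
    spow (sqrt a) s * (\<Sum>\<delta>\<in>UNIV. epsu \<delta> \<gamma> * sig J \<delta> \<alpha>)
    + spow (sqrt a) (opp s) * trace_part J * (\<Sum>\<delta>\<in>UNIV. epsu \<delta> \<gamma> * kron \<delta> \<alpha>)"
    by (simp add: sbar_eq epsd_def cnj_eps sum_2 algebra_simps del: sum_kron)
  also have "\<dots> = spow (sqrt a) s * (\<Sum>\<delta>\<in>UNIV. epsu \<delta> \<gamma> * sig J \<delta> \<alpha>)
    + spow (sqrt a) (opp s) * trace_part J * epsu \<alpha> \<gamma>" by simp
  also have "\<dots> / Q = (\<Sum>q\<in>UNIV. frame J q * crossed_cups s q (\<alpha>, \<gamma>))"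
    by (simp add: sig_frame trace_part_frame crossed_cups_def sum_UNIV_prod sum_2 algebra_simps
       add_divide_distrib diff_divide_distrib)
  finally show ?thesis .
qed

text \<open>The metric is the crossed pair of cups: the term \<open>\<sigma>\<^sup>I \<sigma>\<^sup>J\<close> of \<open>sbar_eq\<close> yields the nested cups, the
  product of traces the parallel ones.\<close>

lemma G_frame: "G s $ I $ J = (\<Sum>p\<in>UNIV. \<Sum>q\<in>UNIV. frame I p * frame J q * crossed_cups s p q)"
proof -
  have "G s $ I $ J = - (1 / Q) *
    (spow (sqrt a) s * (\<Sum>\<alpha>\<in>UNIV. \<Sum>\<beta>\<in>UNIV. \<Sum>\<gamma>\<in>UNIV. \<Sum>\<nu>\<in>UNIV. sig I \<alpha> \<beta> * sig J \<beta> \<gamma> * eps \<gamma> \<nu> * epsu \<alpha> \<nu>)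
    + spow (sqrt a) (opp s) * trace_part J *
      (\<Sum>\<alpha>\<in>UNIV. \<Sum>\<nu>\<in>UNIV. \<Sum>\<beta>\<in>UNIV. epsu \<alpha> \<nu> * sig I \<alpha> \<beta> * (\<Sum>\<gamma>\<in>UNIV. kron \<beta> \<gamma> * eps \<gamma> \<nu>)))"
    unfolding G_def by (simp add: sbar_eq sum_2 algebra_simps del: sum_kron)
  also have "\<dots> = - (1 / Q) *
    (spow (sqrt a) s * (\<Sum>\<alpha>\<in>UNIV. \<Sum>\<beta>\<in>UNIV. sig I \<alpha> \<beta> * (\<Sum>\<nu>\<in>UNIV. epsu \<alpha> \<nu> * (\<Sum>\<gamma>\<in>UNIV. sig J \<beta> \<gamma> * eps \<gamma> \<nu>)))
    + spow (sqrt a) (opp s) * trace_part J * trace_part I)"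
    by (simp add: trace_part_def sum_2 algebra_simps)
  finally have G: "G s $ I $ J = - (1 / Q) *
    (spow (sqrt a) s * (\<Sum>\<alpha>\<in>UNIV. \<Sum>\<beta>\<in>UNIV. sig I \<alpha> \<beta> * (\<Sum>\<nu>\<in>UNIV. epsu \<alpha> \<nu> * (\<Sum>\<gamma>\<in>UNIV. sig J \<beta> \<gamma> * eps \<gamma> \<nu>)))
    + spow (sqrt a) (opp s) * trace_part J * trace_part I)" .
  have "(\<Sum>\<alpha>\<in>UNIV. \<Sum>\<beta>\<in>UNIV. sig I \<alpha> \<beta> * (\<Sum>\<nu>\<in>UNIV. epsu \<alpha> \<nu> * (\<Sum>\<gamma>\<in>UNIV. sig J \<beta> \<gamma> * eps \<gamma> \<nu>)))
    = (\<Sum>\<alpha>\<in>UNIV. \<Sum>\<beta>\<in>UNIV. sig I \<alpha> \<beta> * (\<Sum>\<nu>\<in>UNIV. epsu \<alpha> \<nu> * - frame J (\<beta>, \<nu>)))"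
    by (simp add: frame_eq)
  also have "\<dots> = (\<Sum>\<alpha>\<in>UNIV. \<Sum>\<beta>\<in>UNIV. \<Sum>\<rho>\<in>UNIV. \<Sum>\<nu>\<in>UNIV.
     frame I (\<alpha>, \<rho>) * frame J (\<beta>, \<nu>) * (epsu \<alpha> \<nu> * epsu \<rho> \<beta>))"
  proof (intro sum.cong refl)
    fix \<alpha> \<beta>
    have "sig I \<alpha> \<beta> * (\<Sum>\<nu>\<in>UNIV. epsu \<alpha> \<nu> * - frame J (\<beta>, \<nu>)) =
      (\<Sum>\<rho>\<in>UNIV. frame I (\<alpha>, \<rho>) * epsu \<rho> \<beta>) * (\<Sum>\<nu>\<in>UNIV. epsu \<alpha> \<nu> * frame J (\<beta>, \<nu>))"
      by (simp only: sig_frame[of I] sum_negf mult_minus_right mult_minus_left minus_minus)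
    also have "\<dots> = (\<Sum>\<rho>\<in>UNIV. \<Sum>\<nu>\<in>UNIV.
      (frame I (\<alpha>, \<rho>) * epsu \<rho> \<beta>) * (epsu \<alpha> \<nu> * frame J (\<beta>, \<nu>)))"
      by (rule sum_product)
    also have "\<dots> = (\<Sum>\<rho>\<in>UNIV. \<Sum>\<nu>\<in>UNIV.
      frame I (\<alpha>, \<rho>) * frame J (\<beta>, \<nu>) * (epsu \<alpha> \<nu> * epsu \<rho> \<beta>))"
      by (intro sum.cong refl) (simp only: mult_ac)
    finally show "sig I \<alpha> \<beta> * (\<Sum>\<nu>\<in>UNIV. epsu \<alpha> \<nu> * - frame J (\<beta>, \<nu>)) =
      (\<Sum>\<rho>\<in>UNIV. \<Sum>\<nu>\<in>UNIV. frame I (\<alpha>, \<rho>) * frame J (\<beta>, \<nu>) * (epsu \<alpha> \<nu> * epsu \<rho> \<beta>))" .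
  qed
  also have "\<dots> = (\<Sum>p\<in>UNIV. \<Sum>q\<in>UNIV. frame I p * frame J q *
     (epsu (fst p) (snd q) * epsu (snd p) (fst q)))"
    unfolding sum_UNIV_prod fst_conv snd_conv by (intro sum.cong refl sum.swap)
  finally have nested: "(\<Sum>\<alpha>\<in>UNIV. \<Sum>\<beta>\<in>UNIV. sig I \<alpha> \<beta> * (\<Sum>\<nu>\<in>UNIV. epsu \<alpha> \<nu> * (\<Sum>\<gamma>\<in>UNIV. sig J \<beta> \<gamma> * eps \<gamma> \<nu>)))
    = (\<Sum>p\<in>UNIV. \<Sum>q\<in>UNIV. frame I p * frame J q * (epsu (fst p) (snd q) * epsu (snd p) (fst q)))" .
  have "trace_part I * trace_part J =
    (\<Sum>p\<in>UNIV. \<Sum>q\<in>UNIV. frame I p * frame J q * (epsu (fst p) (snd p) * epsu (fst q) (snd q)))"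
    unfolding trace_part_frame minus_mult_minus sum_product
    by (intro sum.cong refl) (simp only: mult_ac)
  then have parallel: "spow (sqrt a) (opp s) * trace_part J * trace_part I = spow (sqrt a) (opp s) *
    (\<Sum>p\<in>UNIV. \<Sum>q\<in>UNIV. frame I p * frame J q * (epsu (fst p) (snd p) * epsu (fst q) (snd q)))"
    by (metis mult.assoc mult.commute)
  show ?thesis
    unfolding G nested parallel crossed_cups_def
    by (simp add: sum_distrib_left sum.distrib sum_negf sum_subtractf algebra_simps)
qed

text \<open>This is where the linear independence of the Pauli matrices enters.\<close>

lemma frame_dual:
  "\<exists>d. (\<forall>I K. (\<Sum>p\<in>UNIV. d I p * frame K p) = kron I K)
     \<and> (\<forall>p q. (\<Sum>I\<in>UNIV. frame I p * d I q) = kron p q)"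
proof -
  have "k = (\<lambda>I. 0)" if k: "\<And>p. (\<Sum>I\<in>UNIV. frame I p * k I) = 0" for k
  proof (rule sig_independent)
    fix \<alpha> \<beta>
    have "k I * sig I \<alpha> \<beta> = (\<Sum>\<rho>\<in>UNIV. - (frame I (\<alpha>, \<rho>) * k I * epsu \<rho> \<beta>))" for I
      by (simp add: sig_frame sum_negf sum_distrib_left mult_ac)
    then have "(\<Sum>I\<in>UNIV. k I * sig I \<alpha> \<beta>) =
        (\<Sum>I\<in>UNIV. \<Sum>\<rho>\<in>UNIV. - (frame I (\<alpha>, \<rho>) * k I * epsu \<rho> \<beta>))" by simp
    also have "\<dots> = (\<Sum>\<rho>\<in>UNIV. \<Sum>I\<in>UNIV. - (frame I (\<alpha>, \<rho>) * k I * epsu \<rho> \<beta>))" by (rule sum.swap)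
    also have "\<dots> = (\<Sum>\<rho>\<in>UNIV. - ((\<Sum>I\<in>UNIV. frame I (\<alpha>, \<rho>) * k I) * epsu \<rho> \<beta>))"
      by (simp only: sum_distrib_right sum_negf)
    finally have "(\<Sum>I\<in>UNIV. k I * sig I \<alpha> \<beta>) = \<dots>" .
    then show "(\<Sum>I\<in>UNIV. k I * sig I \<alpha> \<beta>) = 0" by (simp add: k)
  qed
  then obtain B where B: "\<And>i k. (\<Sum>j\<in>UNIV. B i j * frame k j) = kron i k"
    using injective_left_inverse[of "\<lambda>p I. frame I p"] by auto
  have "(\<Sum>I\<in>UNIV. frame I p * B I q) = kron p q" for p q
    by (rule left_inverse_right_inverse) (simp_all add: B)
  with B show ?thesis by blast
qed

lemma G_left_inverse: "matrix_inv (G s) ** G s = mat 1"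
proof -
  have "x = 0" if x: "G s *v x = 0" for x
  proof -
    obtain d where d1: "\<And>I K. (\<Sum>p\<in>UNIV. d I p * frame K p) = kron I K"
      and d2: "\<And>p q. (\<Sum>I\<in>UNIV. frame I p * d I q) = kron p q"
      using frame_dual by blast
    define z where "z q = (\<Sum>J\<in>UNIV. frame J q * x $ J)" for q
    define w where "w p = (\<Sum>q\<in>UNIV. crossed_cups s p q * z q)" for p
    have 0: "(\<Sum>p\<in>UNIV. frame I p * w p) = 0" for I
    proof -
      have "(\<Sum>J\<in>UNIV. G s $ I $ J * x $ J) = 0"
        using x by (simp add: matrix_vector_mult_def vec_eq_iff)
      also have "(\<Sum>J\<in>UNIV. G s $ I $ J * x $ J) =
        (\<Sum>J\<in>UNIV. \<Sum>p\<in>UNIV. \<Sum>q\<in>UNIV. frame I p * frame J q * crossed_cups s p q * x $ J)"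
        by (simp add: G_frame sum_distrib_right)
      also have "\<dots> = (\<Sum>p\<in>UNIV. \<Sum>J\<in>UNIV. \<Sum>q\<in>UNIV. frame I p * frame J q * crossed_cups s p q * x $ J)"
        by (rule sum.swap)
      also have "\<dots> = (\<Sum>p\<in>UNIV. \<Sum>q\<in>UNIV. \<Sum>J\<in>UNIV. frame I p * frame J q * crossed_cups s p q * x $ J)"
        by (intro sum.cong refl sum.swap)
      also have "\<dots> = (\<Sum>p\<in>UNIV. frame I p * w p)"
        by (simp add: w_def z_def sum_distrib_left mult_ac)
      finally show ?thesis by simp
    qed
    have "w p = 0" for p
    proof -
      have "w p = (\<Sum>q\<in>UNIV. kron q p * w q)" by simp
      also have "\<dots> = (\<Sum>q\<in>UNIV. \<Sum>I\<in>UNIV. d I p * (frame I q * w q))"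
        by (simp add: d2[symmetric] sum_distrib_left sum_distrib_right mult_ac)
      also have "\<dots> = (\<Sum>I\<in>UNIV. \<Sum>q\<in>UNIV. d I p * (frame I q * w q))"
        by (rule sum.swap)
      also have "\<dots> = 0" by (simp add: 0 flip: sum_distrib_left)
      finally show ?thesis .
    qed
    then have z: "z p = 0" for p
      unfolding w_def by (rule crossed_cups_nondegenerate)
    have "x $ I = 0" for I
    proof -
      have "x $ I = (\<Sum>J\<in>UNIV. kron I J * x $ J)" by simp
      also have "\<dots> = (\<Sum>J\<in>UNIV. \<Sum>p\<in>UNIV. d I p * (frame J p * x $ J))"
        by (simp add: d1[symmetric] sum_distrib_left sum_distrib_right mult_ac)
      also have "\<dots> = (\<Sum>p\<in>UNIV. \<Sum>J\<in>UNIV. d I p * (frame J p * x $ J))"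
        by (rule sum.swap)
      also have "\<dots> = (\<Sum>p\<in>UNIV. d I p * z p)" by (simp add: z_def sum_distrib_left)
      finally show ?thesis by (simp add: z)
    qed
    then show ?thesis by (simp add: vec_eq_iff)
  qed
  then have "\<exists>B. B ** G s = mat 1" using matrix_left_invertible_ker by blast
  then have "\<exists>B. G s ** B = mat 1 \<and> B ** G s = mat 1" by (metis matrix_left_right_inverse)
  then show ?thesis unfolding matrix_inv_def by (rule someI2_ex) simp
qed

lemma coframe_frame: "(\<Sum>p\<in>UNIV. coframe L p * frame K p) = kron L K"
proof -
  have "coframe L p = (\<Sum>J\<in>UNIV. matrix_inv (G Plus) $ L $ J *
     ((\<Sum>\<delta>\<in>UNIV. epsd (snd p) \<delta> * sbar Plus J \<delta> (fst p)) / Q))" for p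
    unfolding coframe_def sbar_mix_def sbar_low_def sum_2
    by (simp add: sum_distrib_left sum.distrib sum_divide_distrib algebra_simps add_divide_distrib)
  then have "(\<Sum>p\<in>UNIV. coframe L p * frame K p) = (\<Sum>p\<in>UNIV. \<Sum>J\<in>UNIV. matrix_inv (G Plus) $ L $ J *
      (\<Sum>q\<in>UNIV. frame J q * crossed_cups Plus q p) * frame K p)"
    by (simp add: sbar_frame sum_distrib_right)
  also have "\<dots> = (\<Sum>J\<in>UNIV. \<Sum>p\<in>UNIV. matrix_inv (G Plus) $ L $ J *
      (\<Sum>q\<in>UNIV. frame J q * crossed_cups Plus q p) * frame K p)" by (rule sum.swap)
  also have "\<dots> = (\<Sum>J\<in>UNIV. matrix_inv (G Plus) $ L $ J *
      (\<Sum>p\<in>UNIV. \<Sum>q\<in>UNIV. frame J q * frame K p * crossed_cups Plus q p))"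
    by (simp add: sum_distrib_left mult_ac)
  also have "\<dots> = (\<Sum>J\<in>UNIV. matrix_inv (G Plus) $ L $ J * G Plus $ J $ K)"
    unfolding G_frame by (subst (2) sum.swap) simp
  also have "\<dots> = (matrix_inv (G Plus) ** G Plus) $ L $ K"
    by (simp add: matrix_matrix_mult_def)
  finally show ?thesis by (simp add: G_left_inverse mat_def kron_def)
qed

lemma frame_coframe: "(\<Sum>K\<in>UNIV. frame K p * coframe K q) = kron p q"
  by (rule left_inverse_right_inverse) (simp_all add: coframe_frame)

end

section \<open>Vector operators built from spinor operators\<close>

context quantum_pauli
begin

text \<open>The pattern common to the Lorentz generators and to the functionals \<open>F\<close>: an operator matrix with
  vector indices composed of one for the undotted and one for the dotted spinor index.\<close>

definition vector_op :: "(2 \<Rightarrow> 2 \<Rightarrow> 'v \<Rightarrow> 'v) \<Rightarrow> (2 \<Rightarrow> 2 \<Rightarrow> 'v \<Rightarrow> 'v) \<Rightarrow> 4 \<Rightarrow> 4 \<Rightarrow> 'v \<Rightarrow> 'v::complex_vector"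
  where "vector_op P N L K v = (\<Sum>p\<in>UNIV. \<Sum>q\<in>UNIV.
    (coframe L p * frame K q) *\<^sub>C P (fst p) (fst q) (N (snd p) (snd q) v))"

lemma clinear_vector_op:
  assumes "\<And>i j. clinear (P i j)" "\<And>i j. clinear (N i j)"
  shows "clinear (vector_op P N L K)"
  by (rule clinearI)
    (simp_all add: vector_op_def cvsp.linear_add[OF assms(1)] cvsp.linear_add[OF assms(2)]
      clinear_scale[OF assms(1)] clinear_scale[OF assms(2)] scaleC_add_right sum.distrib
      cvs.scale_sum_right scaleC_scaleC mult_ac)

lemma frame_vector_op:
  "(\<Sum>I\<in>UNIV. frame I p *\<^sub>C vector_op P N I K v) =
   (\<Sum>q\<in>UNIV. frame K q *\<^sub>C P (fst p) (fst q) (N (snd p) (snd q) v))"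
proof -
  have "(\<Sum>I\<in>UNIV. frame I p *\<^sub>C vector_op P N I K v) = (\<Sum>I\<in>UNIV. \<Sum>p'\<in>UNIV. \<Sum>q\<in>UNIV.
     (frame I p * coframe I p') *\<^sub>C frame K q *\<^sub>C P (fst p') (fst q) (N (snd p') (snd q) v))"
    by (simp add: vector_op_def cvs.scale_sum_right scaleC_scaleC mult.assoc)
  also have "\<dots> = (\<Sum>p'\<in>UNIV. \<Sum>q\<in>UNIV. \<Sum>I\<in>UNIV.
     (frame I p * coframe I p') *\<^sub>C frame K q *\<^sub>C P (fst p') (fst q) (N (snd p') (snd q) v))"
    by (rule sum_swap3)
  also have "\<dots> = (\<Sum>p'\<in>UNIV. kron p p' *\<^sub>C (\<Sum>q\<in>UNIV. frame K q *\<^sub>C P (fst p') (fst q) (N (snd p') (snd q) v)))"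
    by (simp only: frame_coframe cvs.scale_sum_right flip: cvs.scale_sum_left)
  finally show ?thesis by simp
qed

lemma vector_op_preserves_G:
  fixes P N :: "2 \<Rightarrow> 2 \<Rightarrow> 'v::complex_vector \<Rightarrow> 'v"
  assumes lin: "\<And>i j. clinear (P i j)" "\<And>i j. clinear (N i j)"
    and "\<And>k l v. (\<Sum>i\<in>UNIV. \<Sum>j\<in>UNIV. epsu i j *\<^sub>C P i k (P j l v)) = epsu k l *\<^sub>C v"
    and "\<And>k l v. (\<Sum>i\<in>UNIV. \<Sum>j\<in>UNIV. epsu i j *\<^sub>C N i k (N j l v)) = epsu k l *\<^sub>C v"
    and "\<And>\<beta> \<gamma> k l v. (\<Sum>i\<in>UNIV. \<Sum>j\<in>UNIV. crossing s \<beta> \<gamma> i j *\<^sub>C N i k (P j l v))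
       = (\<Sum>i\<in>UNIV. \<Sum>j\<in>UNIV. crossing s i j k l *\<^sub>C P \<beta> i (N \<gamma> j v))"
  shows "(\<Sum>I\<in>UNIV. \<Sum>J\<in>UNIV. G s $ I $ J *\<^sub>C vector_op P N I K (vector_op P N J L v))
    = G s $ K $ L *\<^sub>C v"
proof -
  note inv = crossed_cups_invariant[of P N s, OF assms]
  note op_lin = clinear_vector_op[of P N, OF lin]
  let ?D = "\<lambda>p q v. P (fst p) (fst q) (N (snd p) (snd q) v)"
  have D_lin: "clinear (?D p q)" for p q
    by (rule clinear_compose[OF lin])
  have "(\<Sum>I\<in>UNIV. \<Sum>J\<in>UNIV. G s $ I $ J *\<^sub>C vector_op P N I K (vector_op P N J L v)) =
    (\<Sum>I\<in>UNIV. \<Sum>J\<in>UNIV. \<Sum>p\<in>UNIV. \<Sum>q\<in>UNIV. crossed_cups s p q *\<^sub>C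
      frame I p *\<^sub>C vector_op P N I K (frame J q *\<^sub>C vector_op P N J L v))"
    unfolding G_frame cvs.scale_sum_left clinear_scale[OF op_lin] scaleC_scaleC
    by (intro sum.cong refl) (simp add: mult_ac)
  also have "\<dots> = (\<Sum>I\<in>UNIV. \<Sum>p\<in>UNIV. \<Sum>q\<in>UNIV. \<Sum>J\<in>UNIV. crossed_cups s p q *\<^sub>C
      frame I p *\<^sub>C vector_op P N I K (frame J q *\<^sub>C vector_op P N J L v))"
    by (rule sum.cong[OF refl], rule sum_swap3)
  also have "\<dots> = (\<Sum>p\<in>UNIV. \<Sum>q\<in>UNIV. \<Sum>I\<in>UNIV. \<Sum>J\<in>UNIV. crossed_cups s p q *\<^sub>C
      frame I p *\<^sub>C vector_op P N I K (frame J q *\<^sub>C vector_op P N J L v))"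
    by (rule sum_swap3)
  also have "\<dots> = (\<Sum>p\<in>UNIV. \<Sum>q\<in>UNIV. crossed_cups s p q *\<^sub>C
      (\<Sum>I\<in>UNIV. frame I p *\<^sub>C vector_op P N I K (\<Sum>J\<in>UNIV. frame J q *\<^sub>C vector_op P N J L v)))"
    by (simp only: cvs.scale_sum_right clinear_sum[OF op_lin])
  also have "\<dots> = (\<Sum>p\<in>UNIV. \<Sum>q\<in>UNIV. \<Sum>p'\<in>UNIV. \<Sum>q'\<in>UNIV.
      frame K p' *\<^sub>C frame L q' *\<^sub>C crossed_cups s p q *\<^sub>C ?D p p' (?D q q' v))"
    unfolding frame_vector_op clinear_sum[OF D_lin] clinear_scale[OF D_lin] cvs.scale_sum_right scaleC_scaleC
    by (intro sum.cong refl) (simp add: mult_ac)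
  also have "\<dots> = (\<Sum>p\<in>UNIV. \<Sum>p'\<in>UNIV. \<Sum>q'\<in>UNIV. \<Sum>q\<in>UNIV.
      frame K p' *\<^sub>C frame L q' *\<^sub>C crossed_cups s p q *\<^sub>C ?D p p' (?D q q' v))"
    by (rule sum.cong[OF refl], rule sum_swap3)
  also have "\<dots> = (\<Sum>p'\<in>UNIV. \<Sum>q'\<in>UNIV. \<Sum>p\<in>UNIV. \<Sum>q\<in>UNIV.
      frame K p' *\<^sub>C frame L q' *\<^sub>C crossed_cups s p q *\<^sub>C ?D p p' (?D q q' v))"
    by (rule sum_swap3)
  also have "\<dots> = (\<Sum>p'\<in>UNIV. \<Sum>q'\<in>UNIV. frame K p' *\<^sub>C frame L q' *\<^sub>C crossed_cups s p' q' *\<^sub>C v)"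
    by (simp only: inv flip: cvs.scale_sum_right)
  also have "\<dots> = G s $ K $ L *\<^sub>C v"
    by (simp add: G_frame cvs.scale_sum_left scaleC_scaleC mult.assoc)
  finally show ?thesis .
qed

lemma vector_op_mult:
  fixes P N :: "2 \<Rightarrow> 2 \<Rightarrow> 'v::complex_algebra_1 \<Rightarrow> 'v"
  assumes lin: "\<And>i j. clinear (P i j)"
    and P: "\<And>i j b c. P i j (b * c) = (\<Sum>k\<in>UNIV. P i k b * P k j c)"
    and N: "\<And>i j b c. N i j (b * c) = (\<Sum>k\<in>UNIV. N i k b * N k j c)"
  shows "vector_op P N L K (b * c) = (\<Sum>I\<in>UNIV. vector_op P N L I b * vector_op P N I K c)"
proof -
  let ?D = "\<lambda>p q v. P (fst p) (fst q) (N (snd p) (snd q) v)"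
  have D: "?D p q (b * c) = (\<Sum>r\<in>UNIV. ?D p r b * ?D r q c)" for p q
    unfolding N clinear_sum[OF lin] P sum_UNIV_prod fst_conv snd_conv by (rule sum.swap)
  have "(\<Sum>I\<in>UNIV. vector_op P N L I b * vector_op P N I K c) =
    (\<Sum>I\<in>UNIV. \<Sum>p\<in>UNIV. \<Sum>r\<in>UNIV.
      (coframe L p *\<^sub>C ?D p r b) * frame I r *\<^sub>C vector_op P N I K c)"
    unfolding vector_op_def[of P N L] sum_distrib_right mult_scaleC_left mult_scaleC_right scaleC_scaleC
    by (intro sum.cong refl) (simp add: mult.commute)
  also have "\<dots> = (\<Sum>p\<in>UNIV. \<Sum>r\<in>UNIV. \<Sum>I\<in>UNIV.
      (coframe L p *\<^sub>C ?D p r b) * frame I r *\<^sub>C vector_op P N I K c)"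
    by (rule sum_swap3)
  also have "\<dots> = (\<Sum>p\<in>UNIV. \<Sum>r\<in>UNIV. \<Sum>q\<in>UNIV.
      (coframe L p * frame K q) *\<^sub>C (?D p r b * ?D r q c))"
    unfolding frame_vector_op sum_distrib_left[symmetric]
    by (simp add: sum_distrib_left mult_scaleC_left mult_scaleC_right scaleC_scaleC mult.commute[of "frame K _"])
  also have "\<dots> = (\<Sum>p\<in>UNIV. \<Sum>q\<in>UNIV. \<Sum>r\<in>UNIV.
      (coframe L p * frame K q) *\<^sub>C (?D p r b * ?D r q c))"
    by (rule sum.cong[OF refl], rule sum.swap)
  also have "\<dots> = vector_op P N L K (b * c)"
    by (simp only: vector_op_def D cvs.scale_sum_right)
  finally show ?thesis ..
qed

end

section \<open>Convolution operators\<close>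

lemma balanced_scale_fst: "clinear g \<Longrightarrow> balanced (\<lambda>x y. g x *\<^sub>C (y :: 'b::complex_vector))"
  for g :: "'a::complex_vector \<Rightarrow> complex"
  by (simp add: balanced_def cvsp.linear_add cvsp.linear_scale scaleC_add_left scaleC_add_right
      scaleC_scaleC scaleC_complex_def mult.commute)

lemma balanced_prod: "clinear g \<Longrightarrow> clinear h \<Longrightarrow> balanced (\<lambda>x y. g x * (h y :: complex))"
  by (simp add: balanced_def cvsp.linear_add cvsp.linear_scale scaleC_complex_def algebra_simps)

lemma tensor_lift_combination:
  assumes "finite A" "\<And>i. i \<in> A \<Longrightarrow> balanced (h i)" "balanced h'"
    and eq: "\<And>x y. h' x y = (\<Sum>i\<in>A. c i *\<^sub>C h i x y)"
  shows "tensor_lift h' t = (\<Sum>i\<in>A. c i *\<^sub>C tensor_lift (h i) t)"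
proof (induction t rule: tensor_induct)
  case zero
  show ?case by (simp add: assms(2) tensor_lift_zero tensor_lift_zero[OF assms(3)])
next
  case (tens_add a b t)
  then show ?case
    by (simp add: assms(2) tensor_lift_add tensor_lift_add[OF assms(3)] tensor_lift_tens
        tensor_lift_tens[OF assms(3)] scaleC_add_right sum.distrib) (simp add: eq)
qed

lemma elt_conv_clinear:
  assumes "alg_hom D" "clinear g"
  shows "clinear (\<lambda>b. elt_conv D b g)"
proof -
  have "clinear D" using assms(1) by (simp add: alg_hom_def)
  then show ?thesis unfolding elt_conv_def
    by (intro clinearI)
     (simp_all add: cvsp.linear_add cvsp.linear_scale tensor_lift_add tensor_lift_scaleC
      balanced_scale_fst assms cvsp.linear_scale scaleC_scaleC scaleC_complex_def)
qed

lemma elt_conv_combination: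
  assumes "finite A" "\<And>i. i \<in> A \<Longrightarrow> clinear (g i)" "clinear g'"
    and "\<And>x. g' x = (\<Sum>i\<in>A. c i * g i x)"
  shows "elt_conv D b g' = (\<Sum>i\<in>A. c i *\<^sub>C elt_conv D b (g i))"
  unfolding elt_conv_def
proof (rule tensor_lift_combination)
  show "g' x *\<^sub>C y = (\<Sum>i\<in>A. c i *\<^sub>C g i x *\<^sub>C y)" for x y
    by (simp add: assms(4) cvs.scale_sum_left scaleC_scaleC)
qed (use assms(1-3) in \<open>simp_all add: balanced_scale_fst\<close>)

lemma clinear_conv:
  assumes "alg_hom D" "clinear g" "clinear h"
  shows "clinear (conv D g h)"
proof -
  have "clinear D" using assms(1) by (simp add: alg_hom_def)
  then show ?thesis
    by (intro clinearI)
     (simp_all add: conv_def cvsp.linear_add cvsp.linear_scale tensor_lift_add tensor_lift_scaleC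
      balanced_prod assms scaleC_complex_def mult.assoc)
qed

lemma elt_conv_mult:
  assumes D: "alg_hom D" and lin: "\<And>i j. clinear (g i j)"
    and g: "\<And>i j b c. g i j (b * c) = (\<Sum>k\<in>UNIV. g i k b * g k j c)"
  shows "elt_conv D (b * c) (g i j) = (\<Sum>k\<in>UNIV. elt_conv D b (g i k) * elt_conv D c (g (k::'i::finite) j))"
proof -
  note bal = balanced_scale_fst[OF lin]
  have 1: "tensor_lift (\<lambda>x y. g i j x *\<^sub>C y) ((x1 \<otimes> x2) * u) =
    (\<Sum>k\<in>UNIV. (g i k x1 *\<^sub>C x2) * tensor_lift (\<lambda>x y. g k j x *\<^sub>C y) u)" for x1 x2 u
    by (induction u rule: tensor_induct)
      (simp_all add: tensor_lift_zero[OF bal] tensor_lift_add[OF bal] tensor_lift_tens[OF bal]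
        tens_mult_tens distrib_left sum.distrib g cvs.scale_sum_left mult_scaleC_left mult_scaleC_right
        scaleC_scaleC mult.commute)
  have "tensor_lift (\<lambda>x y. g i j x *\<^sub>C y) (t * u) =
    (\<Sum>k\<in>UNIV. tensor_lift (\<lambda>x y. g i k x *\<^sub>C y) t * tensor_lift (\<lambda>x y. g k j x *\<^sub>C y) u)" for t u
    by (induction t rule: tensor_induct)
      (simp_all add: tensor_lift_zero[OF bal] tensor_lift_add[OF bal] tensor_lift_tens[OF bal]
        1 distrib_right sum.distrib)
  then show ?thesis using D by (simp add: elt_conv_def alg_hom_def)
qed

context star_hopf_algebra
begin

text \<open>Both sides are \<open>g(b\<^sub>1) h(b\<^sub>2) b\<^sub>3\<close>. The map \<open>T\<close> of the proof evaluates \<open>g \<otimes> h \<otimes> id\<close> on the triple tensor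
  product; the two bracketings of the iterated coproduct agree by coassociativity.\<close>

lemma elt_conv_conv:
  assumes g: "clinear g" and h: "clinear h"
  shows "elt_conv Delta b (conv Delta g h) = elt_conv Delta (elt_conv Delta b g) h"
proof -
  have Dl: "clinear Delta" using Delta_hom by (simp add: alg_hom_def)
  note bh = balanced_scale_fst[OF h] and bg = balanced_scale_fst[OF g]
  define T where "T = tensor_lift (\<lambda>x u. g x *\<^sub>C tensor_lift (\<lambda>y z. h y *\<^sub>C (z :: 'a)) u)"
  have lift_h: "clinear (tensor_lift (\<lambda>y z. h y *\<^sub>C (z :: 'a)))"
    by (rule clinearI) (simp_all add: tensor_lift_add tensor_lift_scaleC bh clinear_scale[OF h] scaleC_complex_def scaleC_scaleC)
  have T_bal: "balanced (\<lambda>x u. g x *\<^sub>C tensor_lift (\<lambda>y z. h y *\<^sub>C (z :: 'a)) u)"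
    using g lift_h by (simp add: balanced_def cvsp.linear_add cvsp.linear_scale scaleC_add_left
        scaleC_add_right scaleC_complex_def scaleC_scaleC mult.commute)
  note T_simps = tensor_lift_zero[OF T_bal, folded T_def] tensor_lift_add[OF T_bal, folded T_def]
     tensor_lift_tens[OF T_bal, folded T_def]
  have bal_id: "balanced (\<lambda>a b. a \<otimes> Delta b)"
    using Dl by (simp add: balanced_def cvsp.linear_add cvsp.linear_scale tens_bilinear_simps)
  have bal_D: "balanced (\<lambda>a b. Delta a \<otimes> b)"
    using Dl by (simp add: balanced_def cvsp.linear_add cvsp.linear_scale tens_bilinear_simps)
  have bal_3: "balanced (\<lambda>a b. a \<otimes> (b \<otimes> c))" for c :: 'a
    by (simp add: balanced_def tens_bilinear_simps)
  have bal_assoc: "balanced (\<lambda>t c. tensor_lift (\<lambda>a b. a \<otimes> (b \<otimes> c)) t :: ('a, ('a, 'a) tensor) tensor)"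
  proof -
    define L :: "'a \<Rightarrow> ('a, 'a) tensor \<Rightarrow> ('a, ('a, 'a) tensor) tensor"
      where "L c = tensor_lift (\<lambda>a b. a \<otimes> (b \<otimes> c))" for c
    have L: "L c 0 = 0" "L c (t + t') = L c t + L c t'" "L c (a \<otimes> b) = a \<otimes> (b \<otimes> c)"
      "L c (k *\<^sub>C t) = k *\<^sub>C L c t" for c t t' a b k
      unfolding L_def
      by (rule tensor_lift_zero[OF bal_3], rule tensor_lift_add[OF bal_3], rule tensor_lift_tens[OF bal_3],
          rule tensor_lift_scaleC[OF bal_3], simp add: tens_scale_left)
    have "L (c + c') t = L c t + L c' t" "L (k *\<^sub>C c) t = k *\<^sub>C L c t" for c c' k t
      by (induction t rule: tensor_induct) (simp_all add: L tens_bilinear_simps)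
    then have "balanced (\<lambda>t c. L c t)" by (simp add: balanced_def L)
    then show ?thesis by (simp add: L_def)
  qed
  have "elt_conv Delta (elt_conv Delta b g) h = T (tensor_map id Delta (Delta b))"
  proof -
    have "tensor_lift (\<lambda>y z. h y *\<^sub>C z) (Delta (tensor_lift (\<lambda>x y. g x *\<^sub>C y) t)) =
      T (tensor_map id Delta t)" for t
      by (induction t rule: tensor_induct)
        (simp_all add: tensor_map_def tensor_lift_zero[OF bal_id] tensor_lift_add[OF bal_id] tensor_lift_tens[OF bal_id]
          T_simps tensor_lift_zero[OF bg] tensor_lift_add[OF bg] tensor_lift_tens[OF bg]
          cvsp.linear_0[OF Dl] cvsp.linear_add[OF Dl] cvsp.linear_scale[OF Dl]
          cvsp.linear_0[OF lift_h] cvsp.linear_add[OF lift_h] cvsp.linear_scale[OF lift_h])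
    then show ?thesis by (simp add: elt_conv_def)
  qed
  moreover have "elt_conv Delta b (conv Delta g h) = T (tensor_assoc (tensor_map Delta id (Delta b)))"
  proof -
    have c: "tensor_lift (\<lambda>x y. g x * h y) u *\<^sub>C z = T (tensor_lift (\<lambda>a b. a \<otimes> (b \<otimes> z)) u)" for u and z :: 'a
      by (induction u rule: tensor_induct)
        (simp_all add: tensor_lift_zero[OF bal_3] tensor_lift_add[OF bal_3] tensor_lift_tens[OF bal_3]
          T_simps tensor_lift_tens[OF bh] scaleC_add_left scaleC_scaleC
          tensor_lift_zero tensor_lift_add tensor_lift_tens balanced_prod[OF g h])
    have c': "conv Delta g h x *\<^sub>C z = T (tensor_lift (\<lambda>a b. a \<otimes> (b \<otimes> z)) (Delta x))" for x z
      unfolding conv_def by (rule c)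
    note bc = balanced_scale_fst[OF clinear_conv[OF Delta_hom g h]]
    have "tensor_lift (\<lambda>x y. conv Delta g h x *\<^sub>C y) t = T (tensor_assoc (tensor_map Delta id t))" for t
      by (induction t rule: tensor_induct)
        (simp_all add: tensor_map_def tensor_assoc_def tensor_lift_zero[OF bal_D] tensor_lift_add[OF bal_D] tensor_lift_tens[OF bal_D]
          tensor_lift_zero[OF bal_assoc] tensor_lift_add[OF bal_assoc] tensor_lift_tens[OF bal_assoc]
          tensor_lift_zero[OF bc] tensor_lift_add[OF bc] tensor_lift_tens[OF bc] T_simps c'[symmetric])
    then show ?thesis by (simp add: elt_conv_def)
  qed
  ultimately show ?thesis by (simp add: coassoc)
qed

lemma counit_elt_conv:
  assumes "clinear g" shows "counit (elt_conv Delta b g) = g b"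
proof -
  have c: "clinear counit" using counit_hom by (simp add: alg_hom_def)
  note bal = balanced_scale_fst[OF assms]
  have bal': "balanced (\<lambda>x y. counit y *\<^sub>C (x :: 'a))"
    using c by (simp add: balanced_def cvsp.linear_add cvsp.linear_scale scaleC_add_left scaleC_add_right
      scaleC_scaleC scaleC_complex_def mult.commute)
  have "counit (tensor_lift (\<lambda>x y. g x *\<^sub>C y) t) = g (tensor_lift (\<lambda>x y. counit y *\<^sub>C x) t)" for t
    by (induction t rule: tensor_induct)
      (simp_all add: tensor_lift_zero[OF bal] tensor_lift_add[OF bal] tensor_lift_tens[OF bal]
        tensor_lift_zero[OF bal'] tensor_lift_add[OF bal'] tensor_lift_tens[OF bal']
        cvsp.linear_0[OF c] cvsp.linear_add[OF c] clinear_scale[OF c]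
        cvsp.linear_0[OF assms] cvsp.linear_add[OF assms] clinear_scale[OF assms] scaleC_complex_def)
  then show ?thesis by (simp add: elt_conv_def counit_right)
qed

lemma elt_conv_counit: "elt_conv Delta b counit = b"
  unfolding elt_conv_def by (rule counit_left)

text \<open>A multiplicative matrix of functionals turns the antipode axioms into the statement that
  composition with \<open>S\<close> inverts it for convolution.\<close>

lemma conv_antipode:
  assumes lin: "\<And>i j. clinear (g i j)"
    and one: "\<And>i j. g i j 1 = kron i j"
    and g: "\<And>i j b c. g i j (b * c) = (\<Sum>k\<in>UNIV. g i k b * g k j c)"
  shows "(\<Sum>k\<in>UNIV. conv Delta (\<lambda>x. g i k (S x)) (g (k::'i::finite) j) b) = kron i j * counit b"
    "(\<Sum>k\<in>UNIV. conv Delta (g i k) (\<lambda>x. g (k::'i::finite) j (S x)) b) = kron i j * counit b"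
proof -
  have linS: "clinear (\<lambda>x. g i j (S x))" for i j by (rule clinear_compose[OF lin S_linear])
  note b1 = balanced_prod[OF linS lin] and b2 = balanced_prod[OF lin linS]
  have b3: "balanced (\<lambda>x y. S x * y)" "balanced (\<lambda>x y. x * S y)"
    by (simp_all add: balanced_def cvsp.linear_add[OF S_linear] clinear_scale[OF S_linear]
      distrib_left distrib_right mult_scaleC_left mult_scaleC_right)
  have "(\<Sum>k\<in>UNIV. tensor_lift (\<lambda>x y. g i k (S x) * g k j y) t) = g i j (tensor_lift (\<lambda>x y. S x * y) t)" for t
    by (induction t rule: tensor_induct)
      (simp_all add: tensor_lift_zero[OF b1] tensor_lift_add[OF b1] tensor_lift_tens[OF b1]
        tensor_lift_zero[OF b3(1)] tensor_lift_add[OF b3(1)] tensor_lift_tens[OF b3(1)]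
        cvsp.linear_0[OF lin] cvsp.linear_add[OF lin] g sum.distrib)
  then show "(\<Sum>k\<in>UNIV. conv Delta (\<lambda>x. g i k (S x)) (g k j) b) = kron i j * counit b"
    by (simp add: conv_def antipode_left clinear_scale[OF lin] one scaleC_complex_def)
  have "(\<Sum>k\<in>UNIV. tensor_lift (\<lambda>x y. g i k x * g k j (S y)) t) = g i j (tensor_lift (\<lambda>x y. x * S y) t)" for t
    by (induction t rule: tensor_induct)
      (simp_all add: tensor_lift_zero[OF b2] tensor_lift_add[OF b2] tensor_lift_tens[OF b2]
        tensor_lift_zero[OF b3(2)] tensor_lift_add[OF b3(2)] tensor_lift_tens[OF b3(2)]
        cvsp.linear_0[OF lin] cvsp.linear_add[OF lin] g sum.distrib)
  then show "(\<Sum>k\<in>UNIV. conv Delta (g i k) (\<lambda>x. g k j (S x)) b) = kron i j * counit b"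
    by (simp add: conv_def antipode_right clinear_scale[OF lin] one scaleC_complex_def)
qed

end

lemma clinear_combination:
  assumes "\<And>i. i \<in> A \<Longrightarrow> clinear (g i :: _ \<Rightarrow> complex)"
  shows "clinear (\<lambda>x. \<Sum>i\<in>A. c i * g i x)"
  by (rule clinearI)
    (simp_all add: cvsp.linear_add[OF assms] clinear_scale[OF assms] distrib_left sum.distrib
      scaleC_complex_def sum_distrib_left mult.left_commute)

lemma elt_conv_sum:
  assumes "\<And>i. i \<in> A \<Longrightarrow> clinear (g i)" "finite A"
  shows "elt_conv D b (\<lambda>x. \<Sum>i\<in>A. c i * g i x) = (\<Sum>i\<in>A. c i *\<^sub>C elt_conv D b (g i))"
  by (rule elt_conv_combination) (simp_all add: assms clinear_combination)

context star_hopf_algebra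
begin

lemma clinear_elt_conv: "clinear g \<Longrightarrow> clinear (\<lambda>b. elt_conv Delta b g)"
  by (rule elt_conv_clinear[OF Delta_hom])

lemma clinear_conv_Delta: "clinear g \<Longrightarrow> clinear h \<Longrightarrow> clinear (conv Delta g h)"
  by (rule clinear_conv[OF Delta_hom])

lemma functional_conv_elt:
  assumes "clinear g" "clinear h"
  shows "g (conv_elt Delta h b) = conv Delta g h b" "g (elt_conv Delta b h) = conv Delta h g b"
proof -
  note b = balanced_prod[OF assms] balanced_prod[OF assms(2,1)] balanced_scale_fst[OF assms(2)]
  have b': "balanced (\<lambda>x y. h y *\<^sub>C (x :: 'a))"
    using assms by (simp add: balanced_def cvsp.linear_add cvsp.linear_scale scaleC_add_left scaleC_add_right
      scaleC_scaleC scaleC_complex_def mult.commute)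
  have "g (tensor_lift (\<lambda>x y. h y *\<^sub>C x) t) = tensor_lift (\<lambda>x y. g x * h y) t"
    for t
    by (induction t rule: tensor_induct)
      (simp_all add: tensor_lift_zero tensor_lift_add tensor_lift_tens b b' cvsp.linear_0[OF assms(1)]
        cvsp.linear_add[OF assms(1)] clinear_scale[OF assms(1)] scaleC_complex_def mult.commute[of "h _" "g _"])
  moreover have "g (tensor_lift (\<lambda>x y. h x *\<^sub>C y) t) = tensor_lift (\<lambda>x y. h x * g y) t" for t
    by (induction t rule: tensor_induct)
      (simp_all add: tensor_lift_zero tensor_lift_add tensor_lift_tens b b' cvsp.linear_0[OF assms(1)]
        cvsp.linear_add[OF assms(1)] clinear_scale[OF assms(1)] scaleC_complex_def)
  ultimately show "g (conv_elt Delta h b) = conv Delta g h b" "g (elt_conv Delta b h) = conv Delta h g b"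
    by (simp_all add: conv_elt_def elt_conv_def conv_def)
qed

end

section \<open>The functionals of the bicovariant calculus\<close>

context bicovariant_functionals
begin

abbreviation f_op :: "sign \<Rightarrow> 2 \<Rightarrow> 2 \<Rightarrow> 'a \<Rightarrow> 'a"
  where "f_op s i j b \<equiv> elt_conv Delta b (f s i j)"

lemma f_M_crossing: "f s i m (M \<alpha> \<gamma>) = crossing s i \<alpha> \<gamma> m"
  by (simp add: f_M R_crossing)

text \<open>The transpose of \<open>ft\<close> is multiplicative, so \<open>f = ft \<circ> S\<close> is its convolution inverse. As \<open>f\<close> is also
  the \<open>\<epsilon>\<close>-transpose of \<open>ft\<close>, this inverse relation is the invariance of the cup.\<close>

lemma f_op_cup: "(\<Sum>i\<in>UNIV. \<Sum>j\<in>UNIV. epsu i j *\<^sub>C f_op s i k (f_op s j l v)) = epsu k l *\<^sub>C v"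
proof -
  \<comment> \<open>the index of \<open>f\<close> lowered on one side is the index of \<open>ft\<close> raised on the other\<close>
  have lower: "(\<Sum>i\<in>UNIV. epsu i j * f s i k x) = (\<Sum>\<delta>\<in>UNIV. epsu k \<delta> * ft s \<delta> j x)" for j k x
  proof -
    have "(\<Sum>i\<in>UNIV. epsu i j * f s i k x) =
      (\<Sum>\<delta>\<in>UNIV. \<Sum>\<gamma>\<in>UNIV. epsu k \<delta> * ft s \<delta> \<gamma> x * (\<Sum>i\<in>UNIV. eps \<gamma> i * epsu i j))"
      unfolding f_ft_eps by (simp add: sum_2 algebra_simps)
    then show ?thesis by (simp add: eps_epsu)
  qed
  have lower_op: "(\<Sum>i\<in>UNIV. epsu i j *\<^sub>C f_op s i k w) = (\<Sum>\<delta>\<in>UNIV. epsu k \<delta> *\<^sub>C elt_conv Delta w (ft s \<delta> j))"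
    for j w
    using lower by (simp add: linear flip: elt_conv_sum)
  have "(\<Sum>k\<in>UNIV. conv Delta (\<lambda>x. ft s k i (S x)) (ft s j k) b) = kron i j * counit b" for i j b
    by (rule conv_antipode(1)[of "\<lambda>i j. ft s j i"]) (simp_all add: linear at_one kron_commute ft_mult)
  then have conv: "(\<Sum>k\<in>UNIV. conv Delta (f s k i) (ft s j k) b) = kron i j * counit b" for i j b
    by (simp add: f_ft_S comp_def)
  have inverse: "(\<Sum>k\<in>UNIV. elt_conv Delta (f_op s k i b) (ft s j k)) = kron i j *\<^sub>C b" for i j b
  proof -
    have c: "clinear counit" using counit_hom by (simp add: alg_hom_def)
    define g where "g x = kron i j * counit x" for x
    have g: "clinear g"
      using clinear_combination[of "{()}" "\<lambda>_. counit" "\<lambda>_. kron i j"] c by (simp add: g_def[abs_def])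
    have "elt_conv Delta b g = (\<Sum>k\<in>UNIV. 1 *\<^sub>C elt_conv Delta b (conv Delta (f s k i) (ft s j k)))"
      by (rule elt_conv_combination) (simp_all add: g clinear_conv_Delta linear g_def conv)
    moreover have "elt_conv Delta b g = (\<Sum>k\<in>{()}. kron i j *\<^sub>C elt_conv Delta b counit)"
      by (rule elt_conv_combination) (simp_all add: g g_def c)
    ultimately show ?thesis
      by (simp add: scaleC_one elt_conv_counit elt_conv_conv linear)
  qed
  have "(\<Sum>i\<in>UNIV. \<Sum>j\<in>UNIV. epsu i j *\<^sub>C f_op s i k (f_op s j l v))
     = (\<Sum>j\<in>UNIV. \<Sum>\<delta>\<in>UNIV. epsu k \<delta> *\<^sub>C elt_conv Delta (f_op s j l v) (ft s \<delta> j))"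
    by (subst sum.swap) (simp only: lower_op)
  also have "\<dots> = (\<Sum>\<delta>\<in>UNIV. epsu k \<delta> *\<^sub>C (\<Sum>j\<in>UNIV. elt_conv Delta (f_op s j l v) (ft s \<delta> j)))"
    by (subst sum.swap) (simp only: cvs.scale_sum_right)
  also have "\<dots> = (\<Sum>\<delta>\<in>UNIV. kron l \<delta> *\<^sub>C epsu k \<delta> *\<^sub>C v)"
    by (simp only: inverse scaleC_scaleC mult.commute)
  finally show ?thesis by (simp del: cvs.scale_scale)
qed

text \<open>Apply \<open>f s\<close> to the commutation rule of \<open>M\<close> with \<open>f (opp s) \<star> b\<close>: by multiplicativity it splits, and its values
  on \<open>M\<close> are the crossing.\<close>

lemma f_op_crossing:
  "(\<Sum>i\<in>UNIV. \<Sum>j\<in>UNIV. crossing s \<beta> \<gamma> i j *\<^sub>C f_op (opp s) i k (f_op s j l v))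
   = (\<Sum>i\<in>UNIV. \<Sum>j\<in>UNIV. crossing s i j k l *\<^sub>C f_op s \<beta> i (f_op (opp s) \<gamma> j v))"
proof -
  have "(\<Sum>i\<in>UNIV. \<Sum>j\<in>UNIV. crossing s \<beta> \<gamma> i j * conv Delta (f s j l) (f (opp s) i k) b)
   = (\<Sum>i\<in>UNIV. \<Sum>j\<in>UNIV. crossing s i j k l * conv Delta (f (opp s) \<gamma> j) (f s \<beta> i) b)" for b
  proof -
    have "(\<Sum>i\<in>UNIV. \<Sum>j\<in>UNIV. f s \<beta> j (M \<gamma> i) * f s j l (conv_elt Delta (f (opp s) i k) b)) =
      f s \<beta> l (\<Sum>i\<in>UNIV. M \<gamma> i * conv_elt Delta (f (opp s) i k) b)"
      by (simp add: clinear_sum[OF linear(1)] f_mult)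
    also have "\<dots> = f s \<beta> l (\<Sum>j\<in>UNIV. elt_conv Delta b (f (opp s) \<gamma> j) * M j k)"
      by (simp only: M_f)
    also have "\<dots> = (\<Sum>j\<in>UNIV. \<Sum>i\<in>UNIV. f s \<beta> i (elt_conv Delta b (f (opp s) \<gamma> j)) * f s i l (M j k))"
      by (simp add: clinear_sum[OF linear(1)] f_mult)
    also have "\<dots> = (\<Sum>i\<in>UNIV. \<Sum>j\<in>UNIV. f s \<beta> i (elt_conv Delta b (f (opp s) \<gamma> j)) * f s i l (M j k))"
      by (rule sum.swap)
    finally show ?thesis
      by (simp add: f_M_crossing functional_conv_elt linear mult.commute)
  qed
  then have "(\<Sum>p\<in>UNIV. crossing s \<beta> \<gamma> (fst p) (snd p) * conv Delta (f s (snd p) l) (f (opp s) (fst p) k) b)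
   = (\<Sum>p\<in>UNIV. crossing s (fst p) (snd p) k l * conv Delta (f (opp s) \<gamma> (snd p)) (f s \<beta> (fst p)) b)" for b
    by (simp add: sum_UNIV_prod)
  then have "elt_conv Delta v (\<lambda>b. \<Sum>p\<in>UNIV. crossing s \<beta> \<gamma> (fst p) (snd p) * conv Delta (f s (snd p) l) (f (opp s) (fst p) k) b)
   = elt_conv Delta v (\<lambda>b. \<Sum>p\<in>UNIV. crossing s (fst p) (snd p) k l * conv Delta (f (opp s) \<gamma> (snd p)) (f s \<beta> (fst p)) b)"
    by simp
  then show ?thesis
    by (simp add: elt_conv_sum clinear_conv_Delta linear elt_conv_conv) (simp add: sum_UNIV_prod)
qed

end

context quantum_lorentz
begin

abbreviation F_op :: "sign \<Rightarrow> 4 \<Rightarrow> 4 \<Rightarrow> 'a \<Rightarrow> 'a"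
  where "F_op s L K b \<equiv> elt_conv Delta b (F s L K)"

lemma F_eq: "F s L K = (\<lambda>b. \<Sum>r\<in>UNIV. (coframe L (fst r) * frame K (snd r)) *
  conv Delta (f (opp s) (snd (fst r)) (snd (snd r))) (f s (fst (fst r)) (fst (snd r))) b)"
proof
  fix b
  define h where "h \<alpha> \<delta> \<gamma> \<beta> =
    sbar_mix L \<alpha> \<delta> * sig_mix K \<gamma> \<beta> * conv Delta (f (opp s) \<alpha> \<beta>) (f s \<delta> \<gamma>) b / Q" for \<alpha> \<delta> \<gamma> \<beta>
  have "F s L K b = (\<Sum>\<alpha>\<in>UNIV. \<Sum>\<delta>\<in>UNIV. \<Sum>\<gamma>\<in>UNIV. \<Sum>\<beta>\<in>UNIV. h \<alpha> \<delta> \<gamma> \<beta>)"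
    by (simp add: F_def h_def ftd_f sum_divide_distrib)
  also have "\<dots> = (\<Sum>\<delta>\<in>UNIV. \<Sum>\<alpha>\<in>UNIV. \<Sum>\<gamma>\<in>UNIV. \<Sum>\<beta>\<in>UNIV. h \<alpha> \<delta> \<gamma> \<beta>)"
    by (rule sum.swap)
  finally show "F s L K b = (\<Sum>r\<in>UNIV. (coframe L (fst r) * frame K (snd r)) *
    conv Delta (f (opp s) (snd (fst r)) (snd (snd r))) (f s (fst (fst r)) (fst (snd r))) b)"
    unfolding sum_UNIV_prod by (simp add: h_def coframe_def frame_def)
qed

lemma clinear_F: "clinear (F s L K)"
  unfolding F_eq by (intro clinear_combination clinear_conv_Delta linear)

text \<open>Convolution reverses the order: \<open>F\<close> is the product of the dotted and the undotted functional, while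
  its operator applies the dotted one first.\<close>

lemma F_op_eq: "F_op s L K b = vector_op (f_op s) (f_op (opp s)) L K b"
  unfolding F_eq
  by (subst elt_conv_sum)
    (simp_all add: clinear_conv_Delta linear elt_conv_conv vector_op_def sum_UNIV_prod[where 'i = "2 \<times> 2"])

lemma clinear_f_op: "clinear (f_op s i j)"
  by (intro clinear_elt_conv linear)

lemma F_preserves_G:
  "(\<Sum>I\<in>UNIV. \<Sum>J\<in>UNIV. G s $ I $ J *\<^sub>C F_op s I K (F_op s J L b)) = G s $ K $ L *\<^sub>C b"
  unfolding F_op_eq
  by (rule vector_op_preserves_G) (simp_all add: clinear_f_op f_op_cup f_op_crossing)

lemma F_mult: "F s L K (b * c) = (\<Sum>I\<in>UNIV. F s L I b * F s I K c)"
proof -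
  have "F s L K (b * c) = counit (F_op s L K (b * c))"
    by (simp add: counit_elt_conv clinear_F)
  also have "F_op s L K (b * c) = (\<Sum>I\<in>UNIV. F_op s L I b * F_op s I K c)"
    unfolding F_op_eq
    by (rule vector_op_mult[OF clinear_f_op]; rule elt_conv_mult[OF Delta_hom]; simp add: linear f_mult)
  also have "counit \<dots> = (\<Sum>I\<in>UNIV. counit (F_op s L I b) * counit (F_op s I K c))"
    using counit_hom by (simp add: alg_hom_def clinear_sum)
  finally show ?thesis by (simp add: counit_elt_conv clinear_F)
qed

lemma F_one: "F s L K 1 = kron L K"
proof -
  have D1: "Delta 1 = 1 \<otimes> 1" using Delta_hom by (simp add: alg_hom_def one_tensor_def)
  have "conv Delta g h 1 = g 1 * h 1" if "clinear g" "clinear h" for g h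
    by (simp add: conv_def D1 tensor_lift_tens[OF balanced_prod[OF that]])
  then have "F s L K 1 = (\<Sum>r\<in>UNIV. coframe L (fst r) * frame K (snd r) * kron (fst r) (snd r))"
    unfolding F_eq by (simp add: linear at_one kron_prod mult_ac)
  also have "\<dots> = (\<Sum>p\<in>UNIV. \<Sum>q\<in>UNIV. coframe L p * frame K q * kron p q)"
    by (simp add: sum_UNIV_prod[where 'i = "2 \<times> 2"])
  finally show ?thesis by (simp add: coframe_frame)
qed

text \<open>Evaluating \<open>F_preserves_G\<close> on \<open>T\<close> gives invariance under the matrix \<open>B = F(T)\<close>. As \<open>A = F(S(T))\<close> is
  inverse to \<open>B\<close>, multiplication by \<open>A\<close> moves one factor \<open>B\<close> to the other side, and a second
  multiplication cancels the remaining one.\<close>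

lemma F_corep_preserves_G:
  fixes T :: "'i::finite \<Rightarrow> 'i \<Rightarrow> 'a"
  assumes Delta_T: "\<And>i j. Delta (T i j) = (\<Sum>k\<in>UNIV. T i k \<otimes> T k j)"
    and counit_T: "\<And>i j. counit (T i j) = kron i j"
  shows "(\<Sum>I\<in>UNIV. \<Sum>J\<in>UNIV. \<Sum>m\<in>UNIV. G s $ I $ J * F s I K (S (T i m)) * F s J L (S (T m p)))
    = G s $ K $ L * kron i p"
proof -
  define A where "A I K i m = F s I K (S (T i m))" for I K i m
  define B where "B I K i m = F s I K (T i m)" for I K i m
  have lift_sum: "tensor_lift h (\<Sum>k\<in>UNIV. T i k \<otimes> T k j) = (\<Sum>k\<in>UNIV. h (T i k) (T k j))"
    if "balanced h" for h :: "'a \<Rightarrow> 'a \<Rightarrow> 'c::ab_group_add" and i j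
  proof -
    have "tensor_lift h (\<Sum>k\<in>X. T i k \<otimes> T k j) = (\<Sum>k\<in>X. h (T i k) (T k j))" if "finite X" for X
      using that by induction (simp_all add: tensor_lift_zero tensor_lift_add tensor_lift_tens \<open>balanced h\<close>)
    then show ?thesis by simp
  qed
  have BA: "(\<Sum>I\<in>UNIV. \<Sum>l\<in>UNIV. B I' I r l * A I K l m) = kron I' K * kron r m" for I' K r m
  proof -
    have "clinear (\<lambda>x. F s I K (S x))" for I K by (rule clinear_compose[OF clinear_F S_linear])
    then have "conv Delta (F s I' I) (\<lambda>x. F s I K (S x)) (T r m) = (\<Sum>l\<in>UNIV. B I' I r l * A I K l m)" for I
      by (simp add: conv_def Delta_T A_def B_def lift_sum balanced_prod clinear_F)
    then show ?thesis
      using conv_antipode(2)[of "F s", OF clinear_F F_one F_mult, of I' K "T r m"]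
      by (simp add: counit_T)
  qed
  have elt: "F_op s J L (T i p) = (\<Sum>m\<in>UNIV. B J L i m *\<^sub>C T m p)" for J L i p
    by (simp add: elt_conv_def Delta_T B_def lift_sum balanced_scale_fst clinear_F)
  have BB: "(\<Sum>I'\<in>UNIV. \<Sum>J'\<in>UNIV. \<Sum>r\<in>UNIV. G s $ I' $ J' * B J' J i r * B I' I r l) = G s $ I $ J * kron i l"
    for I J i l
  proof -
    have c: "clinear counit" using counit_hom by (simp add: alg_hom_def)
    have "counit (\<Sum>I'\<in>UNIV. \<Sum>J'\<in>UNIV. G s $ I' $ J' *\<^sub>C F_op s I' I (F_op s J' J (T i l)))
       = G s $ I $ J * kron i l"
      unfolding F_preserves_G by (simp add: clinear_scale[OF c] counit_T scaleC_complex_def)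
    moreover have "counit (F_op s I' I (F_op s J' J (T i l))) = (\<Sum>r\<in>UNIV. B J' J i r * B I' I r l)" for I' J'
      by (simp add: counit_elt_conv[OF clinear_F] elt clinear_sum[OF clinear_F] clinear_scale[OF clinear_F]
         scaleC_complex_def B_def)
    ultimately show ?thesis
      by (simp add: clinear_sum[OF c] clinear_scale[OF c] scaleC_complex_def sum_distrib_left mult.assoc)
  qed
  \<comment> \<open>the invariance \<open>BB\<close> multiplied by \<open>A\<close>, which cancels one of the two factors \<open>B\<close>\<close>
  have GA: "(\<Sum>I\<in>UNIV. G s $ I $ J * A I K i m) = (\<Sum>J'\<in>UNIV. G s $ K $ J' * B J' J i m)" for J K i m
  proof -
    have "(\<Sum>I\<in>UNIV. G s $ I $ J * A I K i m) = (\<Sum>I\<in>UNIV. \<Sum>l\<in>UNIV. (G s $ I $ J * kron i l) * A I K l m)"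
      by (simp add: mult.assoc flip: sum_distrib_left)
    also have "\<dots> = (\<Sum>I\<in>UNIV. \<Sum>l\<in>UNIV. \<Sum>I'\<in>UNIV. \<Sum>J'\<in>UNIV. \<Sum>r\<in>UNIV.
         G s $ I' $ J' * B J' J i r * (B I' I r l * A I K l m))"
      unfolding BB[symmetric] by (simp add: sum_distrib_right mult.assoc)
    also have "\<dots> = (\<Sum>I\<in>UNIV. \<Sum>I'\<in>UNIV. \<Sum>J'\<in>UNIV. \<Sum>r\<in>UNIV. \<Sum>l\<in>UNIV.
         G s $ I' $ J' * B J' J i r * (B I' I r l * A I K l m))"
      by (rule sum.cong[OF refl], rule sum_swap4)
    also have "\<dots> = (\<Sum>I'\<in>UNIV. \<Sum>J'\<in>UNIV. \<Sum>r\<in>UNIV. \<Sum>I\<in>UNIV. \<Sum>l\<in>UNIV.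
         G s $ I' $ J' * B J' J i r * (B I' I r l * A I K l m))"
      by (rule sum_swap4)
    also have "\<dots> = (\<Sum>I'\<in>UNIV. \<Sum>J'\<in>UNIV. \<Sum>r\<in>UNIV. G s $ I' $ J' * B J' J i r * (kron I' K * kron r m))"
      by (simp only: BA flip: sum_distrib_left)
    also have "\<dots> = (\<Sum>I'\<in>UNIV. kron I' K * (\<Sum>J'\<in>UNIV. \<Sum>r\<in>UNIV. kron r m * (G s $ I' $ J' * B J' J i r)))"
      unfolding sum_distrib_left by (intro sum.cong refl) (simp add: mult_ac)
    finally show ?thesis by simp
  qed
  have "(\<Sum>I\<in>UNIV. \<Sum>J\<in>UNIV. \<Sum>m\<in>UNIV. G s $ I $ J * A I K i m * A J L m p) =
     (\<Sum>J\<in>UNIV. \<Sum>m\<in>UNIV. (\<Sum>I\<in>UNIV. G s $ I $ J * A I K i m) * A J L m p)"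
    by (simp only: sum_distrib_right) (rule sum_swap3)
  also have "\<dots> = (\<Sum>J\<in>UNIV. \<Sum>m\<in>UNIV. \<Sum>J'\<in>UNIV. G s $ K $ J' * (B J' J i m * A J L m p))"
    unfolding GA by (simp add: sum_distrib_right mult.assoc)
  also have "\<dots> = (\<Sum>J'\<in>UNIV. \<Sum>J\<in>UNIV. \<Sum>m\<in>UNIV. G s $ K $ J' * (B J' J i m * A J L m p))"
    by (rule sum_swap3[symmetric])
  also have "\<dots> = (\<Sum>J'\<in>UNIV. G s $ K $ J' * (kron J' L * kron i p))"
    by (simp only: BA flip: sum_distrib_left)
  also have "\<dots> = G s $ K $ L * kron i p"
    by (simp add: mult.left_commute[of _ "kron _ L"])
  finally show ?thesis by (simp add: A_def)
qed

end

section \<open>The Lorentz generators preserve the metric\<close>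

lemma tens_sum_left: "sum u A \<otimes> w = (\<Sum>i\<in>A. u i \<otimes> w)"
proof -
  have "clinear (\<lambda>u. u \<otimes> w)" by (rule clinearI) (simp_all add: tens_add_left tens_scale_left)
  then show ?thesis by (rule clinear_sum)
qed

lemma tens_sum_right: "w \<otimes> sum u A = (\<Sum>i\<in>A. w \<otimes> u i)"
proof -
  have "clinear (\<lambda>u. w \<otimes> u)" by (rule clinearI) (simp_all add: tens_add_right tens_scale_right)
  then show ?thesis by (rule clinear_sum)
qed

lemma clinear_mult_left: "clinear (\<lambda>v. b * v :: 'a::complex_algebra_1)"
  by (rule clinearI) (simp_all add: distrib_left mult_scaleC_right)

context quantum_SL2C
begin

text \<open>The indices are transposed because \<open>S\<^sup>-\<^sup>1\<close> reverses coproducts: with this convention \<open>Mdi\<close> is again a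
  matrix corepresentation, as \<open>Delta_Mdi\<close> shows.\<close>

definition Mdi :: "2 \<Rightarrow> 2 \<Rightarrow> 'a"
  where "Mdi \<gamma> \<rho> = inv S (Md \<rho> \<gamma>)"

lemma Mdi_eq: "Mdi i k = (\<Sum>\<delta>\<in>UNIV. \<Sum>\<gamma>\<in>UNIV. (eps \<delta> i * epsu k \<gamma>) *\<^sub>C Md \<delta> \<gamma>)"
  by (simp add: Mdi_def inv_S_Md epsud_def epsd_def cnj_eps cnj_epsu)

lemma Mdi_eq1: "Mdi i k = (\<Sum>\<delta>\<in>UNIV. eps \<delta> i *\<^sub>C (\<Sum>\<gamma>\<in>UNIV. epsu k \<gamma> *\<^sub>C Md \<delta> \<gamma>))"
  by (simp add: Mdi_eq cvs.scale_sum_right)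

lemma Mdi_eq2: "Mdi i k = (\<Sum>\<gamma>\<in>UNIV. epsu k \<gamma> *\<^sub>C (\<Sum>\<delta>\<in>UNIV. eps \<delta> i *\<^sub>C Md \<delta> \<gamma>))"
  unfolding Mdi_eq by (subst sum.swap) (simp add: cvs.scale_sum_right mult.commute)

lemma eps_Md_Md:
  "(\<Sum>\<delta>\<in>UNIV. \<Sum>\<epsilon>\<in>UNIV. eps \<epsilon> \<delta> *\<^sub>C (Md \<delta> \<alpha> * Md \<epsilon> \<beta>)) = eps \<beta> \<alpha> *\<^sub>C 1"
  using epsud_Md_Md[of \<alpha> \<beta>] by (simp add: epsud_def cnj_epsu sum_negf)

lemma Mdi_cup: "(\<Sum>i\<in>UNIV. \<Sum>j\<in>UNIV. epsu i j *\<^sub>C (Mdi i k * Mdi j l)) = epsu k l *\<^sub>C 1"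
proof -
  define n where "n \<delta> k = (\<Sum>\<gamma>\<in>UNIV. epsu k \<gamma> *\<^sub>C Md \<delta> \<gamma>)" for \<delta> k
  have "(\<Sum>i\<in>UNIV. \<Sum>j\<in>UNIV. epsu i j *\<^sub>C (Mdi i k * Mdi j l)) =
    (\<Sum>i\<in>UNIV. \<Sum>j\<in>UNIV. \<Sum>\<delta>\<in>UNIV. \<Sum>\<epsilon>\<in>UNIV. (eps \<delta> i * epsu i j * eps \<epsilon> j) *\<^sub>C (n \<delta> k * n \<epsilon> l))"
    by (simp add: Mdi_eq1 n_def[symmetric] sum_product cvs.scale_sum_right mult_scaleC_left
        mult_scaleC_right mult_ac)
  also have "\<dots> = (\<Sum>i\<in>UNIV. \<Sum>\<delta>\<in>UNIV. \<Sum>\<epsilon>\<in>UNIV. \<Sum>j\<in>UNIV. (eps \<delta> i * epsu i j * eps \<epsilon> j) *\<^sub>C (n \<delta> k * n \<epsilon> l))"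
    by (rule sum.cong[OF refl], rule sum_swap3)
  also have "\<dots> = (\<Sum>\<delta>\<in>UNIV. \<Sum>\<epsilon>\<in>UNIV. \<Sum>i\<in>UNIV. \<Sum>j\<in>UNIV. (eps \<delta> i * epsu i j * eps \<epsilon> j) *\<^sub>C (n \<delta> k * n \<epsilon> l))"
    by (rule sum_swap3)
  also have "\<dots> = (\<Sum>\<delta>\<in>UNIV. \<Sum>\<epsilon>\<in>UNIV. eps \<epsilon> \<delta> *\<^sub>C (n \<delta> k * n \<epsilon> l))"
  proof -
    have "(\<Sum>i\<in>UNIV. \<Sum>j\<in>UNIV. eps \<delta> i * epsu i j * eps \<epsilon> j) = eps \<epsilon> \<delta>" for \<delta> \<epsilon>
    proof -
      have "(\<Sum>i\<in>UNIV. \<Sum>j\<in>UNIV. eps \<delta> i * epsu i j * eps \<epsilon> j) =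
        (\<Sum>j\<in>UNIV. (\<Sum>i\<in>UNIV. eps \<delta> i * epsu i j) * eps \<epsilon> j)"
        by (subst sum.swap) (simp only: sum_distrib_right)
      then show ?thesis by (simp add: eps_epsu)
    qed
    then show ?thesis by (simp flip: cvs.scale_sum_left)
  qed
  also have "\<dots> = (\<Sum>\<delta>\<in>UNIV. \<Sum>\<epsilon>\<in>UNIV. \<Sum>\<alpha>\<in>UNIV. \<Sum>\<beta>\<in>UNIV.
      (epsu k \<alpha> * epsu l \<beta>) *\<^sub>C eps \<epsilon> \<delta> *\<^sub>C (Md \<delta> \<alpha> * Md \<epsilon> \<beta>))"
    unfolding n_def sum_product mult_scaleC_left mult_scaleC_right cvs.scale_sum_right scaleC_scaleC
    by (intro sum.cong refl) (simp add: mult_ac)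
  also have "\<dots> = (\<Sum>\<delta>\<in>UNIV. \<Sum>\<alpha>\<in>UNIV. \<Sum>\<beta>\<in>UNIV. \<Sum>\<epsilon>\<in>UNIV.
      (epsu k \<alpha> * epsu l \<beta>) *\<^sub>C eps \<epsilon> \<delta> *\<^sub>C (Md \<delta> \<alpha> * Md \<epsilon> \<beta>))"
    by (rule sum.cong[OF refl], rule sum_swap3)
  also have "\<dots> = (\<Sum>\<alpha>\<in>UNIV. \<Sum>\<beta>\<in>UNIV. \<Sum>\<delta>\<in>UNIV. \<Sum>\<epsilon>\<in>UNIV.
      (epsu k \<alpha> * epsu l \<beta>) *\<^sub>C eps \<epsilon> \<delta> *\<^sub>C (Md \<delta> \<alpha> * Md \<epsilon> \<beta>))"
    by (rule sum_swap3)
  also have "\<dots> = (\<Sum>\<alpha>\<in>UNIV. \<Sum>\<beta>\<in>UNIV. (epsu k \<alpha> * epsu l \<beta>) *\<^sub>C eps \<beta> \<alpha> *\<^sub>C 1)"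
    by (simp only: eps_Md_Md flip: cvs.scale_sum_right)
  also have "\<dots> = (\<Sum>\<alpha>\<in>UNIV. epsu k \<alpha> * (\<Sum>\<beta>\<in>UNIV. epsu l \<beta> * eps \<beta> \<alpha>)) *\<^sub>C 1"
    by (simp add: cvs.scale_sum_left sum_distrib_left mult.assoc)
  finally show ?thesis by (simp add: epsu_eps)
qed

lemma Rdu_crossing: "Rdu s \<delta> \<gamma> \<alpha> \<sigma> = crossing (opp s) \<delta> \<alpha> \<gamma> \<sigma>"
  using R_crossing[of "opp s"] by (simp add: Rdu_def)

text \<open>Bending one leg of a crossing with \<open>\<epsilon>\<close> gives the mirror crossing; this rewrites the relation
  between \<open>M\<close> and \<open>Md\<close> as one between \<open>M\<close> and \<open>Mdi\<close>.\<close>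

lemma crossing_rotate_left:
  "(\<Sum>i\<in>UNIV. crossing s \<alpha> c i j * eps \<delta> i) = (\<Sum>\<sigma>\<in>UNIV. eps \<sigma> c * Rdu s \<delta> j \<alpha> \<sigma>)"
proof -
  have "(\<Sum>i\<in>UNIV. crossing s \<alpha> c i j * eps \<delta> i) =
    spow (sqrt a) (opp s) * kron c j * (\<Sum>i\<in>UNIV. kron \<alpha> i * eps \<delta> i)
    + spow (sqrt a) s * eps \<alpha> c * (\<Sum>i\<in>UNIV. eps \<delta> i * epsu i j)"
    unfolding crossing_def by (simp add: sum_2 algebra_simps del: sum_kron)
  moreover have "(\<Sum>\<sigma>\<in>UNIV. eps \<sigma> c * Rdu s \<delta> j \<alpha> \<sigma>) =
    spow (sqrt a) s * kron \<delta> j * (\<Sum>\<sigma>\<in>UNIV. kron \<alpha> \<sigma> * eps \<sigma> c)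
    + spow (sqrt a) (opp s) * eps \<delta> \<alpha> * (\<Sum>\<sigma>\<in>UNIV. epsu j \<sigma> * eps \<sigma> c)"
    unfolding Rdu_crossing crossing_def by (simp add: sum_2 algebra_simps del: sum_kron)
  ultimately show ?thesis by (simp add: eps_epsu epsu_eps kron_commute[of j])
qed

lemma crossing_rotate_right:
  "(\<Sum>j\<in>UNIV. crossing s i j d \<beta> * epsu j \<delta>) = (\<Sum>\<rho>\<in>UNIV. epsu d \<rho> * Rdu s \<rho> \<beta> i \<delta>)"
proof -
  have "(\<Sum>j\<in>UNIV. crossing s i j d \<beta> * epsu j \<delta>) =
    spow (sqrt a) (opp s) * kron i d * (\<Sum>j\<in>UNIV. kron j \<beta> * epsu j \<delta>)
    + spow (sqrt a) s * epsu d \<beta> * (\<Sum>j\<in>UNIV. eps i j * epsu j \<delta>)"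
    unfolding crossing_def by (simp add: sum_2 algebra_simps del: sum_kron)
  moreover have "(\<Sum>\<rho>\<in>UNIV. epsu d \<rho> * Rdu s \<rho> \<beta> i \<delta>) =
    spow (sqrt a) s * kron i \<delta> * (\<Sum>\<rho>\<in>UNIV. kron \<rho> \<beta> * epsu d \<rho>)
    + spow (sqrt a) (opp s) * epsu \<beta> \<delta> * (\<Sum>\<rho>\<in>UNIV. epsu d \<rho> * eps \<rho> i)"
    unfolding Rdu_crossing crossing_def by (simp add: sum_2 algebra_simps del: sum_kron)
  ultimately show ?thesis by (simp add: eps_epsu epsu_eps kron_commute[of d] kron_commute[of \<delta>])
qed

text \<open>The relation \<open>M_Md_R\<close> with two legs bent by \<open>\<epsilon>\<close>.\<close>

lemma Mdi_M_crossing: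
  "(\<Sum>i\<in>UNIV. \<Sum>j\<in>UNIV. crossing s \<alpha> c i j *\<^sub>C (Mdi i d * M j \<beta>))
   = (\<Sum>i\<in>UNIV. \<Sum>j\<in>UNIV. crossing s i j d \<beta> *\<^sub>C (M \<alpha> i * Mdi c j))"
proof -
  have "(\<Sum>i\<in>UNIV. \<Sum>j\<in>UNIV. crossing s \<alpha> c i j *\<^sub>C (Mdi i d * M j \<beta>)) =
    (\<Sum>i\<in>UNIV. \<Sum>j\<in>UNIV. \<Sum>\<delta>\<in>UNIV. \<Sum>\<rho>\<in>UNIV. (crossing s \<alpha> c i j * eps \<delta> i) *\<^sub>C epsu d \<rho> *\<^sub>C (Md \<delta> \<rho> * M j \<beta>))"
    by (simp add: Mdi_eq sum_distrib_right cvs.scale_sum_right mult_scaleC_left mult.assoc)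
  also have "\<dots> = (\<Sum>j\<in>UNIV. \<Sum>\<delta>\<in>UNIV. \<Sum>\<rho>\<in>UNIV. \<Sum>i\<in>UNIV.
     (crossing s \<alpha> c i j * eps \<delta> i) *\<^sub>C epsu d \<rho> *\<^sub>C (Md \<delta> \<rho> * M j \<beta>))"
    by (rule sum_swap4)
  also have "\<dots> = (\<Sum>j\<in>UNIV. \<Sum>\<delta>\<in>UNIV. \<Sum>\<rho>\<in>UNIV. \<Sum>\<sigma>\<in>UNIV.
     (eps \<sigma> c * Rdu s \<delta> j \<alpha> \<sigma>) *\<^sub>C epsu d \<rho> *\<^sub>C (Md \<delta> \<rho> * M j \<beta>))"
    by (simp only: crossing_rotate_left flip: cvs.scale_sum_left)
  also have "\<dots> = (\<Sum>\<rho>\<in>UNIV. \<Sum>j\<in>UNIV. \<Sum>\<delta>\<in>UNIV. \<Sum>\<sigma>\<in>UNIV.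
     (eps \<sigma> c * Rdu s \<delta> j \<alpha> \<sigma>) *\<^sub>C epsu d \<rho> *\<^sub>C (Md \<delta> \<rho> * M j \<beta>))"
    by (rule sum_swap3[symmetric])
  also have "\<dots> = (\<Sum>\<rho>\<in>UNIV. \<Sum>\<sigma>\<in>UNIV. \<Sum>j\<in>UNIV. \<Sum>\<delta>\<in>UNIV.
     (eps \<sigma> c * Rdu s \<delta> j \<alpha> \<sigma>) *\<^sub>C epsu d \<rho> *\<^sub>C (Md \<delta> \<rho> * M j \<beta>))"
    by (rule sum.cong[OF refl], rule sum_swap3[symmetric])
  also have "\<dots> = (\<Sum>\<rho>\<in>UNIV. \<Sum>\<sigma>\<in>UNIV. (epsu d \<rho> * eps \<sigma> c) *\<^sub>C
      (\<Sum>j\<in>UNIV. \<Sum>\<delta>\<in>UNIV. Rdu s \<delta> j \<alpha> \<sigma> *\<^sub>C (Md \<delta> \<rho> * M j \<beta>)))"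
    unfolding cvs.scale_sum_right scaleC_scaleC by (intro sum.cong refl) (simp add: mult_ac)
  also have "\<dots> = (\<Sum>\<rho>\<in>UNIV. \<Sum>\<sigma>\<in>UNIV. (epsu d \<rho> * eps \<sigma> c) *\<^sub>C
      (\<Sum>\<delta>\<in>UNIV. \<Sum>j\<in>UNIV. Rdu s \<delta> j \<alpha> \<sigma> *\<^sub>C (Md \<delta> \<rho> * M j \<beta>)))"
    by (subst (3) sum.swap) (rule refl)
  also have "\<dots> = (\<Sum>\<rho>\<in>UNIV. \<Sum>\<sigma>\<in>UNIV. (epsu d \<rho> * eps \<sigma> c) *\<^sub>C
      (\<Sum>i\<in>UNIV. \<Sum>\<delta>\<in>UNIV. Rdu s \<rho> \<beta> i \<delta> *\<^sub>C (M \<alpha> i * Md \<sigma> \<delta>)))"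
    by (simp only: M_Md_R)
  also have "\<dots> = (\<Sum>\<rho>\<in>UNIV. \<Sum>\<sigma>\<in>UNIV. \<Sum>i\<in>UNIV. \<Sum>\<delta>\<in>UNIV.
      (epsu d \<rho> * Rdu s \<rho> \<beta> i \<delta>) *\<^sub>C eps \<sigma> c *\<^sub>C (M \<alpha> i * Md \<sigma> \<delta>))"
    unfolding cvs.scale_sum_right scaleC_scaleC by (intro sum.cong refl) (simp add: mult_ac)
  also have "\<dots> = (\<Sum>\<rho>\<in>UNIV. \<Sum>i\<in>UNIV. \<Sum>\<sigma>\<in>UNIV. \<Sum>\<delta>\<in>UNIV.
      (epsu d \<rho> * Rdu s \<rho> \<beta> i \<delta>) *\<^sub>C eps \<sigma> c *\<^sub>C (M \<alpha> i * Md \<sigma> \<delta>))"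
    by (rule sum.cong[OF refl], rule sum.swap)
  also have "\<dots> = (\<Sum>i\<in>UNIV. \<Sum>\<sigma>\<in>UNIV. \<Sum>\<delta>\<in>UNIV. \<Sum>\<rho>\<in>UNIV.
      (epsu d \<rho> * Rdu s \<rho> \<beta> i \<delta>) *\<^sub>C eps \<sigma> c *\<^sub>C (M \<alpha> i * Md \<sigma> \<delta>))"
    by (rule sum_swap4)
  also have "\<dots> = (\<Sum>i\<in>UNIV. \<Sum>\<sigma>\<in>UNIV. \<Sum>\<delta>\<in>UNIV. \<Sum>j\<in>UNIV.
      (crossing s i j d \<beta> * epsu j \<delta>) *\<^sub>C eps \<sigma> c *\<^sub>C (M \<alpha> i * Md \<sigma> \<delta>))"
    by (simp only: crossing_rotate_right flip: cvs.scale_sum_left)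
  also have "\<dots> = (\<Sum>i\<in>UNIV. \<Sum>j\<in>UNIV. \<Sum>\<sigma>\<in>UNIV. \<Sum>\<delta>\<in>UNIV.
      (crossing s i j d \<beta> * epsu j \<delta>) *\<^sub>C eps \<sigma> c *\<^sub>C (M \<alpha> i * Md \<sigma> \<delta>))"
    by (rule sum.cong[OF refl], rule sum_swap3[symmetric])
  also have "\<dots> = (\<Sum>i\<in>UNIV. \<Sum>j\<in>UNIV. crossing s i j d \<beta> *\<^sub>C (M \<alpha> i * Mdi c j))"
    unfolding Mdi_eq sum_distrib_left cvs.scale_sum_right mult_scaleC_right scaleC_scaleC
    by (intro sum.cong refl) (simp add: mult_ac)
  finally show ?thesis .
qed

lemma Delta_Mdi: "Delta (Mdi i k) = (\<Sum>j\<in>UNIV. Mdi i j \<otimes> Mdi j k)"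
proof -
  have Dl: "clinear Delta" using Delta_hom by (simp add: alg_hom_def)
  define n where "n \<gamma> = (\<Sum>\<delta>\<in>UNIV. eps \<delta> i *\<^sub>C Md \<delta> \<gamma>)" for \<gamma>
  define n' where "n' \<delta> = (\<Sum>\<gamma>\<in>UNIV. epsu k \<gamma> *\<^sub>C Md \<delta> \<gamma>)" for \<delta>
  have "(\<Sum>j\<in>UNIV. Mdi i j \<otimes> Mdi j k) =
    (\<Sum>j\<in>UNIV. \<Sum>\<mu>\<in>UNIV. \<Sum>\<kappa>\<in>UNIV. (eps \<mu> j * epsu j \<kappa>) *\<^sub>C (n \<kappa> \<otimes> n' \<mu>))"
    unfolding Mdi_eq1[of _ k] Mdi_eq2[of i] n_def[symmetric] n'_def[symmetric]
      tens_sum_left tens_sum_right tens_scale_left tens_scale_right cvs.scale_sum_right scaleC_scaleC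
    by (intro sum.cong refl)
  also have "\<dots> = (\<Sum>\<mu>\<in>UNIV. \<Sum>\<kappa>\<in>UNIV. \<Sum>j\<in>UNIV. (eps \<mu> j * epsu j \<kappa>) *\<^sub>C (n \<kappa> \<otimes> n' \<mu>))"
    by (rule sum_swap3)
  also have "\<dots> = (\<Sum>\<kappa>\<in>UNIV. n \<kappa> \<otimes> n' \<kappa>)"
    by (simp add: eps_epsu flip: cvs.scale_sum_left)
  also have "\<dots> = (\<Sum>\<kappa>\<in>UNIV. \<Sum>\<delta>\<in>UNIV. \<Sum>\<gamma>\<in>UNIV. (eps \<delta> i * epsu k \<gamma>) *\<^sub>C (Md \<delta> \<kappa> \<otimes> Md \<kappa> \<gamma>))"
    unfolding n_def n'_def tens_sum_left tens_scale_left tens_sum_right tens_scale_right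
      cvs.scale_sum_right scaleC_scaleC
    by (subst (2) sum.swap) (simp add: mult.commute)
  also have "\<dots> = (\<Sum>\<delta>\<in>UNIV. \<Sum>\<gamma>\<in>UNIV. \<Sum>\<kappa>\<in>UNIV. (eps \<delta> i * epsu k \<gamma>) *\<^sub>C (Md \<delta> \<kappa> \<otimes> Md \<kappa> \<gamma>))"
    by (rule sum_swap3)
  also have "\<dots> = Delta (Mdi i k)"
    by (simp only: Mdi_eq clinear_sum[OF Dl] clinear_scale[OF Dl] Delta_Md cvs.scale_sum_right)
  finally show ?thesis ..
qed

lemma counit_Mdi: "counit (Mdi i k) = kron i k"
proof -
  have c: "clinear counit" using counit_hom by (simp add: alg_hom_def)
  have "counit (Mdi i k) = (\<Sum>\<gamma>\<in>UNIV. epsu k \<gamma> * (\<Sum>\<delta>\<in>UNIV. eps \<delta> i * kron \<delta> \<gamma>))"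
    by (simp only: Mdi_eq2 clinear_sum[OF c] clinear_scale[OF c] counit_Md scaleC_complex_def)
  then show ?thesis by (simp add: epsu_eps kron_commute)
qed

end

context quantum_lorentz
begin

lemma Lambda_vector_op:
  "Lambda L K * v = vector_op (\<lambda>i j v. M i j * v) (\<lambda>i j v. Mdi i j * v) L K v"
proof -
  define h where "h \<gamma> \<alpha> \<sigma> \<rho> = (sbar_mix L \<gamma> \<alpha> * sig_mix K \<sigma> \<rho> / Q) *\<^sub>C (M \<alpha> \<sigma> * Mdi \<gamma> \<rho>)" for \<gamma> \<alpha> \<sigma> \<rho>
  have "Lambda L K = (\<Sum>\<gamma>\<in>UNIV. \<Sum>\<alpha>\<in>UNIV. \<Sum>\<sigma>\<in>UNIV. \<Sum>\<rho>\<in>UNIV. h \<gamma> \<alpha> \<sigma> \<rho>)"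
    by (simp add: Lambda_def h_def Mdi_def cvs.scale_sum_right)
  also have "\<dots> = (\<Sum>\<alpha>\<in>UNIV. \<Sum>\<gamma>\<in>UNIV. \<Sum>\<sigma>\<in>UNIV. \<Sum>\<rho>\<in>UNIV. h \<gamma> \<alpha> \<sigma> \<rho>)"
    by (rule sum.swap)
  finally show ?thesis
    by (simp add: vector_op_def sum_UNIV_prod h_def coframe_def frame_def sum_distrib_right
        mult_scaleC_left mult.assoc)
qed

lemma Lambda_preserves_G:
  "(\<Sum>I\<in>UNIV. \<Sum>J\<in>UNIV. G s $ I $ J *\<^sub>C (Lambda I K * Lambda J L)) = G s $ K $ L *\<^sub>C 1"
proof -
  have "(\<Sum>I\<in>UNIV. \<Sum>J\<in>UNIV. G s $ I $ J *\<^sub>C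
     vector_op (\<lambda>i j v. M i j * v) (\<lambda>i j v. Mdi i j * v) I K
       (vector_op (\<lambda>i j v. M i j * v) (\<lambda>i j v. Mdi i j * v) J L 1)) = G s $ K $ L *\<^sub>C 1"
  proof (rule vector_op_preserves_G)
    show "(\<Sum>i\<in>UNIV. \<Sum>j\<in>UNIV. epsu i j *\<^sub>C (M i k * (M j l * v))) = epsu k l *\<^sub>C v" for k l v
      using arg_cong[OF epsu_M_M[of k l], of "\<lambda>x. x * v"]
      by (simp add: sum_distrib_right mult_scaleC_left mult.assoc)
    show "(\<Sum>i\<in>UNIV. \<Sum>j\<in>UNIV. epsu i j *\<^sub>C (Mdi i k * (Mdi j l * v))) = epsu k l *\<^sub>C v" for k l v
      using arg_cong[OF Mdi_cup[of k l], of "\<lambda>x. x * v"]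
      by (simp add: sum_distrib_right mult_scaleC_left mult.assoc)
    show "(\<Sum>i\<in>UNIV. \<Sum>j\<in>UNIV. crossing s \<beta> \<gamma> i j *\<^sub>C (Mdi i k * (M j l * v))) =
       (\<Sum>i\<in>UNIV. \<Sum>j\<in>UNIV. crossing s i j k l *\<^sub>C (M \<beta> i * (Mdi \<gamma> j * v)))" for \<beta> \<gamma> k l v
      using arg_cong[OF Mdi_M_crossing[of s \<beta> \<gamma> k l], of "\<lambda>x. x * v"]
      by (simp add: sum_distrib_right mult_scaleC_left mult.assoc)
  qed (rule clinear_mult_left)+
  then show ?thesis by (simp flip: Lambda_vector_op)
qed

lemma Lambda_sum: "Lambda L K = (\<Sum>p\<in>UNIV. \<Sum>q\<in>UNIV.
    (coframe L p * frame K q) *\<^sub>C (M (fst p) (fst q) * Mdi (snd p) (snd q)))"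
  using Lambda_vector_op[of L K 1] by (simp add: vector_op_def)

lemma counit_Lambda: "counit (Lambda L K) = kron L K"
proof -
  have c: "clinear counit" "counit (x * y) = counit x * counit y" for x y
    using counit_hom by (simp_all add: alg_hom_def)
  have "counit (Lambda L K) = (\<Sum>p\<in>UNIV. \<Sum>q\<in>UNIV. (coframe L p * frame K q) * kron p q)"
    by (simp only: Lambda_sum clinear_sum[OF c(1)] clinear_scale[OF c(1)] c(2) counit_M counit_Mdi
        kron_prod scaleC_complex_def)
  then show ?thesis by (simp add: coframe_frame)
qed

lemma Delta_Lambda: "Delta (Lambda L K) = (\<Sum>J\<in>UNIV. Lambda L J \<otimes> Lambda J K)"
proof -
  have D: "clinear Delta" "Delta (x * y) = Delta x * Delta y" for x y
    using Delta_hom by (simp_all add: alg_hom_def)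
  let ?D = "\<lambda>p q. M (fst p) (fst q) * Mdi (snd p) (snd q)"
  have frame: "(\<Sum>J\<in>UNIV. frame J r *\<^sub>C Lambda J K) = (\<Sum>q\<in>UNIV. frame K q *\<^sub>C ?D r q)" for r
    using frame_vector_op[of r "\<lambda>i j v. M i j * v" "\<lambda>i j v. Mdi i j * v" K 1]
    by (simp flip: Lambda_vector_op)
  have "(\<Sum>J\<in>UNIV. Lambda L J \<otimes> Lambda J K) =
     (\<Sum>J\<in>UNIV. \<Sum>p\<in>UNIV. \<Sum>r\<in>UNIV. coframe L p *\<^sub>C (?D p r \<otimes> frame J r *\<^sub>C Lambda J K))"
    unfolding Lambda_sum[of L] by (simp add: tens_sum_left tens_scale_left tens_scale_right)
  also have "\<dots> = (\<Sum>p\<in>UNIV. \<Sum>r\<in>UNIV. \<Sum>J\<in>UNIV. coframe L p *\<^sub>C (?D p r \<otimes> frame J r *\<^sub>C Lambda J K))"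
    by (rule sum_swap3)
  also have "\<dots> = (\<Sum>p\<in>UNIV. \<Sum>r\<in>UNIV. coframe L p *\<^sub>C (?D p r \<otimes> (\<Sum>J\<in>UNIV. frame J r *\<^sub>C Lambda J K)))"
    by (simp only: tens_sum_right cvs.scale_sum_right)
  also have "\<dots> = (\<Sum>p\<in>UNIV. \<Sum>r\<in>UNIV. \<Sum>q\<in>UNIV. (coframe L p * frame K q) *\<^sub>C (?D p r \<otimes> ?D r q))"
    unfolding frame by (simp only: tens_sum_right tens_scale_right cvs.scale_sum_right scaleC_scaleC)
  also have "\<dots> = (\<Sum>p\<in>UNIV. \<Sum>q\<in>UNIV. \<Sum>r\<in>UNIV. (coframe L p * frame K q) *\<^sub>C (?D p r \<otimes> ?D r q))"
    by (rule sum.cong[OF refl], rule sum.swap)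
  also have "\<dots> = (\<Sum>p\<in>UNIV. \<Sum>q\<in>UNIV. (coframe L p * frame K q) *\<^sub>C Delta (?D p q))"
  proof -
    have "(\<Sum>r\<in>UNIV. ?D p r \<otimes> ?D r q) = Delta (?D p q)" for p q
      by (simp add: D(2) Delta_M Delta_Mdi sum_product tens_mult_tens sum_UNIV_prod)
    then show ?thesis by (simp flip: cvs.scale_sum_right)
  qed
  also have "\<dots> = Delta (Lambda L K)"
    by (simp only: Lambda_sum clinear_sum[OF D(1)] clinear_scale[OF D(1)])
  finally show ?thesis ..
qed

end

section \<open>Invariance and centrality of the norm\<close>

context quantum_minkowski
begin

definition norm_elt :: "sign \<Rightarrow> 'e"
  where "norm_elt s = (\<Sum>I\<in>UNIV. \<Sum>J\<in>UNIV. G s $ I $ J *\<^sub>C (X s I * X s J))"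

lemma iota_linear: "clinear iota"
  using iota_hom by (simp add: alg_hom_def)

text \<open>Moving \<open>b\<close> to the left past two coordinates convolves it with \<open>F\<close> twice; the metric absorbs both
  convolutions.\<close>

lemma norm_elt_iota: "norm_elt s * iota b = iota b * norm_elt s"
proof -
  have "norm_elt s * iota b = (\<Sum>I\<in>UNIV. \<Sum>J\<in>UNIV. \<Sum>L\<in>UNIV. \<Sum>K\<in>UNIV.
     iota (G s $ I $ J *\<^sub>C F_op s I K (F_op s J L b)) * (X s K * X s L))"
  proof -
    have "X s I * X s J * iota b = (\<Sum>L\<in>UNIV. \<Sum>K\<in>UNIV. iota (F_op s I K (F_op s J L b)) * (X s K * X s L))" for I J
    proof -
      have "X s I * X s J * iota b = (\<Sum>L\<in>UNIV. (X s I * iota (F_op s J L b)) * X s L)"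
        by (simp only: mult.assoc[of "X s I" "X s J"] X_iota[of s J] sum_distrib_left mult.assoc)
      then show ?thesis by (simp only: X_iota sum_distrib_right mult.assoc)
    qed
    then show ?thesis
      by (simp add: norm_elt_def sum_distrib_right sum_distrib_left mult_scaleC_left cvs.scale_sum_right clinear_scale[OF iota_linear])
  qed
  also have "\<dots> = (\<Sum>I\<in>UNIV. \<Sum>L\<in>UNIV. \<Sum>K\<in>UNIV. \<Sum>J\<in>UNIV.
     iota (G s $ I $ J *\<^sub>C F_op s I K (F_op s J L b)) * (X s K * X s L))"
    by (rule sum.cong[OF refl], rule sum_swap3)
  also have "\<dots> = (\<Sum>L\<in>UNIV. \<Sum>K\<in>UNIV. \<Sum>I\<in>UNIV. \<Sum>J\<in>UNIV.
     iota (G s $ I $ J *\<^sub>C F_op s I K (F_op s J L b)) * (X s K * X s L))"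
    by (rule sum_swap3)
  also have "\<dots> = (\<Sum>L\<in>UNIV. \<Sum>K\<in>UNIV. iota (G s $ K $ L *\<^sub>C b) * (X s K * X s L))"
  proof -
    have "(\<Sum>I\<in>UNIV. \<Sum>J\<in>UNIV. iota (G s $ I $ J *\<^sub>C F_op s I K (F_op s J L b))) = iota (G s $ K $ L *\<^sub>C b)"
      for K L
      by (simp only: F_preserves_G flip: clinear_sum[OF iota_linear])
    then show ?thesis by (simp only: flip: sum_distrib_right)
  qed
  also have "\<dots> = iota b * norm_elt s"
    by (subst sum.swap) (simp add: norm_elt_def sum_distrib_left clinear_scale[OF iota_linear] mult_scaleC_left mult_scaleC_right)
  finally show ?thesis .
qed

text \<open>Moving \<open>\<psi>\<close> past the two coordinates of each term produces two factors \<open>F(S(T))\<close>, contracted with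
  the metric as in \<open>F_corep_preserves_G\<close>. The cases of interest are coordinates and both kinds of spinors.\<close>

lemma norm_elt_commute:
  fixes T :: "'i::finite \<Rightarrow> 'i \<Rightarrow> 'a"
  assumes Delta_T: "\<And>i j. Delta (T i j) = (\<Sum>k\<in>UNIV. T i k \<otimes> T k j)"
    and counit_T: "\<And>i j. counit (T i j) = kron i j"
    and psi: "\<And>i K. \<psi> i * X t K = (\<Sum>N\<in>UNIV. \<Sum>m\<in>UNIV. F t K N (S (T i m)) *\<^sub>C (X t N * \<psi> m))"
  shows "norm_elt t * \<psi> i = \<psi> i * norm_elt t"
proof -
  define A where "A I K i m = F t I K (S (T i m))" for I K i m
  have psi: "\<psi> i * X t K = (\<Sum>N\<in>UNIV. \<Sum>m\<in>UNIV. A K N i m *\<^sub>C (X t N * \<psi> m))" for i K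
    unfolding A_def by (rule psi)
  have GAA: "(\<Sum>I\<in>UNIV. \<Sum>J\<in>UNIV. \<Sum>m\<in>UNIV. G t $ I $ J * A I K i m * A J L m p) = G t $ K $ L * kron i p" for K L p
    unfolding A_def by (rule F_corep_preserves_G[OF Delta_T counit_T])
  have two: "\<psi> i * (X t I * X t J) = (\<Sum>N\<in>UNIV. \<Sum>m\<in>UNIV. \<Sum>L\<in>UNIV. \<Sum>p\<in>UNIV.
      (A I N i m * A J L m p) *\<^sub>C (X t N * X t L * \<psi> p))" for I J
  proof -
    have "\<psi> i * (X t I * X t J) = (\<Sum>N\<in>UNIV. \<Sum>m\<in>UNIV. A I N i m *\<^sub>C (X t N * (\<psi> m * X t J)))"
      by (simp add: psi[of i I] sum_distrib_right mult_scaleC_left mult.assoc flip: mult.assoc[of "\<psi> i"])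
    then show ?thesis
      by (simp add: psi[of _ J] sum_distrib_left mult_scaleC_right cvs.scale_sum_right mult.assoc)
  qed
  have "\<psi> i * norm_elt t = (\<Sum>I\<in>UNIV. \<Sum>J\<in>UNIV. \<Sum>N\<in>UNIV. \<Sum>m\<in>UNIV. \<Sum>L\<in>UNIV. \<Sum>p\<in>UNIV.
      (G t $ I $ J * A I N i m * A J L m p) *\<^sub>C (X t N * X t L * \<psi> p))"
    by (simp add: norm_elt_def sum_distrib_left mult_scaleC_right two cvs.scale_sum_right mult.assoc)
  also have "\<dots> = (\<Sum>I\<in>UNIV. \<Sum>J\<in>UNIV. \<Sum>N\<in>UNIV. \<Sum>L\<in>UNIV. \<Sum>p\<in>UNIV. \<Sum>m\<in>UNIV.
      (G t $ I $ J * A I N i m * A J L m p) *\<^sub>C (X t N * X t L * \<psi> p))"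
    by (rule sum.cong[OF refl], rule sum.cong[OF refl], rule sum.cong[OF refl], rule sum_swap3)
  also have "\<dots> = (\<Sum>I\<in>UNIV. \<Sum>N\<in>UNIV. \<Sum>L\<in>UNIV. \<Sum>p\<in>UNIV. \<Sum>J\<in>UNIV. \<Sum>m\<in>UNIV.
      (G t $ I $ J * A I N i m * A J L m p) *\<^sub>C (X t N * X t L * \<psi> p))"
    by (rule sum.cong[OF refl], rule sum_swap4)
  also have "\<dots> = (\<Sum>N\<in>UNIV. \<Sum>L\<in>UNIV. \<Sum>p\<in>UNIV. \<Sum>I\<in>UNIV. \<Sum>J\<in>UNIV. \<Sum>m\<in>UNIV.
      (G t $ I $ J * A I N i m * A J L m p) *\<^sub>C (X t N * X t L * \<psi> p))"
    by (rule sum_swap4)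
  also have "\<dots> = (\<Sum>N\<in>UNIV. \<Sum>L\<in>UNIV. \<Sum>p\<in>UNIV. (G t $ N $ L * kron i p) *\<^sub>C (X t N * X t L * \<psi> p))"
    by (simp only: GAA flip: cvs.scale_sum_left)
  also have "\<dots> = (\<Sum>N\<in>UNIV. \<Sum>L\<in>UNIV. \<Sum>p\<in>UNIV. kron i p *\<^sub>C G t $ N $ L *\<^sub>C (X t N * X t L * \<psi> p))"
    by (simp add: mult.commute)
  also have "\<dots> = norm_elt t * \<psi> i"
    by (simp add: norm_elt_def sum_distrib_right mult_scaleC_left del: cvs.scale_scale)
  finally show ?thesis ..
qed

lemma DL_norm_elt: "DL (norm_elt s) = 1 \<otimes> norm_elt s"
proof -
  have D: "clinear DL" "DL (x * y) = DL x * DL y" for x y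
    using DL_hom by (simp_all add: alg_hom_def)
  have "DL (norm_elt s) = (\<Sum>I\<in>UNIV. \<Sum>J\<in>UNIV. \<Sum>K\<in>UNIV. \<Sum>L\<in>UNIV.
     G s $ I $ J *\<^sub>C ((Lambda I K * Lambda J L) \<otimes> (X s K * X s L)))"
    by (simp add: norm_elt_def clinear_sum[OF D(1)] clinear_scale[OF D(1)] D(2) DL_X sum_product
      tens_mult_tens cvs.scale_sum_right)
  also have "\<dots> = (\<Sum>I\<in>UNIV. \<Sum>K\<in>UNIV. \<Sum>L\<in>UNIV. \<Sum>J\<in>UNIV.
     G s $ I $ J *\<^sub>C ((Lambda I K * Lambda J L) \<otimes> (X s K * X s L)))"
    by (rule sum.cong[OF refl], rule sum_swap3)
  also have "\<dots> = (\<Sum>K\<in>UNIV. \<Sum>L\<in>UNIV. \<Sum>I\<in>UNIV. \<Sum>J\<in>UNIV.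
     G s $ I $ J *\<^sub>C ((Lambda I K * Lambda J L) \<otimes> (X s K * X s L)))"
    by (rule sum_swap3)
  also have "\<dots> = (\<Sum>K\<in>UNIV. \<Sum>L\<in>UNIV. (G s $ K $ L *\<^sub>C 1) \<otimes> (X s K * X s L))"
    unfolding Lambda_preserves_G[symmetric] by (simp only: tens_sum_left tens_scale_left)
  also have "\<dots> = 1 \<otimes> norm_elt s"
    by (simp add: norm_elt_def tens_sum_right tens_scale_left tens_scale_right)
  finally show ?thesis .
qed

lemma DR_norm_elt: "DR (norm_elt s) = norm_elt s \<otimes> 1"
proof -
  have D: "clinear DR" "DR (x * y) = DR x * DR y" for x y
    using DR_hom by (simp_all add: alg_hom_def)
  show ?thesis
    by (simp add: norm_elt_def clinear_sum[OF D(1)] clinear_scale[OF D(1)] D(2) DR_X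
      tens_mult_tens tens_sum_left tens_scale_left)
qed

end

theorem mainTheorem5:
  fixes eps epsu :: "2 \<Rightarrow> 2 \<Rightarrow> complex" and a :: real
    and star :: "'a::complex_algebra_1 \<Rightarrow> 'a"
    and Delta :: "'a \<Rightarrow> ('a, 'a) tensor"
    and counit :: "'a \<Rightarrow> complex"
    and S :: "'a \<Rightarrow> 'a"
    and M Md :: "2 \<Rightarrow> 2 \<Rightarrow> 'a"
    and f ft fd ftd :: "sign \<Rightarrow> 2 \<Rightarrow> 2 \<Rightarrow> 'a \<Rightarrow> complex"
    and sig :: "4 \<Rightarrow> 2 \<Rightarrow> 2 \<Rightarrow> complex"
    and iota :: "'a \<Rightarrow> 'e::complex_algebra_1"
    and X :: "sign \<Rightarrow> 4 \<Rightarrow> 'e"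
    and th thd :: "sign \<Rightarrow> 2 \<Rightarrow> 'e"
    and DL :: "'e \<Rightarrow> ('a, 'e) tensor"
    and DR :: "'e \<Rightarrow> ('e, 'a) tensor"
    and N :: "sign \<Rightarrow> 'e"
  assumes "quantum_minkowski eps epsu a star Delta counit S M Md f ft fd ftd sig iota X th thd DL DR"
    and "\<And>s. N s = (\<Sum>I\<in>UNIV. \<Sum>J\<in>UNIV.
      (quantum_pauli.G eps epsu a sig s $ I $ J) *\<^sub>C (X s I * X s J))"
  shows "\<forall>s. DL (N s) = 1 \<otimes> N s \<and> DR (N s) = N s \<otimes> 1
    \<and> (\<forall>b. N s * iota b = iota b * N s)
    \<and> (\<forall>t P. N s * X t P = X t P * N s)
    \<and> (\<forall>t \<alpha>. N s * th t \<alpha> = th t \<alpha> * N s)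
    \<and> (\<forall>t \<alpha>. N s * thd t \<alpha> = thd t \<alpha> * N s)"
proof -
  interpret quantum_minkowski eps epsu a star Delta counit S M Md f ft fd ftd sig iota X th thd DL DR
    by (rule assms(1))
  have N: "N = norm_elt" by (simp add: fun_eq_iff assms(2) norm_elt_def)
  have "norm_elt s * X t P = X t P * norm_elt s" for s t P
    by (rule norm_elt_commute[of Lambda "X t"]) (rule Delta_Lambda counit_Lambda X_X)+
  moreover have "norm_elt s * th t \<alpha> = th t \<alpha> * norm_elt s" for s t \<alpha>
    by (rule norm_elt_commute[of M "th t"]) (rule Delta_M counit_M th_X)+
  moreover have "norm_elt s * thd t \<alpha> = thd t \<alpha> * norm_elt s" for s t \<alpha>
    by (rule norm_elt_commute[of Md "thd t"]) (rule Delta_Md counit_Md thd_X)+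
  ultimately show ?thesis
    by (simp add: N DL_norm_elt DR_norm_elt norm_elt_iota)
qed

end
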